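(* Let $G$ be a finite group and let $A$ and $B$ be two $G$-injective square-lattice PEPS tensors with the same physical space. Suppose that they generate the same PEPS for every system size on the square lattice with periodic boundary conditions, i.e. $|\Psi_A\rangle=|\Psi_B\rangle$ on every $n\times m$ torus. Then there exist invertible matrices $X$ and $Y$ such that $$A = B\,(Y\otimes X\otimes Y^{-1}\otimes X^{-1}),$$ where the four factors act on the up, right, down and left virtual legs respectively.
   Context: A (translation-invariant) square-lattice PEPS tensor with physical space $\mathbb{C}^d$ and bond space $V=\mathbb{C}^D$ is a linear map $A: V\otimes V\otimes V^*\otimes V^*\to\mathbb{C}^d$; the four factors correspond to the up, right, down and left virtual legs. For invertible $Y,X$ (maps onto $V$ from a possibly relabelled bond space) write $A(Y\otimes X\otimes Y^{-1}\otimes X^{-1}):=A\circ\big(Y\otimes X\otimes (Y^{-1})^{T}\otimes (X^{-1})^{T}\big)$, with $T$ the dual map. For $n,m\ge 1$, $|\Psi_A\rangle\in(\mathbb{C}^d)^{\otimes nm}$ is obtained by placing $A$ on every vertex of the $n\times m$ torus and contracting the right leg of each vertex with the left leg of its right neighbour and the up leg with the down leg of its upper neighbour (via the pairing of $V$ and $V^*$). $A$ is $G$-injective (with respect to a representation $g\mapsto u_g$ of $G$ on $V$ that contains every irreducible representation of $G$ at least once) if (i) $A=A(u_g\otimes u_g\otimes u_g^{-1}\otimes u_g^{-1})$ for all $g\in G$; and (ii) there is a linear map $A^{-1}:\mathbb{C}^d\to V\otimes V\otimes V^*\otimes V^*$ with $A^{-1}A=\frac1{|G|}\sum_{g\in G}u_g\otimes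 u_g\otimes (u_g^{-1})^T\otimes(u_g^{-1})^T$. The tensors $A$ and $B$ may have different bond spaces and different representations of the same group $G$. *)

theory Defs
  imports
    "Jordan_Normal_Form.VS_Connect"
    "HOL-Analysis.Analysis"
begin

text \<open>
  Two matrix libraries are used. The fixed spaces \<open>\<complex>\<^sup>D\<close> and \<open>\<complex>\<^sup>d\<close> are the types \<open>complex^'n\<close> and \<open>complex^'p\<close>
  of HOL-Analysis. Irreducible representations range over all dimensions, so they live on
  \<^const>\<open>carrier_vec\<close> of Jordan_Normal_Form. The clashing names and the notation \<open>$\<close> are reserved for HOL-Analysis.
\<close>

hide_const (open) Matrix.mat Matrix.vec
hide_type (open) Matrix.vec
no_notation vec_index (infixl "$" 100)

definition kron :: "complex^'a^'b \<Rightarrow> complex^'c^'d \<Rightarrow> complex^('a \<times> 'c)^('b \<times> 'd)"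
    (infixr "\<otimes>\<^sub>K" 72) where
  "P \<otimes>\<^sub>K Q = (\<chi> i j. P $ fst i $ fst j * Q $ snd i $ snd j)"

text \<open>
  A PEPS tensor \<open>V \<otimes> V \<otimes> V\<^sup>* \<otimes> V\<^sup>* \<rightarrow> \<complex>\<^sup>d\<close> with \<open>V = complex^'a\<close> is its matrix, of type
  \<open>complex^('a \<times> 'a \<times> 'a \<times> 'a)^'p\<close>, with respect to the standard basis of \<open>V\<close> and its dual basis; the column
  index is (up, right, down, left). The dual map of a matrix is its transpose.
  In \<open>leg_map\<close>, \<open>Y\<close> and \<open>X\<close> map the bond space \<open>complex^'a\<close> to \<open>complex^'b\<close>.
\<close>

definition leg_map :: "complex^'a^'b \<Rightarrow> complex^'a^'b \<Rightarrow>
    complex^('a \<times> 'a \<times> 'a \<times> 'a)^('b \<times> 'b \<times> 'b \<times> 'b)" where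
  "leg_map Y X = Y \<otimes>\<^sub>K X \<otimes>\<^sub>K transpose (matrix_inv Y) \<otimes>\<^sub>K transpose (matrix_inv X)"

definition torus :: "nat \<Rightarrow> nat \<Rightarrow> (nat \<times> nat) set" where
  "torus n m = {..<n} \<times> {..<m}"

text \<open>
  The vector in \<open>(\<complex>\<^sup>d)\<^sup>\<otimes>\<^sup>n\<^sup>m\<close> is given by its coefficients, indexed by the physical configurations \<open>s\<close>.
  \<open>h (x, y)\<close> is the basis index on the edge from \<open>(x, y)\<close> to its right neighbour \<open>(x + 1, y)\<close>, and \<open>v (x, y)\<close>
  the one on the edge to its upper neighbour \<open>(x, y + 1)\<close>; \<open>(x + n - 1) mod n\<close> is the cyclic predecessor of \<open>x\<close>.
\<close>

definition peps_state :: "complex^('a::finite \<times> 'a \<times> 'a \<times> 'a)^'p \<Rightarrow> nat \<Rightarrow> nat \<Rightarrow>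
    (nat \<times> nat \<Rightarrow> 'p) \<Rightarrow> complex" where
  "peps_state A n m = (\<lambda>s \<in> torus n m \<rightarrow>\<^sub>E UNIV.
     \<Sum>h \<in> torus n m \<rightarrow>\<^sub>E UNIV. \<Sum>v \<in> torus n m \<rightarrow>\<^sub>E UNIV.
       \<Prod>(x, y) \<in> torus n m.
         A $ s (x, y) $ (v (x, y), h (x, y), v (x, (y + m - 1) mod m), h ((x + n - 1) mod n, y)))"

definition representation :: "('g, 'z) monoid_scheme \<Rightarrow> ('g \<Rightarrow> complex^'n^'n) \<Rightarrow> bool" where
  "representation G u \<longleftrightarrow> u \<one>\<^bsub>G\<^esub> = mat 1 \<and>
     (\<forall>g \<in> carrier G. \<forall>h \<in> carrier G. u (g \<otimes>\<^bsub>G\<^esub> h) = u g ** u h)"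

definition irreducible_representation ::
    "('g, 'z) monoid_scheme \<Rightarrow> nat \<Rightarrow> ('g \<Rightarrow> complex mat) \<Rightarrow> bool" where
  "irreducible_representation G k \<rho> \<longleftrightarrow>
     k > 0 \<and>
     (\<forall>g \<in> carrier G. \<rho> g \<in> carrier_mat k k) \<and>
     \<rho> \<one>\<^bsub>G\<^esub> = 1\<^sub>m k \<and>
     (\<forall>g \<in> carrier G. \<forall>h \<in> carrier G. \<rho> (g \<otimes>\<^bsub>G\<^esub> h) = \<rho> g * \<rho> h) \<and>
     (\<forall>W. VectorSpace.subspace class_ring W (module_vec TYPE(complex) k) \<longrightarrow>
        (\<forall>g \<in> carrier G. \<forall>w \<in> W. \<rho> g *\<^sub>v w \<in> W) \<longrightarrow>
        W = {0\<^sub>v k} \<or> W = carrier_vec k)"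

text \<open>
  \<open>\<rho>\<close> is contained in \<open>u\<close> if it is isomorphic to a subrepresentation of \<open>u\<close>, i.e. if there is an injective
  linear map \<open>f\<close> that intertwines \<open>\<rho>\<close> and \<open>u\<close>.
\<close>

definition contains_representation ::
    "('g, 'z) monoid_scheme \<Rightarrow> ('g \<Rightarrow> complex^'n^'n) \<Rightarrow> nat \<Rightarrow> ('g \<Rightarrow> complex mat) \<Rightarrow> bool" where
  "contains_representation G u k \<rho> \<longleftrightarrow>
     (\<exists>f :: complex Matrix.vec \<Rightarrow> complex^'n.
        (\<forall>v \<in> carrier_vec k. \<forall>w \<in> carrier_vec k. f (v + w) = f v + f w) \<and>
        (\<forall>c. \<forall>v \<in> carrier_vec k. f (c \<cdot>\<^sub>v v) = c *s f v) \<and>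
        inj_on f (carrier_vec k) \<and>
        (\<forall>g \<in> carrier G. \<forall>v \<in> carrier_vec k. f (\<rho> g *\<^sub>v v) = u g *v f v))"

definition G_injective :: "('g, 'z) monoid_scheme \<Rightarrow> ('g \<Rightarrow> complex^'a^'a) \<Rightarrow>
    complex^('a \<times> 'a \<times> 'a \<times> 'a)^'p \<Rightarrow> bool" where
  "G_injective G u A \<longleftrightarrow>
     representation G u \<and>
     (\<forall>k \<rho>. irreducible_representation G k \<rho> \<longrightarrow> contains_representation G u k \<rho>) \<and>
     (\<forall>g \<in> carrier G. A = A ** leg_map (u g) (u g)) \<and>
     (\<exists>L :: complex^'p^('a \<times> 'a \<times> 'a \<times> 'a).
        L ** A = (1 / real (card (carrier G))) *\<^sub>R (\<Sum>g \<in> carrier G. leg_map (u g) (u g)))"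

end

theory Submission
  imports Defs "HOL-Computational_Algebra.Fundamental_Theorem_Algebra" "HOL-Library.Function_Algebras"
begin

text \<open>
  A site tensor with fixed physical functional is an endomorphism of \<open>V \<otimes> V\<close> commuting with the group, and every
  such endomorphism occurs. Closing a column of \<open>m\<close> sites vertically gives all of \<open>End\<^sub>G (V\<^sup>\<otimes>\<^sup>m)\<close>, on which the trace
  form is nondegenerate; equality of the states on tori with two and three columns therefore yields trace preserving
  algebra isomorphisms \<open>\<Phi>\<^sub>m\<close> from \<open>End\<^sub>G (V\<^sub>A\<^sup>\<otimes>\<^sup>m)\<close> to \<open>End\<^sub>G (V\<^sub>B\<^sup>\<otimes>\<^sup>m)\<close>. Cutting a vertical edge by the projection onto an
  invariant vector shows that \<open>\<Phi>\<^sub>3\<close> restricts to \<open>\<Phi>\<^sub>2\<close> on each pair of legs, and the relation between the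
  transpositions of three legs then forces \<open>\<Phi>\<^sub>2\<close> to fix the swap. As in Tannaka reconstruction, the space of
  intertwiners for \<open>\<Phi>\<^sub>1\<close> is a cocommutative coalgebra, so it contains a group-like element \<open>X\<close>, which implements
  all \<open>\<Phi>\<^sub>m\<close>. After the gauge transformation \<open>X\<close> of the horizontal legs, the matrices on the vertical leg have equal
  traces of products and span the full matrix algebra, and Skolem--Noether provides \<open>Y\<close>.
\<close>

section \<open>Matrices over the complex numbers and isomorphisms of trace algebras\<close>

text \<open>An isomorphism given on each number of legs separately is implemented by many matrices,
  and those for one leg need not fit those for two. One matrix has to serve all numbers of legs, so
  the isomorphisms must be compatible with tensor products and with the exchange of legs; invariance
  of the exchange is what makes contractions of different legs commute. This is the difference
  between a monoidal and a symmetric monoidal equivalence.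

  Two devices replace the decomposition into irreducibles. The matrix \<open>swap\<close> is itself
  a combination of sites, the corner that sends the left index up and the down index to the right; a
  column of two sites containing it returns the other site up to a flip, so statements about columns
  become statements about sites. A matrix \<open>K\<close> with \<open>trace (u g ** K)\<close>
  equal to 1 at the identity and 0 elsewhere turns a double group average into a single one when
  inserted at an auxiliary index.

  Two columns make the isomorphisms well defined and three make them multiplicative. Heights two and
  three suffice because relations between transpositions already occur on three legs.\<close>

lemma sum_pair: "(\<Sum>x\<in>(UNIV::('a::finite \<times> 'b::finite) set). f x) = (\<Sum>a\<in>UNIV. \<Sum>b\<in>UNIV. f (a, b))"
  by (simp add: sum.cartesian_product)

lemma mult_nth: "(P ** Q) $ i $ j = (\<Sum>k\<in>UNIV. P $ i $ k * Q $ k $ j)"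
  by (simp add: matrix_matrix_mult_def)

lemma mat_nth: "mat c $ i $ j = (if i = j then c else 0)"
  by (simp add: mat_def)

lemma kron_nth [simp]: "(P \<otimes>\<^sub>K Q) $ (a, b) $ (c, d) = P $ a $ c * Q $ b $ d"
  by (simp add: kron_def)

lemma sum_matrix_nth: "(\<Sum>s\<in>S. M s) $ i $ j = (\<Sum>s\<in>S. M s $ i $ j)"
  by (induction S rule: infinite_finite_induct) auto

lemma sum_if_eq [simp]:
  "(\<Sum>k\<in>UNIV. (if k = a then f k else 0)) = (f (a :: 'a::finite) :: 'c::comm_monoid_add)"
  "(\<Sum>k\<in>UNIV. (if a = k then f k else 0)) = f a"
  by simp_all

lemma mult_if_zero [simp]:
  "(if P then a else 0) * b = (if P then a * b else (0 :: 'a::mult_zero))"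
  "b * (if P then a else 0) = (if P then b * a else 0)"
  by simp_all

lemma sum_if_const [simp]:
  "(\<Sum>k\<in>S. (if P then f k else 0)) = (if P then (\<Sum>k\<in>S. f k) else 0)"
  by simp

lemma kron_mult: "(P \<otimes>\<^sub>K Q) ** (R \<otimes>\<^sub>K S) = (P ** R) \<otimes>\<^sub>K (Q ** S)"
  by (auto simp: vec_eq_iff mult_nth sum_pair sum_product mult_ac intro!: sum.cong)

lemma kron_one: "mat 1 \<otimes>\<^sub>K mat 1 = mat 1"
  by (auto simp: vec_eq_iff mat_nth)

lemma trace_kron: "trace (P \<otimes>\<^sub>K Q) = trace P * trace Q"
  by (simp add: trace_def sum_pair sum_product)

definition cscale :: "complex \<Rightarrow> complex^'a^'b \<Rightarrow> complex^'a^'b" where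
  "cscale c M = (\<chi> i j. c * M $ i $ j)"

lemma cscale_nth [simp]: "cscale c M $ i $ j = c * M $ i $ j"
  by (simp add: cscale_def)

lemma cscale_mult [simp]:
  "cscale c P ** Q = cscale c (P ** Q)" "P ** cscale c Q = cscale c (P ** Q)"
  by (simp_all add: vec_eq_iff mult_nth sum_distrib_left mult_ac)

lemma cscale_cscale [simp]: "cscale c (cscale d P) = cscale (c * d) P"
  by (simp add: vec_eq_iff mult_ac)

lemma cscale_one [simp]: "cscale 1 P = P" "cscale 0 P = 0" "cscale c 0 = 0"
  by (simp_all add: vec_eq_iff)

lemma cscale_add: "cscale c (P + Q) = cscale c P + cscale c Q" "cscale (c + d) P = cscale c P + cscale d P"
  "cscale c (P - Q) = cscale c P - cscale c Q"
  by (simp_all add: vec_eq_iff algebra_simps)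

lemma cscale_sum: "cscale c (\<Sum>s\<in>S. M s) = (\<Sum>s\<in>S. cscale c (M s))"
  by (simp add: vec_eq_iff sum_matrix_nth sum_distrib_left)

lemma cscale_kron: "cscale c P \<otimes>\<^sub>K Q = cscale c (P \<otimes>\<^sub>K Q)" "P \<otimes>\<^sub>K cscale c Q = cscale c (P \<otimes>\<^sub>K Q)"
  by (simp_all add: vec_eq_iff)

lemma trace_cscale: "trace (cscale c P) = c * trace P"
  by (simp add: trace_def sum_distrib_left)

lemma trace_sum: "trace (\<Sum>s\<in>S. M s) = (\<Sum>s\<in>S. trace (M s))"
  unfolding trace_def sum_matrix_nth by (rule sum.swap)

lemma sum_mult: "(\<Sum>s\<in>S. M s) ** N = (\<Sum>s\<in>S. M s ** N)"
  "N' ** (\<Sum>s\<in>S. M s) = (\<Sum>s\<in>S. N' ** M s)"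
  by (induction S rule: infinite_finite_induct)
     (simp_all add: vec_eq_iff mult_nth sum.distrib algebra_simps)

lemma matrix_diff_rdistrib: "(P - Q) ** (R::complex^'a^'b) = P ** R - Q ** R"
  by (simp add: vec_eq_iff mult_nth algebra_simps sum_subtractf)

section \<open>Complex subspaces of matrices and algebras with a nondegenerate trace form\<close>

definition csubspace :: "(complex^'a^'b) set \<Rightarrow> bool" where
  "csubspace E \<longleftrightarrow> 0 \<in> E \<and> (\<forall>x\<in>E. \<forall>y\<in>E. x + y \<in> E) \<and> (\<forall>c. \<forall>x\<in>E. cscale c x \<in> E)"

lemma csubspace_sum:
  assumes "csubspace E" "\<And>s. s \<in> S \<Longrightarrow> M s \<in> E"
  shows "(\<Sum>s\<in>S. M s) \<in> E"
  using assms(2)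
  by (induction S rule: infinite_finite_induct) (use assms(1) in \<open>auto simp: csubspace_def\<close>)

lemma csubspace_diff:
  assumes "csubspace E" "x \<in> E" "y \<in> E"
  shows "x - y \<in> E"
proof -
  have eq: "x - y = x + cscale (-1) y" by (simp add: vec_eq_iff)
  show ?thesis unfolding eq using assms unfolding csubspace_def by blast
qed

definition subalgebra :: "(complex^'a^'a) set \<Rightarrow> bool" where
  "subalgebra E \<longleftrightarrow> csubspace E \<and> mat 1 \<in> E \<and> (\<forall>x\<in>E. \<forall>y\<in>E. x ** y \<in> E)"

definition trace_nondegenerate :: "(complex^'a^'a) set \<Rightarrow> bool" where
  "trace_nondegenerate E \<longleftrightarrow> (\<forall>x\<in>E. (\<forall>y\<in>E. trace (x ** y) = 0) \<longrightarrow> x = 0)"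

definition lincomb :: "('s::finite \<Rightarrow> complex^'a^'b) \<Rightarrow> ('s \<Rightarrow> complex) \<Rightarrow> complex^'a^'b" where
  "lincomb P \<xi> = (\<Sum>s\<in>UNIV. cscale (\<xi> s) (P s))"

lemma lincomb_nth: "lincomb P \<xi> $ i $ j = (\<Sum>s\<in>UNIV. \<xi> s * P s $ i $ j)"
  by (simp add: lincomb_def sum_matrix_nth)

lemma lincomb_add: "lincomb P \<xi> + lincomb P \<eta> = lincomb P (\<lambda>s. \<xi> s + \<eta> s)"
  by (simp add: vec_eq_iff lincomb_nth sum.distrib algebra_simps)

lemma lincomb_diff: "lincomb P \<xi> - lincomb P \<eta> = lincomb P (\<lambda>s. \<xi> s - \<eta> s)"
  by (simp add: vec_eq_iff lincomb_nth sum_subtractf algebra_simps)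

lemma lincomb_cscale: "cscale c (lincomb P \<xi>) = lincomb P (\<lambda>s. c * \<xi> s)"
  by (simp add: vec_eq_iff lincomb_nth sum_distrib_left mult_ac)

lemma csubspace_lincomb: "csubspace (range (lincomb P))"
proof -
  have "0 = lincomb P (\<lambda>_. 0)" by (simp add: vec_eq_iff lincomb_nth)
  then show ?thesis
    unfolding csubspace_def by (auto simp: lincomb_add lincomb_cscale)
qed

lemma lincomb_single: "P s = lincomb P (\<lambda>t. if t = s then 1 else 0)"
  by (simp add: vec_eq_iff lincomb_nth)

lemma lincomb_mem: "P s \<in> range (lincomb P)"
  using lincomb_single by blast

definition alg_iso :: "(complex^'a^'a) set \<Rightarrow> (complex^'b^'b) set \<Rightarrow> (complex^'a^'a \<Rightarrow> complex^'b^'b) \<Rightarrow> bool" where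
  "alg_iso E F \<Phi> \<longleftrightarrow> bij_betw \<Phi> E F \<and> \<Phi> (mat 1) = mat 1 \<and>
    (\<forall>x\<in>E. \<forall>y\<in>E. \<Phi> (x + y) = \<Phi> x + \<Phi> y \<and> \<Phi> (x ** y) = \<Phi> x ** \<Phi> y) \<and>
    (\<forall>c. \<forall>x\<in>E. \<Phi> (cscale c x) = cscale c (\<Phi> x)) \<and> (\<forall>x\<in>E. trace (\<Phi> x) = trace x)"

lemma alg_isoD:
  assumes "alg_iso E F \<Phi>"
  shows "x \<in> E \<Longrightarrow> \<Phi> x \<in> F" "inj_on \<Phi> E" "\<Phi> (mat 1) = mat 1"
    "x \<in> E \<Longrightarrow> y \<in> E \<Longrightarrow> \<Phi> (x + y) = \<Phi> x + \<Phi> y"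
    "x \<in> E \<Longrightarrow> y \<in> E \<Longrightarrow> \<Phi> (x ** y) = \<Phi> x ** \<Phi> y"
    "x \<in> E \<Longrightarrow> \<Phi> (cscale c x) = cscale c (\<Phi> x)"
    "x \<in> E \<Longrightarrow> trace (\<Phi> x) = trace x"
    "z \<in> F \<Longrightarrow> \<exists>x\<in>E. \<Phi> x = z"
  using assms by (auto simp: alg_iso_def bij_betw_def)

lemma alg_iso_zero: "alg_iso E F \<Phi> \<Longrightarrow> subalgebra E \<Longrightarrow> \<Phi> 0 = 0"
  using alg_isoD(6)[where E=E and F=F and \<Phi>=\<Phi> and x=0 and c=0] by (auto simp: subalgebra_def csubspace_def)

lemma alg_iso_sum:
  assumes "alg_iso E F \<Phi>" "subalgebra E" "finite S" "\<And>s. s \<in> S \<Longrightarrow> M s \<in> E"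
  shows "\<Phi> (\<Sum>s\<in>S. M s) = (\<Sum>s\<in>S. \<Phi> (M s))"
  using assms(3,4)
proof (induction S rule: finite_induct)
  case empty
  then show ?case using alg_iso_zero[OF assms(1,2)] by simp
next
  case (insert a S)
  have "sum M S \<in> E" using csubspace_sum[of E S M] assms(2) insert by (auto simp: subalgebra_def)
  then show ?case using insert alg_isoD(4)[OF assms(1), where x="M a" and y="sum M S"] by simp
qed

lemma trace_lincomb2: "trace (lincomb P \<xi> ** lincomb Q \<eta>) = (\<Sum>s\<in>UNIV. \<Sum>t\<in>UNIV. \<xi> s * \<eta> t * trace (P s ** Q t))"
  unfolding lincomb_def sum_mult(1) by (simp add: sum_mult(2) cscale_sum trace_sum trace_cscale mult_ac)

lemma trace_lincomb3: "trace (lincomb P \<xi> ** lincomb Q \<eta> ** lincomb R \<zeta>)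
   = (\<Sum>s\<in>UNIV. \<Sum>t\<in>UNIV. \<Sum>r\<in>UNIV. \<xi> s * \<eta> t * \<zeta> r * trace (P s ** Q t ** R r))"
proof -
  have "lincomb P \<xi> ** lincomb Q \<eta> ** lincomb R \<zeta>
    = (\<Sum>s\<in>UNIV. \<Sum>t\<in>UNIV. \<Sum>r\<in>UNIV. cscale (\<xi> s * \<eta> t * \<zeta> r) (P s ** Q t ** R r))"
    unfolding lincomb_def sum_mult(1)
    by (rule sum.cong, rule refl) (simp add: sum_mult cscale_sum mult_ac, rule sum.swap)
  then show ?thesis by (simp add: trace_sum trace_cscale)
qed

text \<open>Traces of two factors decide when a combination vanishes, because the trace form is
  nondegenerate on both sides; this makes the map well defined and injective. Traces of three
  factors test a product against every element of the algebra and so give multiplicativity.\<close>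

lemma trace_lincomb_iso:
  fixes P :: "'s::finite \<Rightarrow> complex^'a^'a" and Q :: "'s \<Rightarrow> complex^'b^'b"
  assumes E: "range (lincomb P) = E" and F: "range (lincomb Q) = F"
    and subE: "subalgebra E" and subF: "subalgebra F"
    and ndE: "trace_nondegenerate E" and ndF: "trace_nondegenerate F"
    and tr2: "\<And>s t. trace (P s ** P t) = trace (Q s ** Q t)"
    and tr3: "\<And>s t r. trace (P s ** P t ** P r) = trace (Q s ** Q t ** Q r)"
  obtains \<Phi> where "alg_iso E F \<Phi>" "\<And>\<xi>. \<Phi> (lincomb P \<xi>) = lincomb Q \<xi>"
proof -
  have T2: "trace (lincomb P \<xi> ** lincomb P \<eta>) = trace (lincomb Q \<xi> ** lincomb Q \<eta>)" for \<xi> \<eta>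
    by (simp add: trace_lincomb2 tr2)
  have T3: "trace (lincomb P \<xi> ** lincomb P \<eta> ** lincomb P \<zeta>)
     = trace (lincomb Q \<xi> ** lincomb Q \<eta> ** lincomb Q \<zeta>)" for \<xi> \<eta> \<zeta>
    by (simp add: trace_lincomb3 tr3)
  have zero: "lincomb P \<xi> = 0 \<longleftrightarrow> lincomb Q \<xi> = 0" for \<xi>
  proof
    assume "lincomb P \<xi> = 0"
    then have "trace (lincomb Q \<xi> ** y) = 0" if "y \<in> F" for y
      using that T2[of \<xi>] F by (auto simp: trace_def)
    then show "lincomb Q \<xi> = 0" using ndF F by (auto simp: trace_nondegenerate_def)
  next
    assume "lincomb Q \<xi> = 0"
    then have "trace (lincomb P \<xi> ** y) = 0" if "y \<in> E" for y
      using that T2[of \<xi>] E by (auto simp: trace_def)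
    then show "lincomb P \<xi> = 0" using ndE E by (auto simp: trace_nondegenerate_def)
  qed
  have eq: "lincomb P \<xi> = lincomb P \<eta> \<longleftrightarrow> lincomb Q \<xi> = lincomb Q \<eta>" for \<xi> \<eta>
    using zero[of "\<lambda>s. \<xi> s - \<eta> s"] by (simp flip: lincomb_diff)
  define \<Phi> where "\<Phi> x = lincomb Q (SOME \<xi>. lincomb P \<xi> = x)" for x
  have \<Phi>: "\<Phi> (lincomb P \<xi>) = lincomb Q \<xi>" for \<xi>
    unfolding \<Phi>_def by (rule eq[THEN iffD1]) (rule someI[where P="\<lambda>\<xi>'. lincomb P \<xi>' = lincomb P \<xi>"], rule refl)
  have mult: "\<Phi> (x ** y) = \<Phi> x ** \<Phi> y" if xy: "x \<in> E" "y \<in> E" for x y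
  proof -
    have "x ** y \<in> E" using that subE by (auto simp: subalgebra_def)
    then obtain \<zeta> where "x ** y = lincomb P \<zeta>" using E by blast
    moreover obtain \<xi> where "x = lincomb P \<xi>" using xy(1) E by blast
    moreover obtain \<eta> where "y = lincomb P \<eta>" using xy(2) E by blast
    ultimately have *: "x = lincomb P \<xi>" "y = lincomb P \<eta>" "x ** y = lincomb P \<zeta>" by auto
    define d where "d = lincomb Q \<xi> ** lincomb Q \<eta> - lincomb Q \<zeta>"
    have dF: "d \<in> F" unfolding d_def using subF F by (auto simp: subalgebra_def intro!: csubspace_diff)
    have "trace (d ** z) = 0" if "z \<in> F" for z
    proof -
      obtain \<theta> where z: "z = lincomb Q \<theta>" using \<open>z \<in> F\<close> F by auto
      have "trace (d ** z) = trace (lincomb Q \<xi> ** lincomb Q \<eta> ** z) - trace (lincomb Q \<zeta> ** z)"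
        by (simp add: d_def matrix_diff_rdistrib trace_sub)
      also have "\<dots> = trace (lincomb P \<xi> ** lincomb P \<eta> ** lincomb P \<theta>) - trace (lincomb P \<zeta> ** lincomb P \<theta>)"
        unfolding z T2 T3 ..
      finally show ?thesis using * by simp
    qed
    then have "d = 0" using dF ndF by (auto simp: trace_nondegenerate_def)
    then show ?thesis using * \<Phi> by (simp add: d_def)
  qed
  have bij: "bij_betw \<Phi> E F"
    unfolding bij_betw_def
  proof
    show "inj_on \<Phi> E" unfolding E[symmetric] by (auto simp: inj_on_def \<Phi> eq)
    show "\<Phi> ` E = F" unfolding E[symmetric] F[symmetric] image_image \<Phi> ..
  qed
  have one: "\<Phi> (mat 1) = mat 1"
  proof -
    obtain y where y: "y \<in> E" "\<Phi> y = mat 1"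
      using bij subF by (auto simp: bij_betw_def subalgebra_def)
    have 1: "mat 1 \<in> E" using subE by (simp add: subalgebra_def)
    then have "\<Phi> (y ** mat 1) = \<Phi> (mat 1)" using mult[OF y(1) 1] y(2) by simp
    then show ?thesis using y by simp
  qed
  have tr: "trace (\<Phi> x) = trace x" if x: "x \<in> E" for x
  proof -
    have "mat 1 \<in> E" using subE by (simp add: subalgebra_def)
    then obtain \<eta> where \<eta>: "mat 1 = lincomb P \<eta>" using E by blast
    obtain \<xi> where "x = lincomb P \<xi>" using x E by blast
    then show ?thesis using \<eta> T2[of \<xi> \<eta>] \<Phi>[of \<xi>] \<Phi>[of \<eta>] one by (metis matrix_mul_rid)
  qed
  have "alg_iso E F \<Phi>"
    unfolding alg_iso_def
  proof (intro conjI ballI allI)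
    fix x y assume "x \<in> E" "y \<in> E"
    then obtain \<xi> \<eta> where "x = lincomb P \<xi>" "y = lincomb P \<eta>" using E by blast
    then show "\<Phi> (x + y) = \<Phi> x + \<Phi> y" by (simp add: lincomb_add \<Phi>)
  next
    fix c x assume "x \<in> E"
    then obtain \<xi> where "x = lincomb P \<xi>" using E by blast
    then show "\<Phi> (cscale c x) = cscale c (\<Phi> x)" by (simp add: lincomb_cscale \<Phi>)
  qed (use bij one tr mult in auto)
  then show ?thesis using \<Phi> that by blast
qed

section \<open>Twirling over a finite group\<close>

definition centralizer :: "('g, 'z) monoid_scheme \<Rightarrow> ('g \<Rightarrow> complex^'n^'n) \<Rightarrow> (complex^'n^'n) set" where
  "centralizer G u = {x. \<forall>g\<in>carrier G. u g ** x = x ** u g}"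

definition outer :: "complex^'a \<Rightarrow> complex^'b \<Rightarrow> complex^'b^'a" where
  "outer a b = (\<chi> i j. a $ i * b $ j)"

lemma outer_nth [simp]: "outer a b $ i $ j = a $ i * b $ j"
  by (simp add: outer_def)

lemma axis_nth: "axis i c $ j = (if j = i then c else 0)"
  by (simp add: axis_def)

lemma outer_mult_left: "M ** outer a b = outer (M *v a) b"
  by (simp add: vec_eq_iff mult_nth matrix_vector_mult_def sum_distrib_left sum_distrib_right mult_ac)

lemma outer_mult_right: "outer a b ** M = outer a (b v* M)"
  by (simp add: vec_eq_iff mult_nth vector_matrix_mult_def sum_distrib_left mult_ac)

lemma matrix_vector_mult_sum: "(\<Sum>s\<in>S. M s) *v a = (\<Sum>s\<in>S. M s *v a)"
  by (induction S rule: infinite_finite_induct) (auto simp: matrix_vector_mult_add_rdistrib)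

lemma matrix_vector_mult_sum_right: "M *v (\<Sum>s\<in>S. a s) = (\<Sum>s\<in>S. (M::complex^'a^'b) *v a s)"
  by (induction S rule: infinite_finite_induct) (auto simp: matrix_vector_right_distrib)

lemma trace_nondegenerate_UNIV: "trace_nondegenerate (UNIV :: (complex^'a^'a) set)"
  unfolding trace_nondegenerate_def
proof (intro ballI impI)
  fix x :: "complex^'a^'a"
  assume 0: "\<forall>y\<in>UNIV. trace (x ** y) = 0"
  have "trace (x ** outer (axis j 1) (axis i 1)) = x $ i $ j" for i j
    by (simp add: trace_def mult_nth axis_nth)
  then show "x = 0" using 0 by (simp add: vec_eq_iff)
qed

lemma matrix_inv_eqI:
  fixes P :: "complex^'a^'b"
  assumes "Q ** P = mat 1" "P ** Q = mat 1"
  shows "matrix_inv P = Q"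
proof -
  have inv: "matrix_inv P ** P = mat 1"
    unfolding matrix_inv_def by (rule someI2[where a = Q]) (use assms in auto)
  have "matrix_inv P = matrix_inv P ** (P ** Q)" using assms by simp
  also have "\<dots> = matrix_inv P ** P ** Q" by (simp only: matrix_mul_assoc)
  also have "\<dots> = Q" using inv by simp
  finally show ?thesis .
qed

section \<open>Representations of a finite group and their commutants\<close>

locale finite_group = group G for G (structure) +
  assumes fin: "finite (carrier G)"

lemma (in group) rep_inv:
  assumes "representation G u" "g \<in> carrier G"
  shows "u (inv g) ** u g = mat 1" "u g ** u (inv g) = mat 1" "matrix_inv (u g) = u (inv g)"
proof -
  show 1: "u (inv g) ** u g = mat 1" "u g ** u (inv g) = mat 1"
    using assms by (metis inv_closed l_inv r_inv representation_def)+
  show "matrix_inv (u g) = u (inv g)" using 1 by (rule matrix_inv_eqI)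
qed

lemma (in group) rep_inv_left:
  assumes "representation G u" "g \<in> carrier G"
  shows "u (inv g) ** (u g ** x) = x" "u g ** (u (inv g) ** x) = x"
    "x ** u (inv g) ** u g = x" "x ** u g ** u (inv g) = x"
  using rep_inv[OF assms] by (simp_all add: matrix_mul_assoc) (simp_all flip: matrix_mul_assoc)

lemma (in group) rep_conj_iff:
  assumes "representation G u" "g \<in> carrier G"
  shows "u (inv g) ** x ** u g = x \<longleftrightarrow> u g ** x = x ** u g"
proof
  assume "u (inv g) ** x ** u g = x"
  then have "u g ** x = u g ** (u (inv g) ** (x ** u g))" by (simp add: matrix_mul_assoc)
  then show "u g ** x = x ** u g" by (simp only: rep_inv_left[OF assms])
next
  assume "u g ** x = x ** u g"
  then have "u (inv g) ** x ** u g = u (inv g) ** (u g ** x)" by (simp flip: matrix_mul_assoc)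
  then show "u (inv g) ** x ** u g = x" by (simp only: rep_inv_left[OF assms])
qed

lemma (in group) rep_kron:
  "representation G u \<Longrightarrow> representation G w \<Longrightarrow> representation G (\<lambda>g. u g \<otimes>\<^sub>K w g)"
  by (simp add: representation_def kron_mult kron_one)

lemma subalgebra_centralizer: "subalgebra (centralizer G u)"
  unfolding subalgebra_def csubspace_def centralizer_def
proof (intro conjI allI ballI)
  fix x y assume "x \<in> {x. \<forall>g\<in>carrier G. u g ** x = x ** u g}" "y \<in> {x. \<forall>g\<in>carrier G. u g ** x = x ** u g}"
  then have *: "u g ** x = x ** u g" "u g ** y = y ** u g" if "g \<in> carrier G" for g using that by auto
  show "x + y \<in> {x. \<forall>g\<in>carrier G. u g ** x = x ** u g}"
    using * by (auto simp: vec_eq_iff mult_nth algebra_simps sum.distrib)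
  have "u g ** (x ** y) = (x ** y) ** u g" if "g \<in> carrier G" for g
    using *[OF that] by (metis matrix_mul_assoc)
  then show "x ** y \<in> {x. \<forall>g\<in>carrier G. u g ** x = x ** u g}" by blast
qed simp_all

lemma centralizer_mult: "x \<in> centralizer G u \<Longrightarrow> y \<in> centralizer G u \<Longrightarrow> x ** y \<in> centralizer G u"
  and centralizer_one: "mat 1 \<in> centralizer G u"
  and centralizer_cscale: "x \<in> centralizer G u \<Longrightarrow> cscale c x \<in> centralizer G u"
  and centralizer_sum: "(\<And>s. s \<in> S \<Longrightarrow> M s \<in> centralizer G u) \<Longrightarrow> (\<Sum>s\<in>S. M s) \<in> centralizer G u"
  and centralizer_add: "x \<in> centralizer G u \<Longrightarrow> y \<in> centralizer G u \<Longrightarrow> x + y \<in> centralizer G u"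
  using subalgebra_centralizer[of G u] csubspace_sum[of "centralizer G u"]
  by (auto simp: subalgebra_def csubspace_def)

lemma centralizer_kron:
  "x \<in> centralizer G u \<Longrightarrow> y \<in> centralizer G w \<Longrightarrow> x \<otimes>\<^sub>K y \<in> centralizer G (\<lambda>g. u g \<otimes>\<^sub>K w g)"
  by (simp add: centralizer_def kron_mult)

lemma (in finite_group) sum_group_left:
  assumes "g \<in> carrier G"
  shows "(\<Sum>h\<in>carrier G. F (g \<otimes> h)) = (\<Sum>h\<in>carrier G. F h)"
  by (rule sum.reindex_bij_betw)
     (use assms in \<open>auto intro!: bij_betwI[where g = "\<lambda>h. inv g \<otimes> h"] simp: m_assoc[symmetric]\<close>)

text \<open>The group average, left unnormalised; the factor \<open>card (carrier G)\<close>
  reappears in \<open>twirl_of_centralizer\<close> and \<open>trace_twirl\<close>.\<close>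

definition twirl :: "('g, 'z) monoid_scheme \<Rightarrow> ('g \<Rightarrow> complex^'b^'b) \<Rightarrow> ('g \<Rightarrow> complex^'a^'a) \<Rightarrow>
    complex^'a^'b \<Rightarrow> complex^'a^'b" where
  "twirl G w u x = (\<Sum>g\<in>carrier G. w g ** x ** u (inv\<^bsub>G\<^esub> g))"

context finite_group
begin

lemma twirl_intertwines:
  assumes "representation G u" "representation G w" "g \<in> carrier G"
  shows "w g ** twirl G w u x = twirl G w u x ** u g"
proof -
  have "w g ** twirl G w u x = (\<Sum>h\<in>carrier G. w (g \<otimes> h) ** x ** u (inv h))"
    using assms by (simp add: twirl_def sum_mult representation_def matrix_mul_assoc)
  also have "\<dots> = (\<Sum>h\<in>carrier G. w (g \<otimes> h) ** x ** u (inv (g \<otimes> h)) ** u g)"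
  proof (rule sum.cong)
    fix h assume h: "h \<in> carrier G"
    have "u (inv (g \<otimes> h)) ** u g = u (inv (g \<otimes> h) \<otimes> g)" using assms h by (simp add: representation_def)
    also have "inv (g \<otimes> h) \<otimes> g = inv h" using assms h by (simp add: inv_mult_group m_assoc)
    finally show "w (g \<otimes> h) ** x ** u (inv h) = w (g \<otimes> h) ** x ** u (inv (g \<otimes> h)) ** u g"
      by (metis matrix_mul_assoc)
  qed simp
  also have "\<dots> = (\<Sum>h\<in>carrier G. w h ** x ** u (inv h) ** u g)"
    by (rule sum_group_left[OF assms(3)])
  finally show ?thesis by (simp add: twirl_def sum_mult)
qed

lemma twirl_centralizer: "representation G u \<Longrightarrow> twirl G u u x \<in> centralizer G u"
  by (auto simp: centralizer_def twirl_intertwines)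

lemma mult_twirl: "y \<in> centralizer G w \<Longrightarrow> y ** twirl G w u x = twirl G w u (y ** x)"
  unfolding twirl_def sum_mult centralizer_def
  by (auto intro!: sum.cong simp: matrix_mul_assoc)

lemma card_carrier_pos: "card (carrier G) > 0"
  using fin one_closed card_gt_0_iff by blast

lemma twirl_of_centralizer:
  assumes "representation G u" "x \<in> centralizer G u"
  shows "twirl G u u x = cscale (of_nat (card (carrier G))) x"
proof -
  have "u g ** x ** u (inv g) = x" if "g \<in> carrier G" for g
    using assms that rep_inv_left[OF assms(1) that] by (auto simp: centralizer_def)
  then have "twirl G u u x = (\<Sum>g\<in>carrier G. x)" unfolding twirl_def by (intro sum.cong) auto
  then show ?thesis by (simp add: vec_eq_iff sum_matrix_nth del: sum_constant) simp
qed

lemma trace_twirl: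
  assumes "representation G u"
  shows "trace (twirl G u u x) = of_nat (card (carrier G)) * trace x"
proof -
  have "trace (u g ** x ** u (inv g)) = trace x" if "g \<in> carrier G" for g
    using trace_mul_sym[of "u g ** x" "u (inv g)"] rep_inv_left[OF assms that] by simp
  then show ?thesis by (simp add: twirl_def trace_sum)
qed

text \<open>Against an element of the commutant, a matrix and its twirl have the same trace pairing
  up to the group order. Orthogonality to the commutant is therefore orthogonality to all
  matrices.\<close>

lemma nondegenerate_centralizer:
  assumes "representation G u"
  shows "trace_nondegenerate (centralizer G u)"
  unfolding trace_nondegenerate_def
proof (intro ballI impI)
  fix x assume x: "x \<in> centralizer G u" and 0: "\<forall>y\<in>centralizer G u. trace (x ** y) = 0"
  have "trace (x ** y) = 0" for y
  proof -
    have "of_nat (card (carrier G)) * trace (x ** y) = trace (x ** twirl G u u y)"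
      unfolding mult_twirl[OF x] trace_twirl[OF assms] ..
    also have "\<dots> = 0" using 0 twirl_centralizer[OF assms] by blast
    finally show ?thesis using card_carrier_pos by simp
  qed
  then show "x = 0" using trace_nondegenerate_UNIV by (auto simp: trace_nondegenerate_def)
qed

text \<open>The existence of such a \<open>K\<close> is how the hypothesis that all irreducible representations occur enters the proof.\<close>

definition separates :: "('a \<Rightarrow> complex^'n^'n) \<Rightarrow> complex^'n^'n \<Rightarrow> bool" where
  "separates u K \<longleftrightarrow> (\<forall>g\<in>carrier G. trace (u g ** K) = (if g = \<one> then 1 else 0))"

text \<open>Summing over \<open>i\<close> closes a trace, so the term of \<open>g\<close> receives
  the weight \<open>trace (u (inv g) ** K)\<close> and only the identity survives. In effect, every
  vector of an arbitrary representation \<open>w\<close> is reached from vectors of \<open>u\<close>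
  by intertwiners.\<close>

lemma twirl_reproduces:
  fixes u :: "'a \<Rightarrow> complex^'n^'n" and w :: "'a \<Rightarrow> complex^'m^'m"
  assumes "representation G w" "separates u K"
  shows "(\<Sum>i\<in>UNIV. twirl G w u (outer a (axis i 1)) *v (K *v axis i 1)) = a"
proof -
  have 1: "outer b c *v k = (\<Sum>j\<in>UNIV. c $ j * k $ j) *s b" for b :: "complex^'m" and c k :: "complex^'n"
    by (simp add: vec_eq_iff matrix_vector_mult_def sum_distrib_left sum_distrib_right mult_ac)
  have 2: "(\<Sum>i\<in>UNIV. (M ** outer a (axis i 1) ** N) *v (K *v axis i 1)) = trace (N ** K) *s (M *v a)"
    for M :: "complex^'m^'m" and N :: "complex^'n^'n"
    by (simp add: outer_mult_left outer_mult_right 1 trace_def mult_nth matrix_vector_mult_def vector_matrix_mult_def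
       axis_nth vec_eq_iff sum_distrib_left sum_distrib_right mult_ac)
  have "(\<Sum>i\<in>UNIV. twirl G w u (outer a (axis i 1)) *v (K *v axis i 1))
    = (\<Sum>g\<in>carrier G. trace (u (inv g) ** K) *s (w g *v a))"
    unfolding twirl_def matrix_vector_mult_sum by (subst sum.swap) (simp only: 2)
  also have "\<dots> = (\<Sum>g\<in>carrier G. if g = \<one> then a else 0)"
    using assms by (intro sum.cong) (auto simp: separates_def inv_eq_1_iff representation_def)
  finally show ?thesis using fin by simp
qed

end

section \<open>Site matrices and closed columns\<close>

definition swap :: "complex^('a::finite \<times> 'a)^('a \<times> 'a)" where
  "swap = (\<chi> i j. if fst i = snd j \<and> snd i = fst j then 1 else 0)"

definition flip :: "complex^('a::finite \<times> 'b::finite)^('c::finite \<times> 'd::finite) \<Rightarrow> complex^('b \<times> 'a)^('d \<times> 'c)" where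
  "flip t = (\<chi> i j. t $ (snd i, fst i) $ (snd j, fst j))"

lemma swap_nth [simp]: "swap $ (a, b) $ (c, d) = (if a = d then (if b = c then 1 else 0) else 0)"
  by (simp add: swap_def)

lemma flip_nth [simp]: "flip t $ (a, b) $ (c, d) = t $ (b, a) $ (d, c)"
  by (simp add: flip_def)

text \<open>A site matrix has rows indexed by (down, left) and columns by (up, right). \<open>ring2\<close> and \<open>ring3\<close> are the
  transfer matrices, from left to right, of a vertically closed column of two or three sites.\<close>

definition ring2 :: "complex^('v::finite \<times> 'h::finite)^('v \<times> 'h) \<Rightarrow> complex^('v \<times> 'h)^('v \<times> 'h) \<Rightarrow> complex^('h \<times> 'h)^('h \<times> 'h)" where
  "ring2 t1 t2 = (\<chi> l r. \<Sum>a\<in>UNIV. \<Sum>b\<in>UNIV. t1 $ (b, fst l) $ (a, fst r) * t2 $ (a, snd l) $ (b, snd r))"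

definition ring3 :: "complex^('v::finite \<times> 'h::finite)^('v \<times> 'h) \<Rightarrow> complex^('v \<times> 'h)^('v \<times> 'h) \<Rightarrow> complex^('v \<times> 'h)^('v \<times> 'h) \<Rightarrow>
    complex^('h \<times> 'h \<times> 'h)^('h \<times> 'h \<times> 'h)" where
  "ring3 t1 t2 t3 = (\<chi> l r. \<Sum>a\<in>UNIV. \<Sum>b\<in>UNIV. \<Sum>c\<in>UNIV.
     t1 $ (c, fst l) $ (a, fst r) * t2 $ (a, fst (snd l)) $ (b, fst (snd r)) * t3 $ (b, snd (snd l)) $ (c, snd (snd r)))"

definition leg12_3 :: "complex^('a::finite \<times> 'a)^('b::finite \<times> 'b) \<Rightarrow> complex^'a^'b \<Rightarrow> complex^('a \<times> 'a \<times> 'a)^('b \<times> 'b \<times> 'b)" where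
  "leg12_3 t x = (\<chi> i j. t $ (fst i, fst (snd i)) $ (fst j, fst (snd j)) * x $ snd (snd i) $ snd (snd j))"

definition leg13_2 :: "complex^('a::finite \<times> 'a)^('b::finite \<times> 'b) \<Rightarrow> complex^'a^'b \<Rightarrow> complex^('a \<times> 'a \<times> 'a)^('b \<times> 'b \<times> 'b)" where
  "leg13_2 t x = (\<chi> i j. t $ (fst i, snd (snd i)) $ (fst j, snd (snd j)) * x $ fst (snd i) $ fst (snd j))"

abbreviation "leg12 t \<equiv> leg12_3 t (mat 1)"
abbreviation "leg13 t \<equiv> leg13_2 t (mat 1)"
abbreviation "leg23 t \<equiv> mat 1 \<otimes>\<^sub>K t"

definition rotate3 :: "complex^('a::finite \<times> 'a \<times> 'a)^('b::finite \<times> 'b \<times> 'b) \<Rightarrow> complex^('a \<times> 'a \<times> 'a)^('b \<times> 'b \<times> 'b)" where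
  "rotate3 M = (\<chi> i j. M $ (fst (snd i), snd (snd i), fst i) $ (fst (snd j), snd (snd j), fst j))"

definition partial_trace :: "complex^('v::finite \<times> 'h::finite)^('v \<times> 'h) \<Rightarrow> complex^'h^'h" where
  "partial_trace t = (\<chi> i j. \<Sum>v\<in>UNIV. t $ (v, i) $ (v, j))"

lemma ring2_nth: "ring2 t1 t2 $ (l1, l2) $ (r1, r2) = (\<Sum>a\<in>UNIV. \<Sum>b\<in>UNIV. t1 $ (b, l1) $ (a, r1) * t2 $ (a, l2) $ (b, r2))"
  by (simp add: ring2_def)

lemma ring3_nth: "ring3 t1 t2 t3 $ (l1, l2, l3) $ (r1, r2, r3) = (\<Sum>a\<in>UNIV. \<Sum>b\<in>UNIV. \<Sum>c\<in>UNIV.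
     t1 $ (c, l1) $ (a, r1) * t2 $ (a, l2) $ (b, r2) * t3 $ (b, l3) $ (c, r3))"
  by (simp add: ring3_def)

lemma leg12_3_nth [simp]: "leg12_3 t x $ (a, b, c) $ (d, e, f) = t $ (a, b) $ (d, e) * x $ c $ f"
  by (simp add: leg12_3_def)

lemma leg13_2_nth [simp]: "leg13_2 t x $ (a, b, c) $ (d, e, f) = t $ (a, c) $ (d, f) * x $ b $ e"
  by (simp add: leg13_2_def)

lemma rotate3_nth [simp]: "rotate3 M $ (a, b, c) $ (d, e, f) = M $ (b, c, a) $ (e, f, d)"
  by (simp add: rotate3_def)

lemma partial_trace_nth [simp]: "partial_trace t $ i $ j = (\<Sum>v\<in>UNIV. t $ (v, i) $ (v, j))"
  by (simp add: partial_trace_def)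

lemmas entrywise = vec_eq_iff mult_nth mat_nth sum_pair ring2_nth ring3_nth

lemma sum_last_first3: "(\<Sum>a\<in>A. \<Sum>b\<in>B. \<Sum>c\<in>C. f a b c) = (\<Sum>c\<in>C. \<Sum>a\<in>A. \<Sum>b\<in>B. f a b c)"
  by (subst sum.swap[of _ C B]) (rule sum.swap)

lemma flip_flip [simp]: "flip (flip t) = t"
  by (simp add: entrywise)

lemma flip_mult: "flip (P ** Q) = flip P ** flip Q"
  unfolding entrywise by (simp add: mult_nth sum_pair, intro allI, rule sum.swap)

lemma flip_kron [simp]: "flip (P \<otimes>\<^sub>K Q) = Q \<otimes>\<^sub>K P"
  by (simp add: entrywise)

lemma flip_swap [simp]: "flip swap = swap"
  by (simp add: entrywise)

lemma flip_conv_swap: "flip t = swap ** t ** swap"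
  by (auto simp: entrywise)

lemma swap_swap [simp]: "swap ** swap = mat 1"
  by (auto simp: entrywise)

lemma swap_kron: "swap ** (P \<otimes>\<^sub>K Q) = (Q \<otimes>\<^sub>K P) ** swap"
  by (auto simp: entrywise)

lemma ring2_swap_left [simp]: "ring2 swap t = t"
  by (simp add: entrywise)

lemma ring2_swap_right [simp]: "ring2 t swap = flip t"
  by (simp add: entrywise)

section \<open>Multilinear identities, checked on pure tensors\<close>

lemma matrix_decompose: "(\<Sum>i\<in>UNIV. \<Sum>j\<in>UNIV. cscale (M $ i $ j) (outer (axis i 1) (axis j 1))) = M"
  by (simp add: vec_eq_iff sum_matrix_nth axis_nth)

lemma outer_axis_kron:
  "outer (axis (fst i) 1) (axis (fst j) 1) \<otimes>\<^sub>K outer (axis (snd i) 1) (axis (snd j) 1) = outer (axis i 1) (axis j 1)"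
  by (cases i; cases j) (auto simp: vec_eq_iff axis_nth)

text \<open>Matrix units of a tensor product are pure tensors. Scalars are absorbed into the first
  factor and zero is the pure tensor of zeros, so the additive case is the only other one.\<close>

lemma kron_induct [case_names kron add]:
  assumes kron: "\<And>P Q. R (P \<otimes>\<^sub>K Q)" and add: "\<And>x y. R x \<Longrightarrow> R y \<Longrightarrow> R (x + y)"
  shows "R (t :: complex^('a::finite \<times> 'b::finite)^('c::finite \<times> 'd::finite))"
proof -
  have "t = (\<Sum>i\<in>UNIV. \<Sum>j\<in>UNIV. cscale (t $ i $ j) (outer (axis (fst i) 1) (axis (fst j) 1)) \<otimes>\<^sub>K outer (axis (snd i) 1) (axis (snd j) 1))"
    using matrix_decompose[of t] by (simp add: cscale_kron outer_axis_kron)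
  moreover have zero: "R 0" using kron[of 0 0] by (simp add: kron_def zero_vec_def)
  have sum: "R (\<Sum>s\<in>S. M s)" if "finite S" "\<And>s. s \<in> S \<Longrightarrow> R (M s)" for S :: "'x set" and M
    using that by (induction S rule: finite_induct) (auto intro: add zero)
  have "R (\<Sum>i\<in>UNIV. \<Sum>j\<in>UNIV. cscale (t $ i $ j) (outer (axis (fst i) 1) (axis (fst j) 1)) \<otimes>\<^sub>K outer (axis (snd i) 1) (axis (snd j) 1))"
    apply (rule sum, simp) apply (rule sum, simp) apply (rule kron) done
  ultimately show ?thesis by simp
qed

lemma kron_induct2 [case_names kron add1 add2]:
  assumes "\<And>P Q P' Q'. R (P \<otimes>\<^sub>K Q) (P' \<otimes>\<^sub>K Q')"
    and "\<And>x y t. R x t \<Longrightarrow> R y t \<Longrightarrow> R (x + y) t" and "\<And>s x y. R s x \<Longrightarrow> R s y \<Longrightarrow> R s (x + y)"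
  shows "R (s :: complex^('a::finite \<times> 'b::finite)^('c::finite \<times> 'd::finite))
           (t :: complex^('a'::finite \<times> 'b'::finite)^('c'::finite \<times> 'd'::finite))"
proof (induction s rule: kron_induct)
  case (kron P Q)
  show ?case by (induction t rule: kron_induct) (use assms in auto)
qed (use assms in auto)

lemma kron_induct3 [case_names kron add1 add2 add3]:
  assumes "\<And>P Q P' Q' P'' Q''. R (P \<otimes>\<^sub>K Q) (P' \<otimes>\<^sub>K Q') (P'' \<otimes>\<^sub>K Q'')"
    and "\<And>x y t r. R x t r \<Longrightarrow> R y t r \<Longrightarrow> R (x + y) t r" and "\<And>s x y r. R s x r \<Longrightarrow> R s y r \<Longrightarrow> R s (x + y) r"
    and "\<And>s t x y. R s t x \<Longrightarrow> R s t y \<Longrightarrow> R s t (x + y)"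
  shows "R (s :: complex^('a::finite \<times> 'b::finite)^('c::finite \<times> 'd::finite))
           (t :: complex^('a'::finite \<times> 'b'::finite)^('c'::finite \<times> 'd'::finite))
           (r :: complex^('a''::finite \<times> 'b''::finite)^('c''::finite \<times> 'd''::finite))"
proof (induction s t rule: kron_induct2)
  case (kron P Q P' Q')
  show ?case by (induction r rule: kron_induct) (use assms in auto)
qed (use assms in auto)

lemma matrix_add_rdistrib: "((P :: complex^'a^'b) + Q) ** R = P ** R + Q ** R"
  by (simp add: vec_eq_iff mult_nth algebra_simps sum.distrib)

lemma ring2_kron_kron: "ring2 (P \<otimes>\<^sub>K Q) (R \<otimes>\<^sub>K T) = cscale (trace (P ** R)) (Q \<otimes>\<^sub>K T)"
proof -
  have "(\<Sum>a\<in>UNIV. \<Sum>b\<in>UNIV. P $ b $ a * R $ a $ b) = trace (P ** R)"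
    by (subst sum.swap) (simp add: trace_def mult_nth)
  moreover have "ring2 (P \<otimes>\<^sub>K Q) (R \<otimes>\<^sub>K T) = cscale (\<Sum>a\<in>UNIV. \<Sum>b\<in>UNIV. P $ b $ a * R $ a $ b) (Q \<otimes>\<^sub>K T)"
    by (simp add: entrywise sum_distrib_left sum_distrib_right mult_ac)
  ultimately show ?thesis by simp
qed

lemma ring3_kron_kron: "ring3 (P \<otimes>\<^sub>K Q) (R \<otimes>\<^sub>K T) (U \<otimes>\<^sub>K W) = cscale (trace (P ** R ** U)) (Q \<otimes>\<^sub>K T \<otimes>\<^sub>K W)"
proof -
  have "(\<Sum>a\<in>UNIV. \<Sum>b\<in>UNIV. \<Sum>c\<in>UNIV. P $ c $ a * R $ a $ b * U $ b $ c) = trace (P ** R ** U)"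
    by (subst sum_last_first3) (simp add: trace_def mult_nth sum_distrib_right, subst sum.swap, rule refl)
  moreover have "ring3 (P \<otimes>\<^sub>K Q) (R \<otimes>\<^sub>K T) (U \<otimes>\<^sub>K W) =
    cscale (\<Sum>a\<in>UNIV. \<Sum>b\<in>UNIV. \<Sum>c\<in>UNIV. P $ c $ a * R $ a $ b * U $ b $ c) (Q \<otimes>\<^sub>K T \<otimes>\<^sub>K W)"
    by (simp add: entrywise sum_distrib_left sum_distrib_right mult_ac)
  ultimately show ?thesis by simp
qed

lemma ring_add:
  "ring2 (s + s') t = ring2 s t + ring2 s' t" "ring2 s (t + t') = ring2 s t + ring2 s t'"
  "ring3 (s + s') t r = ring3 s t r + ring3 s' t r" "ring3 s (t + t') r = ring3 s t r + ring3 s t' r"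
  "ring3 s t (r + r') = ring3 s t r + ring3 s t r'"
  by (simp_all add: entrywise algebra_simps sum.distrib)

lemma kron_add: "P \<otimes>\<^sub>K (Q + R) = P \<otimes>\<^sub>K Q + P \<otimes>\<^sub>K R" "(S + T) \<otimes>\<^sub>K U = S \<otimes>\<^sub>K U + T \<otimes>\<^sub>K U"
  by (simp_all add: vec_eq_iff kron_def algebra_simps)

lemma leg_add:
  "leg12_3 (s + t) x = leg12_3 s x + leg12_3 t x" "leg13_2 (s + t) x = leg13_2 s x + leg13_2 t x"
  by (simp_all add: entrywise algebra_simps)

lemma leg_kron [simp]:
  "leg12_3 (P \<otimes>\<^sub>K Q) R = P \<otimes>\<^sub>K Q \<otimes>\<^sub>K R" "leg13_2 (P \<otimes>\<^sub>K R) Q = P \<otimes>\<^sub>K Q \<otimes>\<^sub>K R"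
  by (simp_all add: entrywise)

lemma leg_cscale:
  "leg12_3 (cscale c t) x = cscale c (leg12_3 t x)" "leg13_2 (cscale c t) x = cscale c (leg13_2 t x)"
  by (simp_all add: entrywise)

lemmas ring_linear = ring_add leg_add kron_add matrix_add_ldistrib matrix_add_rdistrib

lemma ring2_horizontal:
  "ring2 ((mat 1 \<otimes>\<^sub>K x) ** s) t = (x \<otimes>\<^sub>K mat 1) ** ring2 s t"
  "ring2 (s ** (mat 1 \<otimes>\<^sub>K x)) t = ring2 s t ** (x \<otimes>\<^sub>K mat 1)"
  by (induction s t rule: kron_induct2; simp add: ring_linear kron_mult ring2_kron_kron)+

lemma flip_add: "flip (s + t) = flip s + flip t"
  by (simp add: entrywise)

lemma flip_cscale: "flip (cscale c s) = cscale c (flip s)"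
  by (simp add: entrywise)

lemma flip_ring2: "flip (ring2 s t) = ring2 t s"
  by (induction s t rule: kron_induct2; simp add: ring_linear flip_add flip_cscale ring2_kron_kron)
     (metis trace_mul_sym)

text \<open>The vertical factors cancel between neighbouring sites and the horizontal ones remain
  outside. With group elements this gives equivariance of columns; with trivial vertical factors it
  is the horizontal gauge transformation.\<close>

lemma ring2_conj:
  assumes "z' ** z = mat 1"
  shows "ring2 ((z \<otimes>\<^sub>K y) ** s ** (z' \<otimes>\<^sub>K x)) ((z \<otimes>\<^sub>K y) ** t ** (z' \<otimes>\<^sub>K x)) = (y \<otimes>\<^sub>K y) ** ring2 s t ** (x \<otimes>\<^sub>K x)"
proof (induction s t rule: kron_induct2)
  case (kron P Q P' Q')
  have "trace (z ** P ** z' ** (z ** P' ** z')) = trace (z ** (P ** (z' ** z) ** P') ** z')" by (simp only: matrix_mul_assoc)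
  also have "\<dots> = trace (z' ** (z ** (P ** P')))" using assms by (simp add: trace_mul_sym[of "z ** _" z'])
  finally show ?case using assms by (simp add: kron_mult ring2_kron_kron matrix_mul_assoc)
qed (simp_all add: ring_linear)

lemma ring3_conj:
  assumes "z' ** z = mat 1"
  shows "ring3 ((z \<otimes>\<^sub>K y) ** s ** (z' \<otimes>\<^sub>K x)) ((z \<otimes>\<^sub>K y) ** t ** (z' \<otimes>\<^sub>K x)) ((z \<otimes>\<^sub>K y) ** r ** (z' \<otimes>\<^sub>K x))
    = (y \<otimes>\<^sub>K y \<otimes>\<^sub>K y) ** ring3 s t r ** (x \<otimes>\<^sub>K x \<otimes>\<^sub>K x)"
proof (induction s t r rule: kron_induct3)
  case (kron P Q P' Q' P'' Q'')
  have "trace (z ** P ** z' ** (z ** P' ** z') ** (z ** P'' ** z')) = trace (z ** (P ** (z' ** z) ** P' ** (z' ** z) ** P'') ** z')"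
    by (simp only: matrix_mul_assoc)
  also have "\<dots> = trace (z' ** (z ** (P ** P' ** P'')))" using assms by (simp add: trace_mul_sym[of "z ** _" z'])
  finally show ?case using assms by (simp add: kron_mult ring3_kron_kron matrix_mul_assoc)
qed (simp_all add: ring_linear)

text \<open>A corner in first place turns the vertical bond of the ring into the first leg, along
  which \<open>s\<close> and \<open>t\<close> are composed as operators.\<close>

lemma ring3_swap: "ring3 swap s t = leg12 s ** leg13 t"
  by (simp add: entrywise)

text \<open>A product site does not couple its vertical bond to its horizontal leg. The leg splits
  off, and the vertical factor moves cyclically to the next site; this is what cutting an edge means
  here.\<close>

lemma ring3_kron: "ring3 s t (y \<otimes>\<^sub>K x) = leg12_3 (ring2 ((y \<otimes>\<^sub>K mat 1) ** s) t) x"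
  by (induction s t rule: kron_induct2; simp add: ring_linear kron_mult ring3_kron_kron ring2_kron_kron leg_cscale)
     (metis matrix_mul_assoc trace_mul_sym)

lemma ring2_one: "ring2 t (mat 1) = partial_trace t \<otimes>\<^sub>K mat 1"
  by (auto simp: entrywise)

lemma rotate3_linear:
  "rotate3 (s + t) = rotate3 s + rotate3 t" "rotate3 (cscale c s) = cscale c (rotate3 s)"
  "rotate3 (P \<otimes>\<^sub>K Q \<otimes>\<^sub>K R) = R \<otimes>\<^sub>K P \<otimes>\<^sub>K Q"
  by (simp_all add: entrywise)

text \<open>A vertically closed column has no distinguished lowest site.\<close>

lemma rotate3_ring3: "rotate3 (ring3 s t r) = ring3 r s t"
  by (induction s t r rule: kron_induct3; simp add: ring_linear rotate3_linear ring3_kron_kron)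
     (metis matrix_mul_assoc trace_mul_sym)

lemma rotate3_leg12: "rotate3 (leg12 t) = leg23 t"
  by (simp add: entrywise)

lemma rotate3_leg23: "rotate3 (leg23 t) = leg13 (flip t)"
  by (simp add: entrywise)

lemma leg12_mult: "leg12_3 s x ** leg12_3 t y = leg12_3 (s ** t) (x ** y)"
  by (induction s t rule: kron_induct2; simp add: ring_linear kron_mult)

lemma leg13_mult: "leg13_2 s x ** leg13_2 t y = leg13_2 (s ** t) (x ** y)"
  by (induction s t rule: kron_induct2; simp add: ring_linear kron_mult)

lemma ring_cscale:
  "ring2 (cscale c s) t = cscale c (ring2 s t)" "ring2 s (cscale c t) = cscale c (ring2 s t)"
  "ring3 (cscale c s) t r = cscale c (ring3 s t r)" "ring3 s (cscale c t) r = cscale c (ring3 s t r)"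
  "ring3 s t (cscale c r) = cscale c (ring3 s t r)"
  by (simp_all add: entrywise sum_distrib_left mult_ac)

lemma ring_zero: "ring2 0 t = 0" "ring2 s 0 = 0" "ring3 0 t r = 0" "ring3 s 0 r = 0" "ring3 s t 0 = 0"
  by (simp_all add: entrywise)

lemma ring_sum:
  "ring2 (\<Sum>i\<in>I. M i) t = (\<Sum>i\<in>I. ring2 (M i) t)" "ring2 s (\<Sum>i\<in>I. M i) = (\<Sum>i\<in>I. ring2 s (M i))"
  "ring3 (\<Sum>i\<in>I. M i) t r = (\<Sum>i\<in>I. ring3 (M i) t r)" "ring3 s (\<Sum>i\<in>I. M i) r = (\<Sum>i\<in>I. ring3 s (M i) r)"
  "ring3 s t (\<Sum>i\<in>I. M i) = (\<Sum>i\<in>I. ring3 s t (M i))"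
  by (induction I rule: infinite_finite_induct; simp add: ring_zero ring_add)+

lemma ring2_lincomb:
  "ring2 (lincomb A \<phi>) (lincomb A \<psi>) = lincomb (\<lambda>p. ring2 (A (fst p)) (A (snd p))) (\<lambda>p. \<phi> (fst p) * \<psi> (snd p))"
  unfolding lincomb_def ring_sum(1) by (simp add: ring_sum(2) ring_cscale cscale_sum sum_pair mult.commute)

lemma ring3_lincomb:
  "ring3 (lincomb A \<phi>) (lincomb A \<psi>) (lincomb A \<omega>) =
    lincomb (\<lambda>p. ring3 (A (fst p)) (A (fst (snd p))) (A (snd (snd p)))) (\<lambda>p. \<phi> (fst p) * (\<psi> (fst (snd p)) * \<omega> (snd (snd p))))"
  unfolding lincomb_def unfolding ring_sum(3) unfolding ring_sum(4) by (simp add: ring_sum(5) ring_cscale cscale_sum sum_pair mult_ac)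

abbreviation tensor2 :: "('g \<Rightarrow> complex^'a^'a) \<Rightarrow> 'g \<Rightarrow> complex^('a::finite \<times> 'a)^('a \<times> 'a)" where
  "tensor2 u \<equiv> \<lambda>g. u g \<otimes>\<^sub>K u g"

abbreviation tensor3 :: "('g \<Rightarrow> complex^'a^'a) \<Rightarrow> 'g \<Rightarrow> complex^('a::finite \<times> 'a \<times> 'a)^('a \<times> 'a \<times> 'a)" where
  "tensor3 u \<equiv> \<lambda>g. u g \<otimes>\<^sub>K u g \<otimes>\<^sub>K u g"

lemma kron_split: "P \<otimes>\<^sub>K Q = (P \<otimes>\<^sub>K mat 1) ** (mat 1 \<otimes>\<^sub>K Q)" "P \<otimes>\<^sub>K Q = (mat 1 \<otimes>\<^sub>K Q) ** (P \<otimes>\<^sub>K mat 1)"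
  by (simp_all add: kron_mult)

lemma swap_centralizer: "swap \<in> centralizer G (tensor2 u)"
  by (simp add: centralizer_def swap_kron)

lemma flip_centralizer: "t \<in> centralizer G (tensor2 u) \<Longrightarrow> flip t \<in> centralizer G (tensor2 u)"
  by (simp add: flip_conv_swap centralizer_mult swap_centralizer)

lemma leg_centralizer:
  assumes "t \<in> centralizer G (tensor2 u)" "x \<in> centralizer G u"
  shows "leg12_3 t x \<in> centralizer G (tensor3 u)" "leg13_2 t x \<in> centralizer G (tensor3 u)"
    "x \<otimes>\<^sub>K t \<in> centralizer G (tensor3 u)"
proof -
  have *: "u g \<otimes>\<^sub>K u g \<otimes>\<^sub>K u g = leg12_3 (u g \<otimes>\<^sub>K u g) (u g)" "u g \<otimes>\<^sub>K u g \<otimes>\<^sub>K u g = leg13_2 (u g \<otimes>\<^sub>K u g) (u g)" for g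
    by simp_all
  show "leg12_3 t x \<in> centralizer G (tensor3 u)"
    using assms unfolding centralizer_def mem_Collect_eq *(1) leg12_mult by simp
  show "leg13_2 t x \<in> centralizer G (tensor3 u)"
    using assms unfolding centralizer_def mem_Collect_eq *(2) leg13_mult by simp
  show "x \<otimes>\<^sub>K t \<in> centralizer G (tensor3 u)"
    using centralizer_kron[OF assms(2,1)] .
qed

lemma flip_lincomb: "flip (lincomb a \<phi>) = lincomb (\<lambda>s. flip (a s)) \<phi>"
  by (simp add: vec_eq_iff lincomb_nth)

lemma outer_axis_Pair: "outer (axis (a, b) 1) (axis (c, d) 1) = outer (axis a 1) (axis c 1) \<otimes>\<^sub>K outer (axis b 1) (axis d 1)"
  using outer_axis_kron[of "(a, b)" "(c, d)"] by simp

lemma kron_sum: "(\<Sum>s\<in>S. M s) \<otimes>\<^sub>K N = (\<Sum>s\<in>S. M s \<otimes>\<^sub>K N)" "N \<otimes>\<^sub>K (\<Sum>s\<in>S. M s) = (\<Sum>s\<in>S. N \<otimes>\<^sub>K M s)"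
  by (simp_all add: vec_eq_iff sum_matrix_nth sum_distrib_left sum_distrib_right)

lemma cscale_sum_left: "cscale (\<Sum>s\<in>S. c s) M = (\<Sum>s\<in>S. cscale (c s) M)"
  by (simp add: vec_eq_iff sum_matrix_nth sum_distrib_right)

section \<open>Equivariance of closed columns and generators of the commutant\<close>

context finite_group
begin

lemma ring_centralizer:
  fixes s t r :: "complex^('n::finite \<times> 'n)^('n \<times> 'n)"
  assumes "representation G u"
    and s: "s \<in> centralizer G (tensor2 u)" and t: "t \<in> centralizer G (tensor2 u)" and r: "r \<in> centralizer G (tensor2 u)"
  shows "ring2 s t \<in> centralizer G (tensor2 u)" "ring3 s t r \<in> centralizer G (tensor3 u)"
proof -
  note u2 = rep_kron[OF assms(1) assms(1)] and u3 = rep_kron[OF assms(1) rep_kron[OF assms(1) assms(1)]]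
  have conj: "(u (inv g) \<otimes>\<^sub>K u (inv g)) ** x ** (u g \<otimes>\<^sub>K u g) = x" if "x \<in> centralizer G (tensor2 u)" "g \<in> carrier G" for x g
    unfolding rep_conj_iff[OF u2 that(2)] using that by (simp add: centralizer_def)
  note inv = rep_inv(2)[OF assms(1)]
  show "ring2 s t \<in> centralizer G (tensor2 u)"
    unfolding centralizer_def by (simp add: ring2_conj[OF inv, symmetric] conj s t flip: rep_conj_iff[OF u2])
  show "ring3 s t r \<in> centralizer G (tensor3 u)"
    unfolding centralizer_def by (simp add: ring3_conj[OF inv, symmetric] conj s t r flip: rep_conj_iff[OF u3])
qed

text \<open>An element of the commutant is its own twirl divided by the group order, hence a
  combination of twirled matrix units.\<close>

lemma centralizer_induct [consumes 2, case_names twirl add cscale]: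
  fixes w :: "'a \<Rightarrow> complex^'m^'m"
  assumes x: "x \<in> centralizer G w" and w: "representation G w"
    and twirl: "\<And>i j. R (twirl G w w (outer (axis i 1) (axis j 1)))"
    and add: "\<And>x y. R x \<Longrightarrow> R y \<Longrightarrow> R (x + y)" and cscale: "\<And>c x. R x \<Longrightarrow> R (cscale c x)"
  shows "R x"
proof -
  let ?n = "of_nat (card (carrier G)) :: complex"
  have zero: "R 0" using cscale[OF twirl, of 0] by simp
  have sum: "R (\<Sum>s\<in>S. M s)" if "finite S" "\<And>s. s \<in> S \<Longrightarrow> R (M s)" for S :: "'m set" and M
    using that by (induction S rule: finite_induct) (auto intro: add zero)
  have "x = cscale (1 / ?n) (twirl G w w x)"
    using twirl_of_centralizer[OF w x] card_carrier_pos by simp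
  also have "twirl G w w x = twirl G w w (\<Sum>i\<in>UNIV. \<Sum>j\<in>UNIV. cscale (x $ i $ j) (outer (axis i 1) (axis j 1)))"
    by (simp add: matrix_decompose)
  also have "\<dots> = (\<Sum>i\<in>UNIV. \<Sum>j\<in>UNIV. cscale (x $ i $ j) (twirl G w w (outer (axis i 1) (axis j 1))))"
    unfolding twirl_def sum_mult cscale_sum by (simp add: sum.swap[of _ _ "carrier G"] sum_mult)
  finally have eq: "x = cscale (1 / ?n) (\<Sum>i\<in>UNIV. \<Sum>j\<in>UNIV. cscale (x $ i $ j) (twirl G w w (outer (axis i 1) (axis j 1))))" .
  show ?thesis
    by (subst eq) (intro cscale sum twirl finite)
qed

end

text \<open>This records what the later argument takes from G-injectivity. The invariant vector and
  functional are paired to 1, so that \<open>p\<close> becomes a rank-one idempotent in the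
  commutant.\<close>

locale site_family = finite_group G for G (structure) +
  fixes u :: "'a \<Rightarrow> complex^'n^'n" and K :: "complex^'n^'n" and v f :: "complex^'n"
    and a :: "'p::finite \<Rightarrow> complex^('n \<times> 'n)^('n \<times> 'n)"
  assumes rep: "representation G u"
    and sep: "separates u K"
    and v_invariant: "g \<in> carrier G \<Longrightarrow> u g *v v = v"
    and f_invariant: "g \<in> carrier G \<Longrightarrow> f v* u g = f"
    and f_v: "(\<Sum>i\<in>UNIV. f $ i * v $ i) = 1"
    and range_a: "range (lincomb a) = centralizer G (tensor2 u)"
begin

definition p where "p = outer v f"

lemma p_centralizer: "p \<in> centralizer G u"
  by (simp add: p_def centralizer_def outer_mult_left outer_mult_right v_invariant f_invariant)

lemma p_idem: "p ** p = p"
  unfolding p_def outer_mult_left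
  by (simp add: vec_eq_iff matrix_vector_mult_def mult.assoc sum_distrib_left[symmetric] f_v)

lemma rep2: "representation G (tensor2 u)" and rep3: "representation G (tensor3 u)"
  by (rule rep_kron[OF rep rep], rule rep_kron[OF rep rep_kron[OF rep rep]])

text \<open>The sum over the auxiliary index closes the loop through \<open>K\<close>. With
  \<open>M = u (inv g) ** u h\<close> the resulting trace tests whether \<open>g\<close> and
  \<open>h\<close> agree.\<close>

lemma separation_collapse:
  "(\<Sum>k\<in>UNIV. outer b (axis k 1) ** M ** outer (K *v axis k 1) c) = cscale (trace (M ** K)) (outer b c)"
  by (simp add: vec_eq_iff sum_matrix_nth mult_nth trace_def axis_nth matrix_vector_mult_def sum_distrib_left sum_distrib_right mult_ac)

lemma sum_delta_group:
  assumes "g \<in> carrier G"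
  shows "(\<Sum>h\<in>carrier G. cscale (trace (u (inv g) ** u h ** K)) (F h)) = F g"
proof -
  have "cscale (trace (u (inv g) ** u h ** K)) (F h) = (if h = g then F g else 0)" if "h \<in> carrier G" for h
  proof -
    have "u (inv g) ** u h = u (inv g \<otimes> h)" using rep that assms by (simp add: representation_def)
    moreover have "inv g \<otimes> h = \<one> \<longleftrightarrow> h = g"
      using that assms by (metis inv_equality inv_inv l_inv inv_closed)
    ultimately show ?thesis using sep that assms by (simp add: separates_def)
  qed
  then show ?thesis using assms fin by simp
qed

text \<open>The corner is a combination of sites, so every \<open>t = ring2 swap t\<close> is
  already a combination of columns.\<close>

lemma range_ring2: "range (lincomb (\<lambda>q. ring2 (a (fst q)) (a (snd q)))) = centralizer G (tensor2 u)"
proof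
  have "ring2 (a (fst q)) (a (snd q)) \<in> centralizer G (tensor2 u)" for q
    using lincomb_mem[of a] range_a by (intro ring_centralizer[OF rep]) auto
  then show "range (lincomb (\<lambda>q. ring2 (a (fst q)) (a (snd q)))) \<subseteq> centralizer G (tensor2 u)"
    unfolding lincomb_def by (auto intro!: centralizer_sum centralizer_cscale)
  show "centralizer G (tensor2 u) \<subseteq> range (lincomb (\<lambda>q. ring2 (a (fst q)) (a (snd q))))"
  proof
    fix t assume "t \<in> centralizer G (tensor2 u)"
    then obtain \<phi> where \<phi>: "t = lincomb a \<phi>" using range_a by blast
    obtain \<sigma> where \<sigma>: "swap = lincomb a \<sigma>" using swap_centralizer[of G u] range_a by blast
    have "t = ring2 swap t" by simp
    also have "\<dots> \<in> range (lincomb (\<lambda>q. ring2 (a (fst q)) (a (snd q))))"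
      unfolding \<phi> \<sigma> ring2_lincomb by blast
    finally show "t \<in> range (lincomb (\<lambda>q. ring2 (a (fst q)) (a (snd q))))" .
  qed
qed

text \<open>Flipping exchanges the vertical and horizontal roles of a site and preserves the
  commutant of \<open>tensor2 u\<close>; everything shown for columns thereby holds for
  rows.\<close>

lemma site_family_flip: "site_family G u K v f (\<lambda>s. flip (a s))"
proof -
  have "range (lincomb (\<lambda>s. flip (a s))) = flip ` centralizer G (tensor2 u)"
    unfolding range_a[symmetric] image_image flip_lincomb ..
  also have "\<dots> = centralizer G (tensor2 u)"
    using flip_centralizer by (auto intro!: image_eqI[where f = flip, OF flip_flip[symmetric]])
  finally have range: "range (lincomb (\<lambda>s. flip (a s))) = centralizer G (tensor2 u)" .
  show ?thesis by standard (use rep sep v_invariant f_invariant f_v range in auto)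
qed

lemma twirl_kron: "twirl G (tensor2 u) (tensor2 u) (P \<otimes>\<^sub>K Q) = (\<Sum>g\<in>carrier G. (u g ** P ** u (inv g)) \<otimes>\<^sub>K (u g ** Q ** u (inv g)))"
  by (simp add: twirl_def kron_mult)

text \<open>With a corner in first place the column is a product of an operator on legs 1 and 2 and
  one on legs 1 and 3. Twirled matrix units for these give a double average over \<open>g\<close>
  and \<open>h\<close>; an auxiliary index \<open>k\<close> on the first leg, summed with
  \<open>K\<close> inserted, forces \<open>g = h\<close> and leaves the twirl of an arbitrary matrix
  unit.\<close>

lemma range_ring3:
  "range (lincomb (\<lambda>q. ring3 (a (fst q)) (a (fst (snd q))) (a (snd (snd q))))) = centralizer G (tensor3 u)" (is "range (lincomb ?r) = _")
proof
  have "ring3 (a (fst q)) (a (fst (snd q))) (a (snd (snd q))) \<in> centralizer G (tensor3 u)" for q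
    using lincomb_mem[of a] range_a by (intro ring_centralizer[OF rep]) auto
  then show "range (lincomb ?r) \<subseteq> centralizer G (tensor3 u)"
    unfolding lincomb_def by (auto intro!: centralizer_sum centralizer_cscale)
  show "centralizer G (tensor3 u) \<subseteq> range (lincomb ?r)"
  proof
    fix x assume "x \<in> centralizer G (tensor3 u)"
    from this rep3 show "x \<in> range (lincomb ?r)"
    proof (induction x rule: centralizer_induct)
      case (twirl i j)
      obtain i1 i2 i3 j1 j2 j3 where ij: "i = (i1, i2, i3)" "j = (j1, j2, j3)" by (metis prod.collapse)
      let ?E = "\<lambda>i j. outer (axis i 1) (axis j 1) :: complex^'n^'n"
      have E: "outer (axis i 1) (axis j 1) = ?E i1 j1 \<otimes>\<^sub>K ?E i2 j2 \<otimes>\<^sub>K ?E i3 j3"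
        unfolding ij by (simp add: outer_axis_Pair)
      define s where "s k = twirl G (tensor2 u) (tensor2 u) (?E i1 k \<otimes>\<^sub>K ?E i2 j2)" for k
      define t where "t k = twirl G (tensor2 u) (tensor2 u) (outer (K *v axis k 1) (axis j1 1) \<otimes>\<^sub>K ?E i3 j3)" for k
      have rs: "ring3 swap (s k) (t k) = (\<Sum>g\<in>carrier G. \<Sum>h\<in>carrier G.
          (u g ** ?E i1 k ** u (inv g) ** (u h ** outer (K *v axis k 1) (axis j1 1) ** u (inv h)))
          \<otimes>\<^sub>K (u g ** ?E i2 j2 ** u (inv g)) \<otimes>\<^sub>K (u h ** ?E i3 j3 ** u (inv h)))" for k
        unfolding s_def t_def twirl_kron ring_sum(4) by (simp add: ring_sum(5) ring3_swap kron_mult)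
      have "(\<Sum>k\<in>UNIV. ring3 swap (s k) (t k)) = (\<Sum>g\<in>carrier G. \<Sum>h\<in>carrier G.
          (u g ** (\<Sum>k\<in>UNIV. ?E i1 k ** (u (inv g) ** u h) ** outer (K *v axis k 1) (axis j1 1)) ** u (inv h))
          \<otimes>\<^sub>K (u g ** ?E i2 j2 ** u (inv g)) \<otimes>\<^sub>K (u h ** ?E i3 j3 ** u (inv h)))"
      proof -
        have "(\<Sum>k\<in>UNIV. \<Sum>g\<in>carrier G. \<Sum>h\<in>carrier G. F k g h) = (\<Sum>g\<in>carrier G. \<Sum>h\<in>carrier G. \<Sum>k\<in>UNIV. F k g h)"
          for F :: "'n \<Rightarrow> 'a \<Rightarrow> 'a \<Rightarrow> complex^('n \<times> 'n \<times> 'n)^('n \<times> 'n \<times> 'n)"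
          by (subst sum.swap, rule sum.cong[OF refl], rule sum.swap)
        then show ?thesis by (simp add: rs kron_sum sum_mult matrix_mul_assoc)
      qed
      also have "\<dots> = (\<Sum>g\<in>carrier G. (u g ** ?E i1 j1 ** u (inv g)) \<otimes>\<^sub>K (u g ** ?E i2 j2 ** u (inv g)) \<otimes>\<^sub>K (u g ** ?E i3 j3 ** u (inv g)))"
        unfolding separation_collapse by (simp add: cscale_kron sum_delta_group)
      also have "\<dots> = twirl G (tensor3 u) (tensor3 u) (outer (axis i 1) (axis j 1))"
        unfolding E by (simp add: twirl_def kron_mult)
      finally have eq: "(\<Sum>k\<in>UNIV. ring3 swap (s k) (t k)) = twirl G (tensor3 u) (tensor3 u) (outer (axis i 1) (axis j 1))" .
      have "ring3 swap (s k) (t k) \<in> range (lincomb ?r)" for k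
      proof -
        have "s k \<in> range (lincomb a)" "t k \<in> range (lincomb a)" "swap \<in> range (lincomb a)"
          unfolding range_a s_def t_def by (auto intro: twirl_centralizer rep2 swap_centralizer)
        then obtain \<phi> \<psi> \<sigma> where "s k = lincomb a \<phi>" "t k = lincomb a \<psi>" "swap = lincomb a \<sigma>" by blast
        then have "ring3 swap (s k) (t k) = ring3 (lincomb a \<sigma>) (lincomb a \<phi>) (lincomb a \<psi>)" by (simp only:)
        then show ?thesis unfolding ring3_lincomb by blast
      qed
      then show ?case unfolding eq[symmetric] by (intro csubspace_sum csubspace_lincomb)
    qed (use csubspace_lincomb[of ?r, unfolded csubspace_def] in \<open>blast\<close>)+
  qed
qed

text \<open>Cutting the column with the rank-one projection \<open>p\<close> loses nothing: the charge on the remaining vertical edge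
  is transported by the auxiliary index \<open>k\<close>.\<close>

lemma cut_ring2_span:
  assumes "L \<in> centralizer G (tensor2 u)"
    and ring: "\<And>s t. s \<in> centralizer G (tensor2 u) \<Longrightarrow> t \<in> centralizer G (tensor2 u) \<Longrightarrow>
      R (ring2 ((p \<otimes>\<^sub>K mat 1) ** s) t)"
    and add: "\<And>x y. R x \<Longrightarrow> R y \<Longrightarrow> R (x + y)" and cscale: "\<And>c x. R x \<Longrightarrow> R (cscale c x)"
  shows "R L"
  using assms(1) rep2
proof (induction L rule: centralizer_induct)
  case (twirl i j)
  obtain i1 i2 j1 j2 where ij: "i = (i1, i2)" "j = (j1, j2)" by (metis prod.collapse)
  let ?E = "\<lambda>i j. outer (axis i 1) (axis j 1) :: complex^'n^'n"
  have E: "outer (axis i 1) (axis j 1) = ?E i1 j1 \<otimes>\<^sub>K ?E i2 j2"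
    unfolding ij by (rule outer_axis_Pair)
  define s where "s k = twirl G (tensor2 u) (tensor2 u) (outer v (axis k 1) \<otimes>\<^sub>K ?E i1 j1)" for k
  define t where "t k = twirl G (tensor2 u) (tensor2 u) (outer (K *v axis k 1) f \<otimes>\<^sub>K ?E i2 j2)" for k
  let ?D = "\<lambda>g h. (u g ** ?E i1 j1 ** u (inv g)) \<otimes>\<^sub>K (u h ** ?E i2 j2 ** u (inv h))"
  \<comment> \<open>Invariance of \<open>v\<close> and \<open>f\<close> removes the outermost group
    elements, so only the relative element between the two sites is left for \<open>K\<close> to
    detect.\<close>
  have tr: "trace (p ** (u g ** outer v b ** u (inv g)) ** (u h ** outer c f ** u (inv h)))
      = trace (p ** (outer v b ** (u (inv g) ** u h) ** outer c f))" if "g \<in> carrier G" "h \<in> carrier G" for g h b c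
  proof -
    have "u g ** outer v b = outer v b" "outer c f ** u (inv h) = outer c f"
      using that by (simp_all add: outer_mult_left outer_mult_right v_invariant f_invariant)
    then have "(u g ** outer v b ** u (inv g)) ** (u h ** outer c f ** u (inv h)) = outer v b ** (u (inv g) ** u h) ** outer c f"
      by (simp add: matrix_mul_assoc) (simp flip: matrix_mul_assoc)
    then show ?thesis by (simp flip: matrix_mul_assoc)
  qed
  have "ring2 ((p \<otimes>\<^sub>K mat 1) ** s k) (t k) = (\<Sum>g\<in>carrier G. \<Sum>h\<in>carrier G.
      cscale (trace (p ** (u g ** outer v (axis k 1) ** u (inv g)) ** (u h ** outer (K *v axis k 1) f ** u (inv h)))) (?D g h))" for k
    unfolding s_def t_def twirl_kron sum_mult(2) kron_mult ring_sum(1) by (simp add: ring_sum(2) ring2_kron_kron)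
  also have "\<dots> k = (\<Sum>g\<in>carrier G. \<Sum>h\<in>carrier G.
      cscale (trace (p ** (outer v (axis k 1) ** (u (inv g) ** u h) ** outer (K *v axis k 1) f))) (?D g h))" for k
    using tr by (intro sum.cong) auto
  finally have "(\<Sum>k\<in>UNIV. ring2 ((p \<otimes>\<^sub>K mat 1) ** s k) (t k)) = (\<Sum>g\<in>carrier G. \<Sum>h\<in>carrier G. \<Sum>k\<in>UNIV.
      cscale (trace (p ** (outer v (axis k 1) ** (u (inv g) ** u h) ** outer (K *v axis k 1) f))) (?D g h))"
    by simp (subst sum.swap, rule sum.cong[OF refl], rule sum.swap)
  also have "\<dots> = (\<Sum>g\<in>carrier G. \<Sum>h\<in>carrier G. cscale (trace (p ** (\<Sum>k\<in>UNIV. outer v (axis k 1) ** (u (inv g) ** u h) ** outer (K *v axis k 1) f))) (?D g h))"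
    by (simp add: sum_mult trace_sum cscale_sum_left)
  also have "\<dots> = (\<Sum>g\<in>carrier G. \<Sum>h\<in>carrier G. cscale (trace (u (inv g) ** u h ** K)) (?D g h))"
  proof -
    have "trace (p ** outer v f) = 1"
      using p_idem f_v by (simp add: p_def trace_def mult.commute)
    then show ?thesis unfolding separation_collapse by (simp add: trace_cscale)
  qed
  also have "\<dots> = twirl G (tensor2 u) (tensor2 u) (outer (axis i 1) (axis j 1))"
    unfolding E twirl_kron by (simp add: sum_delta_group)
  finally have eq: "(\<Sum>k\<in>UNIV. ring2 ((p \<otimes>\<^sub>K mat 1) ** s k) (t k)) = twirl G (tensor2 u) (tensor2 u) (outer (axis i 1) (axis j 1))" .
  have R: "R (ring2 ((p \<otimes>\<^sub>K mat 1) ** s k) (t k))" for k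
    unfolding s_def t_def by (intro ring twirl_centralizer rep2)
  have zero: "R 0" using cscale[OF R, of 0] by simp
  have "R (\<Sum>k\<in>S. ring2 ((p \<otimes>\<^sub>K mat 1) ** s k) (t k))" for S
    by (induction S rule: infinite_finite_induct) (auto intro: add zero R)
  then show ?case unfolding eq[symmetric] .
qed (use add cscale in auto)

end

section \<open>From equal torus contractions to algebra isomorphisms\<close>

text \<open>\<open>k x\<close> lists the indices on the edges to the right of column \<open>x\<close>, and \<open>w\<close> those on the vertical edges of one column.\<close>

definition torus_contraction :: "nat \<Rightarrow> nat \<Rightarrow> (nat \<Rightarrow> nat \<Rightarrow> complex^('a::finite \<times> 'a)^('a \<times> 'a)) \<Rightarrow> complex" where
  "torus_contraction n m t = (\<Sum>k\<in>{..<n} \<rightarrow>\<^sub>E ({..<m} \<rightarrow>\<^sub>E UNIV). \<Prod>x<n. \<Sum>w\<in>{..<m} \<rightarrow>\<^sub>E UNIV. \<Prod>y<m.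
     t x y $ (w ((y + m - 1) mod m), k ((x + n - 1) mod n) y) $ (w y, k x y))"

lemma sum_PiE_2: "(\<Sum>k\<in>{..<2} \<rightarrow>\<^sub>E S. F (k (0::nat)) (k 1)) = (\<Sum>a\<in>S. \<Sum>b\<in>S. F a b :: complex)"
  unfolding sum.cartesian_product
  by (rule sum.reindex_bij_witness[where i = "\<lambda>(a, b). \<lambda>x\<in>{..<2}. if x = 0 then a else b" and j = "\<lambda>k. (k 0, k 1)"])
     (auto simp: fun_eq_iff PiE_iff extensional_def restrict_def less_2_cases_iff)

lemma sum_PiE_3: "(\<Sum>k\<in>{..<3} \<rightarrow>\<^sub>E S. F (k (0::nat)) (k 1) (k 2)) = (\<Sum>a\<in>S. \<Sum>b\<in>S. \<Sum>c\<in>S. F a b c :: complex)"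
proof -
  have 3: "x < 3 \<longleftrightarrow> x = 0 \<or> x = 1 \<or> x = 2" for x :: nat by auto
  show ?thesis
    unfolding sum.cartesian_product
    by (rule sum.reindex_bij_witness[where i = "\<lambda>(a, b, c). \<lambda>x\<in>{..<3}. if x = 0 then a else if x = 1 then b else c"
          and j = "\<lambda>k. (k 0, k 1, k 2)"])
       (auto simp: fun_eq_iff PiE_iff extensional_def restrict_def 3)
qed

lemma sum_PiE_UNIV:
  fixes H :: "'a::finite \<times> 'a \<Rightarrow> complex" and H' :: "'a \<times> 'a \<times> 'a \<Rightarrow> complex"
  shows "(\<Sum>k\<in>{..<2} \<rightarrow>\<^sub>E UNIV. H (k (0::nat), k 1)) = (\<Sum>q\<in>UNIV. H q)"
    and "(\<Sum>k\<in>{..<3} \<rightarrow>\<^sub>E UNIV. H' (k (0::nat), k 1, k 2)) = (\<Sum>q\<in>UNIV. H' q)"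
  using sum_PiE_2[where F = "\<lambda>a b. H (a, b)" and S = UNIV] sum_PiE_3[where F = "\<lambda>a b c. H' (a, b, c)" and S = UNIV]
  by (simp_all add: sum_pair[of H] sum_pair[of H'] sum_pair)

lemma prod_lessThan_2: "(\<Prod>y<(2::nat). F y) = F 0 * (F 1 :: complex)"
  by (simp add: numeral_2_eq_2)

lemma prod_lessThan_3: "(\<Prod>y<(3::nat). F y) = F 0 * F 1 * (F 2 :: complex)"
  by (simp add: numeral_3_eq_3 numeral_2_eq_2)

lemma column_2: "(\<Sum>w\<in>{..<2} \<rightarrow>\<^sub>E UNIV. \<Prod>y<2. t y $ (w ((y + 2 - 1) mod 2), l y) $ (w y, r y))
   = ring2 (t 0) (t (1::nat)) $ (l 0, l 1) $ (r 0, r 1)"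
  using sum_PiE_2[where F = "\<lambda>a b. t 0 $ (b, l 0) $ (a, r 0) * t 1 $ (a, l 1) $ (b, r 1)" and S = UNIV]
  unfolding prod_lessThan_2 ring2_nth by simp

lemma column_3: "(\<Sum>w\<in>{..<3} \<rightarrow>\<^sub>E UNIV. \<Prod>y<3. t y $ (w ((y + 3 - 1) mod 3), l y) $ (w y, r y))
   = ring3 (t 0) (t (1::nat)) (t 2) $ (l 0, l 1, l 2) $ (r 0, r 1, r 2)"
  using sum_PiE_3[where F = "\<lambda>a b c. t 0 $ (c, l 0) $ (a, r 0) * t 1 $ (a, l 1) $ (b, r 1) * t 2 $ (b, l 2) $ (c, r 2)" and S = UNIV]
  unfolding prod_lessThan_3 ring3_nth by simp

lemma trace_mult_2: "trace (P ** Q) = (\<Sum>a\<in>UNIV. \<Sum>b\<in>UNIV. P $ b $ a * Q $ a $ b)"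
  by (subst sum.swap) (simp add: trace_def mult_nth)

lemma trace_mult_3: "trace (P ** Q ** R) = (\<Sum>a\<in>UNIV. \<Sum>b\<in>UNIV. \<Sum>c\<in>UNIV. P $ c $ a * Q $ a $ b * R $ b $ c)"
  by (subst sum_last_first3) (simp add: trace_def mult_nth sum_distrib_right, subst sum.swap, rule refl)

text \<open>\<open>enc\<close> packs the indices on the horizontal edges of one cut into a product
  type, over which a column is a matrix. The left index of column 0 belongs to the last column,
  which closes the trace.\<close>

lemma torus_contraction_trace:
  fixes t :: "nat \<Rightarrow> nat \<Rightarrow> complex^('a::finite \<times> 'a)^('a \<times> 'a)" and enc :: "(nat \<Rightarrow> 'a) \<Rightarrow> 's::finite"
  assumes column: "\<And>x l r. (\<Sum>w\<in>{..<m} \<rightarrow>\<^sub>E UNIV. \<Prod>y<m. t x y $ (w ((y + m - 1) mod m), l y) $ (w y, r y)) = R x $ enc l $ enc r"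
    and enc: "\<And>H. (\<Sum>k\<in>{..<m} \<rightarrow>\<^sub>E UNIV. H (enc k)) = (\<Sum>q\<in>UNIV. H q :: complex)"
  shows "torus_contraction 2 m t = trace (R 0 ** R 1)" "torus_contraction 3 m t = trace (R 0 ** R 1 ** R 2)"
proof -
  have "torus_contraction 2 m t = (\<Sum>k\<in>{..<2::nat} \<rightarrow>\<^sub>E ({..<m} \<rightarrow>\<^sub>E UNIV). R 0 $ enc (k 1) $ enc (k 0) * R 1 $ enc (k 0) $ enc (k 1))"
    unfolding torus_contraction_def unfolding column unfolding prod_lessThan_2 by simp
  also have "\<dots> = trace (R 0 ** R 1)"
    unfolding trace_mult_2 enc[symmetric] by (rule sum_PiE_2)
  finally show "torus_contraction 2 m t = trace (R 0 ** R 1)" .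
  have "torus_contraction 3 m t = (\<Sum>k\<in>{..<3::nat} \<rightarrow>\<^sub>E ({..<m} \<rightarrow>\<^sub>E UNIV).
      R 0 $ enc (k 2) $ enc (k 0) * R 1 $ enc (k 0) $ enc (k 1) * R 2 $ enc (k 1) $ enc (k 2))"
    unfolding torus_contraction_def unfolding column unfolding prod_lessThan_3 by simp
  also have "\<dots> = trace (R 0 ** R 1 ** R 2)"
    unfolding trace_mult_3 enc[symmetric] by (rule sum_PiE_3)
  finally show "torus_contraction 3 m t = trace (R 0 ** R 1 ** R 2)" .
qed

lemmas torus_contraction_n2 = torus_contraction_trace[OF column_2 sum_PiE_UNIV(1)]
lemmas torus_contraction_n3 = torus_contraction_trace[OF column_3 sum_PiE_UNIV(2)]

text \<open>\<open>rows\<close> is the same equality read with the two directions of the torus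
  exchanged; it supplies the information on the vertical legs.\<close>

locale torus_equal =
  A: site_family G uA KA vA fA a + B: site_family G uB KB vB fB b
  for G :: "('g, 'z) monoid_scheme" (structure)
    and uA :: "'g \<Rightarrow> complex^'m^'m" and KA vA fA and a :: "'p::finite \<Rightarrow> complex^('m \<times> 'm)^('m \<times> 'm)"
    and uB :: "'g \<Rightarrow> complex^'n^'n" and KB vB fB and b :: "'p \<Rightarrow> complex^('n \<times> 'n)^('n \<times> 'n)" +
  assumes columns: "n \<ge> 1 \<Longrightarrow> m \<ge> 1 \<Longrightarrow> torus_contraction n m (\<lambda>x y. a (q x y)) = torus_contraction n m (\<lambda>x y. b (q x y))"
    and rows: "n \<ge> 1 \<Longrightarrow> m \<ge> 1 \<Longrightarrow>
      torus_contraction n m (\<lambda>x y. flip (a (q x y))) = torus_contraction n m (\<lambda>x y. flip (b (q x y)))"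
begin

abbreviation "A1 \<equiv> centralizer G uA"
abbreviation "A2 \<equiv> centralizer G (tensor2 uA)"
abbreviation "A3 \<equiv> centralizer G (tensor3 uA)"
abbreviation "B2 \<equiv> centralizer G (tensor2 uB)"
abbreviation "B3 \<equiv> centralizer G (tensor3 uB)"

text \<open>The configuration is chosen so that column \<open>x\<close> carries the label tuple in
  position \<open>x\<close> of the list and the projections distribute its entries over the
  heights.\<close>

lemmas trace_ring2 =
  columns[of 2 2 "\<lambda>x y. ([fst, snd] ! y) ([s, t] ! x)" for s t, simplified torus_contraction_n2, simplified]
  columns[of 3 2 "\<lambda>x y. ([fst, snd] ! y) ([s, t, r] ! x)" for s t r, simplified torus_contraction_n2, simplified]
  rows[of 2 2 "\<lambda>x y. ([fst, snd] ! y) ([s, t] ! x)" for s t, simplified torus_contraction_n2, simplified]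
  rows[of 3 2 "\<lambda>x y. ([fst, snd] ! y) ([s, t, r] ! x)" for s t r, simplified torus_contraction_n2, simplified]

lemmas trace_ring3 =
  columns[of 2 3 "\<lambda>x y. ([fst, \<lambda>q. fst (snd q), \<lambda>q. snd (snd q)] ! y) ([s, t] ! x)" for s t,
    simplified torus_contraction_n3, simplified]
  columns[of 3 3 "\<lambda>x y. ([fst, \<lambda>q. fst (snd q), \<lambda>q. snd (snd q)] ! y) ([s, t, r] ! x)" for s t r,
    simplified torus_contraction_n3, simplified]

lemma \<Phi>_exists: "\<exists>\<Phi>. alg_iso A2 B2 \<Phi> \<and> (\<forall>\<phi> \<psi>. \<Phi> (ring2 (lincomb a \<phi>) (lincomb a \<psi>)) = ring2 (lincomb b \<phi>) (lincomb b \<psi>))"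
  unfolding ring2_lincomb
  by (rule trace_lincomb_iso[OF A.range_ring2 B.range_ring2 subalgebra_centralizer subalgebra_centralizer
    A.nondegenerate_centralizer[OF A.rep2] A.nondegenerate_centralizer[OF B.rep2]]) (auto simp: trace_ring2)

lemma \<Psi>_exists: "\<exists>\<Psi>. alg_iso A2 B2 \<Psi> \<and>
    (\<forall>\<phi> \<psi>. \<Psi> (ring2 (flip (lincomb a \<phi>)) (flip (lincomb a \<psi>))) = ring2 (flip (lincomb b \<phi>)) (flip (lincomb b \<psi>)))"
  unfolding flip_lincomb ring2_lincomb
  by (rule trace_lincomb_iso[OF site_family.range_ring2[OF A.site_family_flip] site_family.range_ring2[OF B.site_family_flip]
    subalgebra_centralizer subalgebra_centralizer
    A.nondegenerate_centralizer[OF A.rep2] A.nondegenerate_centralizer[OF B.rep2]]) (auto simp: trace_ring2)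

lemma \<Phi>3_exists: "\<exists>\<Phi>. alg_iso A3 B3 \<Phi> \<and>
    (\<forall>\<phi> \<psi> \<omega>. \<Phi> (ring3 (lincomb a \<phi>) (lincomb a \<psi>) (lincomb a \<omega>)) = ring3 (lincomb b \<phi>) (lincomb b \<psi>) (lincomb b \<omega>))"
  unfolding ring3_lincomb
  by (rule trace_lincomb_iso[OF A.range_ring3 B.range_ring3 subalgebra_centralizer subalgebra_centralizer
    A.nondegenerate_centralizer[OF A.rep3] A.nondegenerate_centralizer[OF B.rep3]]) (auto simp: trace_ring3)

definition "\<Phi> = (SOME \<Phi>. alg_iso A2 B2 \<Phi> \<and> (\<forall>\<phi> \<psi>. \<Phi> (ring2 (lincomb a \<phi>) (lincomb a \<psi>)) = ring2 (lincomb b \<phi>) (lincomb b \<psi>)))"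

definition "\<Psi> = (SOME \<Psi>. alg_iso A2 B2 \<Psi> \<and>
  (\<forall>\<phi> \<psi>. \<Psi> (ring2 (flip (lincomb a \<phi>)) (flip (lincomb a \<psi>))) = ring2 (flip (lincomb b \<phi>)) (flip (lincomb b \<psi>))))"

definition "\<Phi>3 = (SOME \<Phi>. alg_iso A3 B3 \<Phi> \<and>
  (\<forall>\<phi> \<psi> \<omega>. \<Phi> (ring3 (lincomb a \<phi>) (lincomb a \<psi>) (lincomb a \<omega>)) = ring3 (lincomb b \<phi>) (lincomb b \<psi>) (lincomb b \<omega>)))"

lemmas \<Phi>_props = someI_ex[OF \<Phi>_exists, folded \<Phi>_def, THEN conjunct1] someI_ex[OF \<Phi>_exists, folded \<Phi>_def, THEN conjunct2, rule_format]
lemmas \<Psi>_props = someI_ex[OF \<Psi>_exists, folded \<Psi>_def, THEN conjunct1] someI_ex[OF \<Psi>_exists, folded \<Psi>_def, THEN conjunct2, rule_format]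
lemmas \<Phi>3_props = someI_ex[OF \<Phi>3_exists, folded \<Phi>3_def, THEN conjunct1] someI_ex[OF \<Phi>3_exists, folded \<Phi>3_def, THEN conjunct2, rule_format]

text \<open>The linear map induced on single sites: the same coefficients with the sites of the
  other family. That the choice is harmless is \<open>lincomb_eq\<close>.\<close>

definition "\<omega> t = lincomb b (SOME \<phi>. lincomb a \<phi> = t)"

text \<open>In a column of two sites the second is chosen so that it is the corner on the side where
  vanishing is to be shown. The column is then the flipped first site, and \<open>\<Phi>\<close>
  transfers the vanishing.\<close>

lemma lincomb_zero: "lincomb a \<delta> = 0 \<longleftrightarrow> lincomb b \<delta> = 0"
proof
  assume "lincomb a \<delta> = 0"
  obtain \<tau> where \<tau>: "lincomb b \<tau> = swap" using swap_centralizer[of G uB] unfolding B.range_a[symmetric] by (metis imageE)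
  have "flip (lincomb b \<delta>) = \<Phi> (ring2 (lincomb a \<delta>) (lincomb a \<tau>))"
    unfolding \<Phi>_props(2) \<tau> by simp
  also have "\<dots> = 0" using \<open>lincomb a \<delta> = 0\<close> alg_iso_zero[OF \<Phi>_props(1) subalgebra_centralizer] by (simp add: ring_zero)
  finally have "flip (flip (lincomb b \<delta>)) = flip 0" by simp
  then show "lincomb b \<delta> = 0" by (simp add: vec_eq_iff flip_def)
next
  assume "lincomb b \<delta> = 0"
  obtain \<tau> where \<tau>: "lincomb a \<tau> = swap" using swap_centralizer[of G uA] unfolding A.range_a[symmetric] by (metis imageE)
  have "\<Phi> (flip (lincomb a \<delta>)) = \<Phi> (ring2 (lincomb a \<delta>) (lincomb a \<tau>))"
    unfolding \<tau> by simp
  also have "\<dots> = \<Phi> 0" using \<open>lincomb b \<delta> = 0\<close> alg_iso_zero[OF \<Phi>_props(1) subalgebra_centralizer]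
    by (simp add: \<Phi>_props(2) ring_zero)
  finally have "flip (lincomb a \<delta>) = 0"
    using alg_isoD(2)[OF \<Phi>_props(1)] A.range_a subalgebra_centralizer[of G "tensor2 uA"]
    by (auto dest!: inj_onD intro!: flip_centralizer simp: subalgebra_def csubspace_def)
  then have "flip (flip (lincomb a \<delta>)) = flip 0" by simp
  then show "lincomb a \<delta> = 0" by (simp add: vec_eq_iff flip_def)
qed

lemma lincomb_eq: "lincomb a \<phi> = lincomb a \<psi> \<longleftrightarrow> lincomb b \<phi> = lincomb b \<psi>"
  using lincomb_zero[of "\<lambda>s. \<phi> s - \<psi> s"] by (simp flip: lincomb_diff)

lemma \<omega>_lincomb: "\<omega> (lincomb a \<phi>) = lincomb b \<phi>"
  unfolding \<omega>_def
  by (rule lincomb_eq[THEN iffD1]) (rule someI[where P = "\<lambda>\<phi>'. lincomb a \<phi>' = lincomb a \<phi>"], rule refl)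

lemma A2_cases: "t \<in> A2 \<Longrightarrow> \<exists>\<phi>. t = lincomb a \<phi>"
  using A.range_a by blast

lemma \<omega>_site: "\<omega> (a s) = b s"
  using \<omega>_lincomb lincomb_single by metis

lemma \<omega>_surj: "t \<in> B2 \<Longrightarrow> \<exists>s\<in>A2. \<omega> s = t"
  unfolding B.range_a[symmetric] A.range_a[symmetric] using \<omega>_lincomb by (metis imageE rangeI)

lemma ring_iso:
  assumes "s \<in> A2" "t \<in> A2"
  shows "\<Phi> (ring2 s t) = ring2 (\<omega> s) (\<omega> t)" "\<Psi> (ring2 (flip s) (flip t)) = ring2 (flip (\<omega> s)) (flip (\<omega> t))"
    "r \<in> A2 \<Longrightarrow> \<Phi>3 (ring3 s t r) = ring3 (\<omega> s) (\<omega> t) (\<omega> r)"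
  using A2_cases[OF assms(1)] A2_cases[OF assms(2)] A2_cases[of r]
  by (auto simp: \<Phi>_props \<Psi>_props \<Phi>3_props \<omega>_lincomb)

end

section \<open>Bimodule structure and cutting an edge\<close>

lemma kron_one_cancel:
  "P \<otimes>\<^sub>K (mat 1 :: complex^'c::finite^'c) = Q \<otimes>\<^sub>K mat 1 \<Longrightarrow> P = Q" "(mat 1 :: complex^'c^'c) \<otimes>\<^sub>K P = mat 1 \<otimes>\<^sub>K Q \<Longrightarrow> P = Q"
proof -
  have *: "(\<And>i j. P $ i $ j * (mat 1 :: complex^'c^'c) $ undefined $ undefined = Q $ i $ j * (mat 1 :: complex^'c^'c) $ undefined $ undefined) \<Longrightarrow> P = Q"
    by (simp add: vec_eq_iff mat_nth)
  show "P = Q" if "P \<otimes>\<^sub>K (mat 1 :: complex^'c^'c) = Q \<otimes>\<^sub>K mat 1"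
    by (rule *) (use that in \<open>metis kron_nth\<close>)
  show "P = Q" if "(mat 1 :: complex^'c^'c) \<otimes>\<^sub>K P = mat 1 \<otimes>\<^sub>K Q"
    by (rule *) (use that in \<open>metis kron_nth mult.commute\<close>)
qed

text \<open>If \<open>\<Phi> (x \<otimes> 1) = y \<otimes> 1\<close>, then \<open>y = marginal \<Phi> x\<close>.\<close>

definition marginal :: "(complex^('a::finite \<times> 'a)^('a \<times> 'a) \<Rightarrow> complex^('b::finite \<times> 'b)^('b \<times> 'b)) \<Rightarrow> complex^'a^'a \<Rightarrow> complex^'b^'b" where
  "marginal \<Phi> x = cscale (1 / of_nat CARD('b)) (partial_trace (flip (\<Phi> (x \<otimes>\<^sub>K mat 1))))"

lemma outer_mult_outer: "outer v f ** E ** outer v f = cscale (\<Sum>j\<in>UNIV. \<Sum>i\<in>UNIV. f $ i * E $ i $ j * v $ j) (outer v f)"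
  by (simp add: outer_mult_left outer_mult_right vec_eq_iff matrix_vector_mult_def vector_matrix_mult_def
    sum_distrib_left sum_distrib_right mult_ac)

lemma kron_one_mem: "x \<in> centralizer G u \<Longrightarrow> x \<otimes>\<^sub>K mat 1 \<in> centralizer G (tensor2 u)"
  "x \<in> centralizer G u \<Longrightarrow> mat 1 \<otimes>\<^sub>K x \<in> centralizer G (tensor2 u)"
  using centralizer_kron centralizer_one by blast+

text \<open>Abstracts one direction of the torus; it is instantiated once for columns and once, with
  flipped sites, for rows.\<close>

locale column_iso = finite_group G for G (structure) +
  fixes u :: "'a \<Rightarrow> complex^'m^'m" and w :: "'a \<Rightarrow> complex^'n^'n"
    and \<Phi> \<omega> :: "complex^('m \<times> 'm)^('m \<times> 'm) \<Rightarrow> complex^('n \<times> 'n)^('n \<times> 'n)"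
  assumes u: "representation G u" and w: "representation G w"
    and iso: "alg_iso (centralizer G (tensor2 u)) (centralizer G (tensor2 w)) \<Phi>"
    and ring: "s \<in> centralizer G (tensor2 u) \<Longrightarrow> t \<in> centralizer G (tensor2 u) \<Longrightarrow> \<Phi> (ring2 s t) = ring2 (\<omega> s) (\<omega> t)"
    and surj: "r \<in> centralizer G (tensor2 w) \<Longrightarrow> \<exists>s\<in>centralizer G (tensor2 u). \<omega> s = r"
begin

text \<open>Exchanging the two sites of a column flips its transfer matrix, on either side of
  \<open>\<omega>\<close>. Taking the corner as one of the sites lets \<open>t\<close> itself be the
  column.\<close>

lemma iso_flip:
  assumes "t \<in> centralizer G (tensor2 u)"
  shows "\<Phi> (flip t) = flip (\<Phi> t)"
proof -
  have "\<Phi> (flip t) = ring2 (\<omega> t) (\<omega> swap)" using ring[OF assms swap_centralizer] by simp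
  also have "\<dots> = flip (ring2 (\<omega> swap) (\<omega> t))" by (simp add: flip_ring2)
  also have "\<dots> = flip (\<Phi> t)" using ring[OF swap_centralizer assms] by simp
  finally show ?thesis .
qed

text \<open>Multiplying the horizontal leg of the first site by \<open>x\<close> multiplies the
  column by \<open>x\<close> on its first leg. Closing with the site that \<open>\<omega>\<close>
  sends to the corner shows that \<open>\<omega>\<close> turns this into multiplication by
  \<open>Z\<close>. Closing with the site sent to the identity leaves a partial trace on one leg and
  the identity on the other, which forces the product form; the trace of the identity accounts for
  the normalisation in \<open>marginal\<close>.\<close>

lemma bimodule:
  assumes x: "x \<in> centralizer G u"
  shows "\<Phi> (x \<otimes>\<^sub>K mat 1) = marginal \<Phi> x \<otimes>\<^sub>K mat 1"
    and "t \<in> centralizer G (tensor2 u) \<Longrightarrow> \<omega> ((mat 1 \<otimes>\<^sub>K x) ** t) = (mat 1 \<otimes>\<^sub>K marginal \<Phi> x) ** \<omega> t"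
    and "t \<in> centralizer G (tensor2 u) \<Longrightarrow> \<omega> (t ** (mat 1 \<otimes>\<^sub>K x)) = \<omega> t ** (mat 1 \<otimes>\<^sub>K marginal \<Phi> x)"
proof -
  let ?A = "centralizer G (tensor2 u)"
  define Z where "Z = flip (\<Phi> (x \<otimes>\<^sub>K mat 1))"
  note x2 = kron_one_mem[OF x]
  obtain t1 where t1: "t1 \<in> ?A" "\<omega> t1 = mat 1" using surj centralizer_one by blast
  obtain s0 where s0: "s0 \<in> ?A" "\<omega> s0 = swap" using surj swap_centralizer by blast
  note [simp] = centralizer_mult x2
  have ring_mem: "ring2 s t \<in> ?A" if "s \<in> ?A" "t \<in> ?A" for s t
    using ring_centralizer(1)[OF u that that(1)] .
  have left: "ring2 (\<omega> ((mat 1 \<otimes>\<^sub>K x) ** s)) (\<omega> t) = \<Phi> (x \<otimes>\<^sub>K mat 1) ** ring2 (\<omega> s) (\<omega> t)" if "s \<in> ?A" "t \<in> ?A" for s t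
    using that by (simp flip: ring add: ring2_horizontal alg_isoD(5)[OF iso] ring_mem)
  have right: "ring2 (\<omega> (s ** (mat 1 \<otimes>\<^sub>K x))) (\<omega> t) = ring2 (\<omega> s) (\<omega> t) ** \<Phi> (x \<otimes>\<^sub>K mat 1)" if "s \<in> ?A" "t \<in> ?A" for s t
    using that by (simp flip: ring add: ring2_horizontal alg_isoD(5)[OF iso] ring_mem)
  have l: "\<omega> ((mat 1 \<otimes>\<^sub>K x) ** t) = Z ** \<omega> t" if "t \<in> ?A" for t
    using left[OF that s0(1)] by (metis Z_def flip_flip flip_mult ring2_swap_right s0(2))
  have r: "\<omega> (t ** (mat 1 \<otimes>\<^sub>K x)) = \<omega> t ** Z" if "t \<in> ?A" for t
    using right[OF that s0(1)] by (metis Z_def flip_flip flip_mult ring2_swap_right s0(2))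
  have "partial_trace Z \<otimes>\<^sub>K mat 1 = ring2 (\<omega> ((mat 1 \<otimes>\<^sub>K x) ** t1)) (\<omega> t1)"
    using l[OF t1(1)] by (simp add: t1(2) ring2_one)
  also have "\<dots> = \<Phi> (x \<otimes>\<^sub>K mat 1) ** (partial_trace (mat 1 :: complex^('n \<times> 'n)^('n \<times> 'n)) \<otimes>\<^sub>K (mat 1 :: complex^'n^'n))"
    using left[OF t1(1) t1(1)] by (simp add: t1(2) ring2_one)
  also have "partial_trace (mat 1 :: complex^('n \<times> 'n)^('n \<times> 'n)) = cscale (of_nat CARD('n)) (mat 1)"
    by (simp add: vec_eq_iff mat_nth)
  finally have "partial_trace Z \<otimes>\<^sub>K (mat 1 :: complex^'n^'n) = cscale (of_nat CARD('n)) (\<Phi> (x \<otimes>\<^sub>K mat 1))"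
    by (simp add: cscale_kron kron_one)
  then have "cscale (1 / of_nat CARD('n)) (partial_trace Z \<otimes>\<^sub>K (mat 1 :: complex^'n^'n)) = \<Phi> (x \<otimes>\<^sub>K mat 1)"
    by simp
  then show eq: "\<Phi> (x \<otimes>\<^sub>K mat 1) = marginal \<Phi> x \<otimes>\<^sub>K mat 1"
    unfolding marginal_def Z_def cscale_kron by simp
  have Z: "Z = mat 1 \<otimes>\<^sub>K marginal \<Phi> x" unfolding Z_def eq by simp
  show "t \<in> ?A \<Longrightarrow> \<omega> ((mat 1 \<otimes>\<^sub>K x) ** t) = (mat 1 \<otimes>\<^sub>K marginal \<Phi> x) ** \<omega> t"
    "t \<in> ?A \<Longrightarrow> \<omega> (t ** (mat 1 \<otimes>\<^sub>K x)) = \<omega> t ** (mat 1 \<otimes>\<^sub>K marginal \<Phi> x)"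
    using l r unfolding Z by auto
qed

lemma iso_kron_one: "x \<in> centralizer G u \<Longrightarrow> \<Phi> (mat 1 \<otimes>\<^sub>K x) = mat 1 \<otimes>\<^sub>K marginal \<Phi> x"
  using iso_flip[OF kron_one_mem(1), of x] bimodule(1)[of x] by simp

lemma iso_kron: "x \<in> centralizer G u \<Longrightarrow> y \<in> centralizer G u \<Longrightarrow> \<Phi> (x \<otimes>\<^sub>K y) = marginal \<Phi> x \<otimes>\<^sub>K marginal \<Phi> y"
  by (simp add: kron_split(1)[of x y] alg_isoD(5)[OF iso] kron_one_mem bimodule(1) iso_kron_one) (simp add: kron_mult)

lemma marginal_linear:
  assumes "x \<in> centralizer G u" "y \<in> centralizer G u"
  shows "marginal \<Phi> (x + y) = marginal \<Phi> x + marginal \<Phi> y" "marginal \<Phi> (cscale c x) = cscale c (marginal \<Phi> x)"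
    "marginal \<Phi> (x ** y) = marginal \<Phi> x ** marginal \<Phi> y"
proof -
  have "\<Phi> ((x + y) \<otimes>\<^sub>K mat 1) = \<Phi> (x \<otimes>\<^sub>K mat 1) + \<Phi> (y \<otimes>\<^sub>K mat 1)"
    using alg_isoD(4)[OF iso kron_one_mem(1)[OF assms(1)] kron_one_mem(1)[OF assms(2)]]
    by (simp add: kron_def vec_eq_iff algebra_simps plus_vec_def)
  then show "marginal \<Phi> (x + y) = marginal \<Phi> x + marginal \<Phi> y"
    by (simp add: marginal_def vec_eq_iff algebra_simps sum.distrib)
  show "marginal \<Phi> (cscale c x) = cscale c (marginal \<Phi> x)"
    using alg_isoD(6)[OF iso kron_one_mem(1)[OF assms(1)]]
    by (simp add: cscale_kron marginal_def flip_cscale) (simp add: vec_eq_iff sum_distrib_left mult_ac)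
  have "\<Phi> ((x ** y) \<otimes>\<^sub>K mat 1) = \<Phi> (x \<otimes>\<^sub>K mat 1) ** \<Phi> (y \<otimes>\<^sub>K mat 1)"
    using alg_isoD(5)[OF iso kron_one_mem(1)[OF assms(1)] kron_one_mem(1)[OF assms(2)]]
    by (simp add: kron_mult)
  then have "marginal \<Phi> (x ** y) \<otimes>\<^sub>K (mat 1 :: complex^'n^'n) = (marginal \<Phi> x ** marginal \<Phi> y) \<otimes>\<^sub>K mat 1"
    using assms by (simp add: bimodule(1) centralizer_mult kron_mult)
  then show "marginal \<Phi> (x ** y) = marginal \<Phi> x ** marginal \<Phi> y" by (rule kron_one_cancel)
qed

lemma marginal_inj: "x \<in> centralizer G u \<Longrightarrow> marginal \<Phi> x = 0 \<Longrightarrow> x = 0"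
proof -
  assume x: "x \<in> centralizer G u" and "marginal \<Phi> x = 0"
  then have "\<Phi> (x \<otimes>\<^sub>K mat 1) = 0 \<otimes>\<^sub>K mat 1" by (simp add: bimodule(1))
  also have "\<dots> = \<Phi> 0" using alg_iso_zero[OF iso subalgebra_centralizer] by (simp add: vec_eq_iff kron_def)
  finally have "x \<otimes>\<^sub>K (mat 1 :: complex^'m^'m) = 0" using alg_isoD(2)[OF iso] kron_one_mem(1)[OF x] subalgebra_centralizer[of G "tensor2 u"]
    by (auto dest!: inj_onD simp: subalgebra_def csubspace_def)
  then have "x \<otimes>\<^sub>K (mat 1 :: complex^'m^'m) = 0 \<otimes>\<^sub>K (mat 1 :: complex^'m^'m)" by (simp add: vec_eq_iff kron_def)
  then show "x = 0" by (rule kron_one_cancel)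
qed

text \<open>Since \<open>p \<otimes> p\<close> is minimal, so is \<open>q \<otimes> q\<close>, and a multiple of \<open>q \<otimes> q\<close> that equals \<open>(q \<otimes> q) swap\<close> forces \<open>q\<close> to have rank one.\<close>

lemma marginal_rank_one:
  assumes p: "outer v f \<in> centralizer G u" "(\<Sum>i\<in>UNIV. f $ i * v $ i) = 1"
  obtains v' f' where "marginal \<Phi> (outer v f) = outer v' f'" "(\<Sum>i\<in>UNIV. f' $ i * v' $ i) = 1"
proof -
  let ?p = "outer v f"
  define q where "q = marginal \<Phi> ?p"
  define P where "P = ?p \<otimes>\<^sub>K ?p"
  have idem: "?p ** ?p = ?p"
    using p(2) outer_mult_outer[of v f "mat 1"] by (simp add: mat_nth)
  have "?p \<noteq> 0"
  proof
    assume "?p = 0"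
    then have "f $ i * v $ i = 0" for i by (auto simp: vec_eq_iff)
    then show False using p(2) by simp
  qed
  then have "q \<noteq> 0" using marginal_inj[OF p(1)] unfolding q_def by blast
  have qq: "q ** q = q" unfolding q_def using marginal_linear(3)[OF p(1) p(1)] idem by simp
  \<comment> \<open>The swap is pulled back because it is not yet known that \<open>\<Phi>\<close>
    fixes it; that proof relies on the present lemma.\<close>
  obtain E where E: "E \<in> centralizer G (tensor2 u)" "\<Phi> E = swap" using alg_isoD(8)[OF iso swap_centralizer] by blast
  have PP: "P \<in> centralizer G (tensor2 u)" unfolding P_def using centralizer_kron p(1) by blast
  have \<Phi>P: "\<Phi> P = q \<otimes>\<^sub>K q" unfolding P_def q_def using iso_kron p(1) by blast
  have "P = outer (\<chi> i. v $ fst i * v $ snd i) (\<chi> i. f $ fst i * f $ snd i)"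
    by (simp add: P_def vec_eq_iff kron_def mult_ac)
  then obtain c where "P ** E ** P = cscale c P" using outer_mult_outer by blast
  then have "\<Phi> P ** swap ** \<Phi> P = cscale c (\<Phi> P)"
    using alg_isoD(6)[OF iso PP, of c] alg_isoD(5)[OF iso PP E(1)] alg_isoD(5)[OF iso centralizer_mult[OF PP E(1)] PP] E(2)
    by simp
  then have qs: "(q \<otimes>\<^sub>K q) ** swap = cscale c (q \<otimes>\<^sub>K q)"
    unfolding \<Phi>P matrix_mul_assoc[symmetric] swap_kron unfolding matrix_mul_assoc kron_mult qq .
  have entry: "q $ i $ l * q $ j $ k = c * (q $ i $ k * q $ j $ l)" for i j k l
    using arg_cong[OF qs, of "\<lambda>M. M $ (i, j) $ (k, l)"] by (simp add: mult_nth sum_pair)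
  obtain j k where jk: "q $ j $ k \<noteq> 0" using \<open>q \<noteq> 0\<close> by (auto simp: vec_eq_iff)
  \<comment> \<open>Dividing \<open>entry\<close> by the nonzero entry \<open>q $ j $ k\<close>
    writes \<open>q\<close> as a multiple of its column \<open>k\<close> times its row
    \<open>j\<close>.\<close>
  define v' where "v' = (\<chi> i. c * q $ i $ k / q $ j $ k)"
  define f' where "f' = (\<chi> l. q $ j $ l)"
  have "q $ i $ l = v' $ i * f' $ l" for i l
    using entry[of i l j k] jk by (simp add: v'_def f'_def nonzero_eq_divide_eq mult_ac)
  then have q: "q = outer v' f'" by (simp add: vec_eq_iff)
  moreover have "(\<Sum>i\<in>UNIV. f' $ i * v' $ i) = 1"
  proof -
    have "cscale (\<Sum>i\<in>UNIV. f' $ i * v' $ i) q = q"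
      using qq outer_mult_outer[of v' f' "mat 1"] unfolding q by (simp add: mat_nth)
    then have "(\<Sum>i\<in>UNIV. f' $ i * v' $ i) * q $ j $ k = q $ j $ k" by (metis cscale_nth)
    then show ?thesis using jk by simp
  qed
  ultimately show ?thesis using that unfolding q_def by blast
qed

end

section \<open>Monoidality\<close>

lemma leg12_one: "leg12_3 (mat 1) x = mat 1 \<otimes>\<^sub>K mat 1 \<otimes>\<^sub>K x"
  by (simp add: kron_one[symmetric] del: kron_one)

lemma rank_one_sandwich:
  "\<exists>h. (outer v f \<otimes>\<^sub>K mat 1) ** W ** (outer v f \<otimes>\<^sub>K mat 1) = outer v f \<otimes>\<^sub>K (h :: complex^'b^'b)"
proof (induction W rule: kron_induct)
  case (kron P Q)
  show ?case
    by (rule exI[of _ "cscale (\<Sum>j\<in>UNIV. \<Sum>i\<in>UNIV. f $ i * P $ i $ j * v $ j) Q"])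
       (simp add: kron_mult outer_mult_outer cscale_kron)
next
  case (add x y)
  then obtain h h' where "(outer v f \<otimes>\<^sub>K mat 1) ** x ** (outer v f \<otimes>\<^sub>K mat 1) = outer v f \<otimes>\<^sub>K h"
    "(outer v f \<otimes>\<^sub>K mat 1) ** y ** (outer v f \<otimes>\<^sub>K mat 1) = outer v f \<otimes>\<^sub>K h'" by blast
  then show ?case by (intro exI[of _ "h + h'"]) (simp add: kron_add(1) matrix_add_ldistrib matrix_add_rdistrib)
qed

lemma rotate3_sum: "rotate3 (\<Sum>s\<in>S. M s) = (\<Sum>s\<in>S. rotate3 (M s))"
  by (simp add: vec_eq_iff rotate3_def sum_matrix_nth)

lemma leg_exchange:
  "leg12 swap ** leg13 t ** leg12 swap = leg23 t" "leg23 swap ** leg12 t ** leg23 swap = leg13 t"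
proof -
  have s: "leg12 swap ** (P \<otimes>\<^sub>K Q \<otimes>\<^sub>K R) ** leg12 swap = Q \<otimes>\<^sub>K P \<otimes>\<^sub>K R" for P Q R :: "complex^'a^'a"
    unfolding leg_kron(1)[symmetric] leg12_mult swap_kron by (simp add: leg12_mult matrix_mul_assoc[symmetric])
  have s': "leg23 swap ** (P \<otimes>\<^sub>K Q \<otimes>\<^sub>K R) ** leg23 swap = P \<otimes>\<^sub>K R \<otimes>\<^sub>K Q" for P Q R :: "complex^'a^'a"
    by (simp add: kron_mult swap_kron matrix_mul_assoc[symmetric])
  show "leg12 swap ** leg13 t ** leg12 swap = leg23 t" 
    by (induction t rule: kron_induct) (simp_all add: s ring_linear)
  show "leg23 swap ** leg12 t ** leg23 swap = leg13 t"
    by (induction t rule: kron_induct) (simp_all add: s' ring_linear)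
qed

text \<open>An operator that may be moved from legs 1 and 2 to legs 1 and 3 acts trivially on its
  second factor; flip invariance carries this over to the first.\<close>

lemma leg12_eq_leg13:
  fixes z :: "complex^('a::finite \<times> 'a)^('a \<times> 'a)"
  assumes "leg12 z = leg13 z" "flip z = z"
  obtains c where "z = cscale c (mat 1)"
proof -
  have e: "z $ (i1, i2) $ (j1, j2) * mat 1 $ i3 $ j3 = z $ (i1, i3) $ (j1, j3) * mat 1 $ i2 $ j2" for i1 i2 i3 j1 j2 j3
    using arg_cong[OF assms(1), of "\<lambda>M. M $ (i1, i2, i3) $ (j1, j2, j3)"] by simp
  define \<zeta> where "\<zeta> i j = z $ (i, undefined) $ (j, undefined)" for i j
  have z: "z $ (i1, i2) $ (j1, j2) = \<zeta> i1 j1 * mat 1 $ i2 $ j2" for i1 i2 j1 j2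
    using e[of i1 i2 j1 j2 undefined undefined] by (simp add: \<zeta>_def mat_nth)
  have f: "z $ (i1, i2) $ (j1, j2) = z $ (i2, i1) $ (j2, j1)" for i1 i2 j1 j2
    using arg_cong[OF assms(2), of "\<lambda>M. M $ (i1, i2) $ (j1, j2)"] by simp
  have s: "\<zeta> i j = \<zeta> undefined undefined * mat 1 $ i $ j" for i j
    using f[of i undefined j undefined] unfolding z by (simp add: mat_nth)
  have "z $ (i1, i2) $ (j1, j2) = cscale (\<zeta> undefined undefined) (mat 1) $ (i1, i2) $ (j1, j2)" for i1 i2 j1 j2
    unfolding z s[of i1 j1] by (simp add: mat_nth)
  then have "z = cscale (\<zeta> undefined undefined) (mat 1)"
    by (simp add: vec_eq_iff)
  then show ?thesis using that by blast
qed

context torus_equal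
begin

lemmas \<Phi>_iso = \<Phi>_props(1) and \<Psi>_iso = \<Psi>_props(1) and \<Phi>3_iso = \<Phi>3_props(1)

definition "\<phi> = marginal \<Phi>"
definition "\<theta> = marginal \<Psi>"
definition "\<omega>' t = flip (\<omega> (flip t))"

lemma ring_iso': "s \<in> A2 \<Longrightarrow> t \<in> A2 \<Longrightarrow> \<Psi> (ring2 s t) = ring2 (\<omega>' s) (\<omega>' t)"
  using ring_iso(2)[of "flip s" "flip t"] by (simp add: \<omega>'_def flip_centralizer)

lemma \<omega>'_surj: "t \<in> B2 \<Longrightarrow> \<exists>s\<in>A2. \<omega>' s = t"
proof -
  assume "t \<in> B2"
  then obtain s where "s \<in> A2" "\<omega> s = flip t" using \<omega>_surj flip_centralizer by blast
  then have "flip s \<in> A2" "\<omega>' (flip s) = t" by (simp_all add: \<omega>'_def flip_centralizer)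
  then show ?thesis by blast
qed

sublocale H: column_iso G uA uB \<Phi> \<omega>
  by standard (use A.rep B.rep \<Phi>_iso ring_iso(1) \<omega>_surj in auto)

sublocale V: column_iso G uA uB \<Psi> \<omega>'
  by standard (use A.rep B.rep \<Psi>_iso ring_iso' \<omega>'_surj in auto)

lemmas vertical' = V.bimodule[folded \<theta>_def]

lemma vertical:
  assumes "y \<in> A1" "t \<in> A2"
  shows "\<omega> ((y \<otimes>\<^sub>K mat 1) ** t) = (\<theta> y \<otimes>\<^sub>K mat 1) ** \<omega> t" "\<omega> (t ** (y \<otimes>\<^sub>K mat 1)) = \<omega> t ** (\<theta> y \<otimes>\<^sub>K mat 1)"
proof -
  have "flip (\<omega>' ((mat 1 \<otimes>\<^sub>K y) ** flip t)) = flip ((mat 1 \<otimes>\<^sub>K \<theta> y) ** \<omega>' (flip t))"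
    using vertical'(2)[OF assms(1) flip_centralizer[OF assms(2)]] by simp
  then show "\<omega> ((y \<otimes>\<^sub>K mat 1) ** t) = (\<theta> y \<otimes>\<^sub>K mat 1) ** \<omega> t"
    by (simp add: flip_mult \<omega>'_def)
  have "flip (\<omega>' (flip t ** (mat 1 \<otimes>\<^sub>K y))) = flip (\<omega>' (flip t) ** (mat 1 \<otimes>\<^sub>K \<theta> y))"
    using vertical'(3)[OF assms(1) flip_centralizer[OF assms(2)]] by simp
  then show "\<omega> (t ** (y \<otimes>\<^sub>K mat 1)) = \<omega> t ** (\<theta> y \<otimes>\<^sub>K mat 1)"
    by (simp add: flip_mult \<omega>'_def)
qed

text \<open>The site \<open>A.p\<close> times the identity, in third place, decouples the third leg.
  By the vertical bimodule property and the rank one of \<open>\<theta> A.p\<close> its image is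
  \<open>\<theta> A.p\<close> times some unknown \<open>h\<close>. Hence \<open>\<Phi>3\<close>
  sends \<open>leg12 M\<close> to \<open>\<Phi> M\<close> on legs 1 and 2 times \<open>h\<close> on
  leg 3, first for cut columns and then, since these span, for all \<open>M\<close>; the case
  \<open>M = mat 1\<close> gives \<open>h = mat 1\<close>.\<close>

lemma \<Phi>3_leg12: 
  assumes L: "L \<in> A2"
  shows "\<Phi>3 (leg12 L) = leg12 (\<Phi> L)"
proof -
  obtain v' f' where q: "\<theta> A.p = outer v' f'"
    using V.marginal_rank_one[of vA fA] A.p_centralizer A.f_v unfolding A.p_def \<theta>_def by blast
  have p2: "A.p \<otimes>\<^sub>K mat 1 \<in> A2" using kron_one_mem(1) A.p_centralizer by blast
  define W where "W = \<omega> (A.p \<otimes>\<^sub>K mat 1)"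
  have pp: "(A.p \<otimes>\<^sub>K mat 1) ** (A.p \<otimes>\<^sub>K mat 1) = A.p \<otimes>\<^sub>K mat 1" by (simp add: kron_mult A.p_idem)
  have "W = (\<theta> A.p \<otimes>\<^sub>K mat 1) ** W ** (\<theta> A.p \<otimes>\<^sub>K mat 1)"
    unfolding W_def using vertical[OF A.p_centralizer p2] by (simp add: pp)
  then obtain h where h: "W = \<theta> A.p \<otimes>\<^sub>K h"
    using rank_one_sandwich[of v' f' W] unfolding q by auto
  have cut: "M \<in> A2 \<and> \<Phi>3 (leg12 M) = leg12_3 (\<Phi> M) h" if "M \<in> A2" for M
    using that
  proof (induction M rule: A.cut_ring2_span[consumes 1, case_names ring add cscale])
    case (ring s t)
    have ps: "(A.p \<otimes>\<^sub>K mat 1) ** s \<in> A2" using p2 ring(1) by (rule centralizer_mult)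
    have "\<Phi>3 (leg12 (ring2 ((A.p \<otimes>\<^sub>K mat 1) ** s) t)) = \<Phi>3 (ring3 s t (A.p \<otimes>\<^sub>K mat 1))"
      by (simp add: ring3_kron)
    also have "\<dots> = ring3 (\<omega> s) (\<omega> t) (\<theta> A.p \<otimes>\<^sub>K h)"
      using ring_iso(3)[OF ring p2] by (simp add: W_def[symmetric] h)
    also have "\<dots> = leg12_3 (\<Phi> (ring2 ((A.p \<otimes>\<^sub>K mat 1) ** s) t)) h"
      by (simp add: ring3_kron ring_iso(1)[OF ps ring(2)] vertical[OF A.p_centralizer ring(1)])
    finally show ?case using A.ring_centralizer(1)[OF A.rep ps ring(2) ps] by simp
  next
    case (add x y)
    then show ?case
      using alg_isoD(4)[OF \<Phi>_iso, of x y] alg_isoD(4)[OF \<Phi>3_iso leg_centralizer(1) leg_centralizer(1), of x "mat 1" y "mat 1"]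
      by (simp add: centralizer_add leg_add centralizer_one)
  next
    case (cscale c x)
    then show ?case
      using alg_isoD(6)[OF \<Phi>_iso, of x c] alg_isoD(6)[OF \<Phi>3_iso leg_centralizer(1), of x "mat 1" c]
      by (simp add: centralizer_cscale leg_cscale centralizer_one)
  qed
  have "mat 1 \<otimes>\<^sub>K mat 1 \<otimes>\<^sub>K h = \<Phi>3 (leg12 (mat 1))"
    using cut[OF centralizer_one] alg_isoD(3)[OF \<Phi>_iso] by (simp add: leg12_one)
  also have "\<dots> = mat 1" by (simp add: leg12_one kron_one alg_isoD(3)[OF \<Phi>3_iso])
  also have "\<dots> = mat 1 \<otimes>\<^sub>K mat 1 \<otimes>\<^sub>K mat 1" by (simp add: kron_one)
  finally have "h = mat 1" by (blast dest: kron_one_cancel)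
  then show ?thesis using cut[OF L] by simp
qed

text \<open>On columns \<open>\<Phi>3\<close> acts site by site, and rotating a column merely
  permutes its sites.\<close>

lemma \<Phi>3_rotate:
  assumes "x \<in> A3"
  shows "\<Phi>3 (rotate3 x) = rotate3 (\<Phi>3 x)"
proof -
  obtain \<xi> where "x = lincomb (\<lambda>q. ring3 (a (fst q)) (a (fst (snd q))) (a (snd (snd q)))) \<xi>"
    using assms unfolding A.range_ring3[symmetric] by (rule imageE)
  then have x: "x = (\<Sum>q\<in>UNIV. cscale (\<xi> q) (ring3 (a (fst q)) (a (fst (snd q))) (a (snd (snd q)))))"
    by (simp add: lincomb_def)
  have a: "a s \<in> A2" for s using A.range_a lincomb_mem by blast
  have r: "ring3 (a s) (a t) (a r) \<in> A3" for s t r using A.ring_centralizer(2)[OF A.rep a a a] .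
  have "\<Phi>3 (rotate3 x) = (\<Sum>q\<in>UNIV. cscale (\<xi> q) (ring3 (b (snd (snd q))) (b (fst q)) (b (fst (snd q)))))"
    unfolding x rotate3_sum rotate3_linear rotate3_ring3
    by (subst alg_iso_sum[OF \<Phi>3_iso subalgebra_centralizer])
       (simp_all add: centralizer_cscale r alg_isoD(6)[OF \<Phi>3_iso] ring_iso(3) a \<omega>_site)
  also have "\<dots> = rotate3 (\<Phi>3 x)"
    unfolding x
    by (subst alg_iso_sum[OF \<Phi>3_iso subalgebra_centralizer])
       (simp_all add: centralizer_cscale r alg_isoD(6)[OF \<Phi>3_iso] ring_iso(3) a \<omega>_site rotate3_sum rotate3_linear rotate3_ring3)
  finally show ?thesis .
qed

text \<open>Rotation carries legs 1 and 2 to legs 2 and 3, and those to legs 3 and 1; the reversed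
  order is absorbed by \<open>H.iso_flip\<close>.\<close>

lemma \<Phi>3_legs:
  assumes L: "L \<in> A2"
  shows "\<Phi>3 (leg23 L) = leg23 (\<Phi> L)" "\<Phi>3 (leg13 L) = leg13 (\<Phi> L)"
proof -
  have 23: "\<Phi>3 (leg23 M) = leg23 (\<Phi> M)" if "M \<in> A2" for M
    using \<Phi>3_rotate[OF leg_centralizer(1)[OF that centralizer_one]] that by (simp add: \<Phi>3_leg12 rotate3_leg12)
  show "\<Phi>3 (leg23 L) = leg23 (\<Phi> L)" by (rule 23[OF L])
  have f: "flip L \<in> A2" using L by (rule flip_centralizer)
  show "\<Phi>3 (leg13 L) = leg13 (\<Phi> L)"
    using \<Phi>3_rotate[OF leg_centralizer(3)[OF f centralizer_one]] f L by (simp add: 23 rotate3_leg23 H.iso_flip)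
qed

lemma card_eq: "CARD('m) = CARD('n)"
proof -
  have "trace (mat 1 :: complex^('m \<times> 'm)^('m \<times> 'm)) = trace (mat 1 :: complex^('n \<times> 'n)^('n \<times> 'n))"
    using alg_isoD(7)[OF \<Phi>_iso centralizer_one] alg_isoD(3)[OF \<Phi>_iso] by simp
  then have "(of_nat (CARD('m) * CARD('m)) :: complex) = of_nat (CARD('n) * CARD('n))"
    by (simp add: trace_def mat_nth)
  then have "CARD('m) * CARD('m) = CARD('n) * CARD('n)" by (simp only: of_nat_eq_iff)
  then show ?thesis by (metis power2_eq_square power2_eq_iff_nonneg le0)
qed

lemma trace_swap: "trace (swap :: complex^('a::finite \<times> 'a)^('a \<times> 'a)) = of_nat CARD('a)"
  by (simp add: trace_def sum_pair)

text \<open>Let \<open>t\<close> be the preimage of the swap. Conjugation by the exchange of legs 1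
  and 2 moves \<open>t\<close> from legs 1 and 3 to legs 2 and 3; the image of this relation under
  \<open>\<Phi>3\<close> says that \<open>z\<close>, placed on legs 1 and 2, commutes with the
  exchange of legs 2 and 3. So \<open>z\<close> is a scalar. Its square being 1 would leave a sign,
  which the trace excludes.\<close>

lemma \<Phi>_swap: "\<Phi> swap = swap"
proof -
  define \<sigma> where "\<sigma> = \<Phi> swap"
  define z where "z = \<sigma> ** swap"
  note swA = swap_centralizer[of G uA]
  have \<sigma>\<sigma>: "\<sigma> ** \<sigma> = mat 1"
    unfolding \<sigma>_def using alg_isoD(5)[OF \<Phi>_iso swA swA] alg_isoD(3)[OF \<Phi>_iso] by simp
  have \<sigma>_flip: "flip \<sigma> = \<sigma>" unfolding \<sigma>_def using H.iso_flip[OF swA] by simp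
  then have comm: "swap ** \<sigma> ** swap = \<sigma>" by (simp add: flip_conv_swap)
  then have z: "\<sigma> = swap ** z" "\<sigma> = z ** swap" by (simp_all add: z_def matrix_mul_assoc) (simp flip: matrix_mul_assoc)
  have zz: "z ** z = mat 1"
    unfolding z_def using comm \<sigma>\<sigma> by (metis matrix_mul_assoc)
  have zflip: "flip z = z" by (simp add: z_def flip_mult \<sigma>_flip)
  obtain t where t: "t \<in> A2" "\<Phi> t = swap" using alg_isoD(8)[OF \<Phi>_iso swap_centralizer] by blast
  note mem = leg_centralizer(1,2)[OF swA centralizer_one] leg_centralizer(1,2)[OF t(1) centralizer_one]
  have "\<Phi>3 (leg12 swap ** leg13 t ** leg12 swap) = leg12 \<sigma> ** leg13 swap ** leg12 \<sigma>"
    using mem by (simp add: alg_isoD(5)[OF \<Phi>3_iso] centralizer_mult \<Phi>3_leg12 \<Phi>3_legs swA t \<sigma>_def)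
  then have "leg12 \<sigma> ** leg13 swap ** leg12 \<sigma> = leg23 swap"
    using \<Phi>3_legs(1)[OF t(1)] t(2) by (simp add: leg_exchange)
  moreover have "leg12 \<sigma> = leg12 z ** leg12 swap" "leg12 \<sigma> = leg12 swap ** leg12 z"
    by (simp_all add: leg12_mult flip: z)
  ultimately have "leg12 z ** (leg12 swap ** leg13 swap ** leg12 swap) ** leg12 z = leg23 swap"
    by (metis matrix_mul_assoc)
  then have e: "leg12 z ** leg23 swap ** leg12 z = leg23 swap" by (simp add: leg_exchange)
  have zz3: "leg12 z ** leg12 z = mat 1" by (simp add: leg12_mult zz leg12_one kron_one)
  have "leg23 swap ** leg12 z = leg12 z ** leg23 swap"
    using arg_cong[OF e, of "\<lambda>M. leg12 z ** M"] by (simp add: matrix_mul_assoc zz3)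
  then have "leg23 swap ** leg12 z ** leg23 swap = leg12 z ** (leg23 swap ** leg23 swap)"
    by (simp add: matrix_mul_assoc)
  then have "leg13 z = leg12 z" by (simp add: leg_exchange kron_mult kron_one)
  then obtain c where c: "z = cscale c (mat 1)" using leg12_eq_leg13 zflip by metis
  then have \<sigma>: "\<sigma> = cscale c swap" using z(1) by simp
  have "of_nat CARD('m) = trace \<sigma>" unfolding \<sigma>_def alg_isoD(7)[OF \<Phi>_iso swA] trace_swap ..
  also have "\<dots> = c * of_nat CARD('n)" by (simp add: \<sigma> trace_cscale trace_swap)
  finally have "c = 1" by (simp add: card_eq)
  then show ?thesis using \<sigma> by (simp add: \<sigma>_def)
qed

end

section \<open>Group-like intertwiners\<close>

text \<open>\<open>attach v\<close> is the map sending \<open>x\<close> to the tensor product of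
  \<open>v\<close> and \<open>x\<close>; \<open>detach f\<close> below contracts the first factor
  with \<open>f\<close>.\<close>

definition attach :: "complex^'a \<Rightarrow> complex^'c^('a::finite \<times> 'c::finite)" where
  "attach v = (\<chi> i j. if snd i = j then v $ fst i else 0)"

definition detach :: "complex^'a \<Rightarrow> complex^('a::finite \<times> 'c::finite)^'c" where
  "detach f = (\<chi> i j. if i = snd j then f $ fst j else 0)"

lemma attach_nth [simp]: "attach v $ (a, b) $ c = (if b = c then v $ a else 0)"
  by (simp add: attach_def)

lemma detach_nth [simp]: "detach f $ c $ (a, b) = (if c = b then f $ a else 0)"
  by (simp add: detach_def)

lemma kron_attach: "(P \<otimes>\<^sub>K Q) ** attach v = attach (P *v v) ** Q"
  by (simp add: entrywise matrix_vector_mult_def sum_distrib_left sum_distrib_right mult_ac)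

lemma detach_kron: "detach f ** (P \<otimes>\<^sub>K Q) = Q ** detach (f v* P)"
  by (simp add: entrywise vector_matrix_mult_def sum_distrib_left sum_distrib_right mult_ac)

lemma detach_attach: "(\<Sum>i\<in>UNIV. f $ i * v $ i) = 1 \<Longrightarrow> detach f ** attach v = mat 1"
  by (auto simp: entrywise)

lemma attach_mult_detach: "attach v ** x ** detach f = outer v f \<otimes>\<^sub>K x"
  by (simp add: entrywise mult_ac)

lemma cscale_mult_vec: "cscale c M *v a = c *s (M *v a)"
  by (simp add: vec_eq_iff matrix_vector_mult_def sum_distrib_left mult_ac)

lemma outer_linear: "outer (\<Sum>i\<in>I. a i) b = (\<Sum>i\<in>I. outer (a i) b)" "outer (c *s a') b = cscale c (outer a' b)"
  by (simp_all add: vec_eq_iff sum_matrix_nth sum_distrib_left sum_distrib_right mult_ac)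

lemma twirl_linear: "twirl G w u (\<Sum>i\<in>I. M i) = (\<Sum>i\<in>I. twirl G w u (M i))" "twirl G w u (cscale c x) = cscale c (twirl G w u x)"
proof -
  show "twirl G w u (\<Sum>i\<in>I. M i) = (\<Sum>i\<in>I. twirl G w u (M i))"
    unfolding twirl_def sum_mult by (rule sum.swap)
qed (simp add: twirl_def cscale_sum)

lemma vec_as_sum: "(a :: complex^'a) = (\<Sum>c\<in>UNIV. (a $ c) *s axis c 1)"
  by (simp add: vec_eq_iff axis_nth)

section \<open>Extending intertwiners from a direct summand\<close>

context finite_group
begin

lemma sum_group_right:
  assumes "g \<in> carrier G"
  shows "(\<Sum>h\<in>carrier G. F (h \<otimes> g)) = (\<Sum>h\<in>carrier G. F h)"
  by (rule sum.reindex_bij_betw)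
     (use assms in \<open>auto intro!: bij_betwI[where g = "\<lambda>h. h \<otimes> inv g"] simp: m_assoc\<close>)

context
  fixes u :: "'a \<Rightarrow> complex^'n^'n" and K and U :: "'a \<Rightarrow> complex^'i^'i"
    and J :: "complex^'n^'i" and C :: "complex^'i^'n"
    and \<Phi> :: "complex^'i^'i \<Rightarrow> complex^'j^'j"
  assumes u: "representation G u" and U: "representation G U" and K: "separates u K"
    and J: "\<And>g. g \<in> carrier G \<Longrightarrow> U g ** J = J ** u g" and C: "\<And>g. g \<in> carrier G \<Longrightarrow> C ** U g = u g ** C"
    and CJ: "C ** J = mat 1"
begin

text \<open>\<open>J\<close> and \<open>C\<close> exhibit \<open>u\<close> as a direct summand of
  \<open>U\<close>, so an intertwiner from \<open>u\<close> to \<open>U\<close> followed after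
  \<open>C\<close> is an element of the commutant of \<open>U\<close>.\<close>

definition embed where "embed a i = twirl G U u (outer a (axis i 1)) ** C"

lemma embed_mem: "embed a i \<in> centralizer G U"
  unfolding centralizer_def embed_def
proof (intro CollectI ballI)
  fix g assume g: "g \<in> carrier G"
  have "U g ** (twirl G U u (outer a (axis i 1)) ** C) = twirl G U u (outer a (axis i 1)) ** (u g ** C)"
    using twirl_intertwines[OF u U g] by (simp add: matrix_mul_assoc)
  then show "U g ** (twirl G U u (outer a (axis i 1)) ** C) = twirl G U u (outer a (axis i 1)) ** C ** U g"
    using C[OF g] by (simp flip: matrix_mul_assoc)
qed

lemma embed_reproduces: "(\<Sum>i\<in>UNIV. embed a i *v (J *v (K *v axis i 1))) = a"
proof -
  have "embed a i *v (J *v y) = twirl G U u (outer a (axis i 1)) *v y" for i y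
    unfolding embed_def matrix_vector_mul_assoc using CJ by (simp flip: matrix_mul_assoc)
  then show ?thesis using twirl_reproduces[OF U K] by simp
qed

lemma embed_mult: "t \<in> centralizer G U \<Longrightarrow> embed (t *v a) i = t ** embed a i"
  unfolding embed_def by (simp add: matrix_mul_assoc mult_twirl outer_mult_left)

lemma embed_sum: "embed a i = (\<Sum>c\<in>UNIV. cscale (a $ c) (embed (axis c 1) i))"
  unfolding embed_def by (subst vec_as_sum[of a]) (simp add: outer_linear twirl_linear sum_mult)

lemma embed_J: "embed (J *v y) i = J ** twirl G u u (outer y (axis i 1)) ** C"
proof -
  have "twirl G U u (J ** x) = J ** twirl G u u x" for x :: "complex^'n^'n"
    unfolding twirl_def sum_mult by (rule sum.cong) (simp_all add: J matrix_mul_assoc)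
  then show ?thesis unfolding embed_def outer_mult_left[symmetric] by simp
qed

text \<open>By \<open>embed_reproduces\<close> the image of \<open>J\<close> generates the whole
  space over the commutant of \<open>U\<close>, and an intertwiner is determined on
  generators.\<close>

lemma intertwiner_unique:
  assumes "\<And>t. t \<in> centralizer G U \<Longrightarrow> S ** t = \<Phi> t ** S" "\<And>t. t \<in> centralizer G U \<Longrightarrow> S' ** t = \<Phi> t ** S'"
    and "S ** J = S' ** J"
  shows "S = S'"
proof -
  have "S *v a = S' *v a" for a
  proof -
    have *: "T *v a = (\<Sum>i\<in>UNIV. \<Phi> (embed a i) *v ((T ** J) *v (K *v axis i 1)))"
      if T: "\<And>t. t \<in> centralizer G U \<Longrightarrow> T ** t = \<Phi> t ** T" for T :: "complex^'i^'j"
    proof -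
      have "T *v a = (\<Sum>i\<in>UNIV. T *v (embed a i *v (J *v (K *v axis i 1))))"
        by (subst embed_reproduces[of a, symmetric]) (rule matrix_vector_mult_sum_right)
      then show ?thesis using T[OF embed_mem]
        by (simp add: matrix_vector_mul_assoc) (simp add: matrix_mul_assoc)
    qed
    have "S *v a = (\<Sum>i\<in>UNIV. \<Phi> (embed a i) *v ((S ** J) *v (K *v axis i 1)))" by (rule *) (rule assms(1))
    moreover have "S' *v a = (\<Sum>i\<in>UNIV. \<Phi> (embed a i) *v ((S' ** J) *v (K *v axis i 1)))" by (rule *) (rule assms(2))
    ultimately show ?thesis using assms(3) by simp
  qed
  then show ?thesis by (simp add: matrix_eq)
qed

text \<open>Expanding \<open>a\<close> by \<open>embed_reproduces\<close> forces the formula for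
  \<open>S\<close>: move \<open>S\<close> past each \<open>embed a i\<close> and use the prescribed
  value on the image of \<open>J\<close>. The result intertwines because \<open>embed\<close> is
  compatible with left multiplication by the commutant.\<close>

lemma intertwiner_extension:
  assumes \<Phi>: "alg_iso (centralizer G U) F \<Phi>"
    and \<phi>: "\<And>x. x \<in> centralizer G u \<Longrightarrow> \<Phi> (J ** x ** C) = J' ** \<phi> x ** C'" and CJ': "C' ** J' = mat 1"
    and X: "\<And>x. x \<in> centralizer G u \<Longrightarrow> X ** x = \<phi> x ** X"
  obtains S where "\<And>t. t \<in> centralizer G U \<Longrightarrow> S ** t = \<Phi> t ** S" "S ** J = J' ** X"
proof -
  define y where "y i = J' *v (X *v (K *v axis i 1))" for i
  define S where "S = (\<chi> b c. (\<Sum>i\<in>UNIV. \<Phi> (embed (axis c 1) i) *v y i) $ b)"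
  have S: "S *v a = (\<Sum>i\<in>UNIV. \<Phi> (embed a i) *v y i)" for a
  proof -
    have "\<Phi> (embed a i) = (\<Sum>c\<in>UNIV. cscale (a $ c) (\<Phi> (embed (axis c 1) i)))" for i
      by (subst embed_sum, subst alg_iso_sum[OF \<Phi> subalgebra_centralizer])
         (simp_all add: embed_mem centralizer_cscale alg_isoD(6)[OF \<Phi>])
    then have "(\<Sum>i\<in>UNIV. \<Phi> (embed a i) *v y i) = (\<Sum>c\<in>UNIV. a $ c *s (\<Sum>i\<in>UNIV. \<Phi> (embed (axis c 1) i) *v y i))"
      by (simp add: matrix_vector_mult_sum cscale_mult_vec vec.scale_sum_right) (rule sum.swap)
    then show ?thesis
      by (simp add: vec_eq_iff S_def matrix_vector_mult_def mult.commute)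
  qed
  have 1: "S ** t = \<Phi> t ** S" if t: "t \<in> centralizer G U" for t
  proof -
    have "S *v (t *v a) = \<Phi> t *v (S *v a)" for a
      unfolding S embed_mult[OF t] matrix_vector_mult_sum_right
      by (simp add: alg_isoD(5)[OF \<Phi> t embed_mem] matrix_vector_mul_assoc)
    then show ?thesis by (simp add: matrix_eq matrix_vector_mul_assoc)
  qed
  have 2: "S ** J = J' ** X"
  proof -
    have "S *v (J *v a) = J' *v (X *v a)" for a
    proof -
      have "\<Phi> (embed (J *v a) i) *v y i = (J' ** X) *v (twirl G u u (outer a (axis i 1)) *v (K *v axis i 1))" for i
      proof -
        let ?t = "twirl G u u (outer a (axis i 1))"
        have t: "?t \<in> centralizer G u" by (rule twirl_centralizer[OF u])
        have "J' ** \<phi> ?t ** C' ** J' ** X = J' ** \<phi> ?t ** (C' ** J') ** X" by (simp only: matrix_mul_assoc)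
        also have "\<dots> = J' ** (X ** ?t)" using CJ' X[OF t] by (simp flip: matrix_mul_assoc)
        finally show ?thesis
          unfolding embed_J \<phi>[OF t] y_def by (simp add: matrix_vector_mul_assoc matrix_mul_assoc)
      qed
      then have "S *v (J *v a) = (J' ** X) *v (\<Sum>i\<in>UNIV. twirl G u u (outer a (axis i 1)) *v (K *v axis i 1))"
        unfolding S by (simp add: matrix_vector_mult_sum_right)
      then show ?thesis unfolding twirl_reproduces[OF u K] by (simp only: matrix_vector_mul_assoc)
    qed
    then show ?thesis by (simp add: matrix_eq matrix_vector_mul_assoc)
  qed
  show ?thesis using that 1 2 by blast
qed

end

end

section \<open>Common eigenvectors of commuting complex-linear maps\<close>

lemma scaleR_conv_cscale: "r *\<^sub>R M = cscale (of_real r) M"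
  unfolding vec_eq_iff cscale_nth vector_scaleR_component by (simp add: scaleR_conv_of_real[where 'a = complex])

lemma csubspace_imp_subspace: "csubspace W \<Longrightarrow> subspace W"
  by (auto simp: csubspace_def subspace_def scaleR_conv_cscale)

definition clinear_on :: "(complex^'a^'b) set \<Rightarrow> (complex^'a^'b \<Rightarrow> complex^'c^'d) \<Rightarrow> bool" where
  "clinear_on W R \<longleftrightarrow> (\<forall>x\<in>W. \<forall>y\<in>W. R (x + y) = R x + R y) \<and> (\<forall>c. \<forall>x\<in>W. R (cscale c x) = cscale c (R x))"

lemma clinear_on_sum:
  assumes "clinear_on W R" "csubspace W" "finite S" "\<And>s. s \<in> S \<Longrightarrow> M s \<in> W"
  shows "R (\<Sum>s\<in>S. M s) = (\<Sum>s\<in>S. R (M s))"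
  using assms(3,4)
proof (induction S rule: finite_induct)
  case empty
  have "R (cscale 0 0) = cscale 0 (R 0)" using assms(1,2) unfolding clinear_on_def csubspace_def by blast
  then show ?case by simp
next
  case (insert a S)
  have "sum M S \<in> W" using csubspace_sum[OF assms(2)] insert by blast
  then show ?case using insert assms(1) by (simp add: clinear_on_def)
qed

text \<open>Split off a root \<open>l\<close> of \<open>q\<close>: either \<open>v\<close> is an
  eigenvector for \<open>l\<close>, or \<open>R v - cscale l v\<close> is a nonzero vector
  annihilated by the quotient, which has smaller degree.\<close>

lemma eigenvector_of_annihilator:
  fixes R :: "complex^'a^'b \<Rightarrow> complex^'a^'b"
  assumes W: "csubspace W" and R: "clinear_on W R" and inv: "\<And>x. x \<in> W \<Longrightarrow> R x \<in> W"
  shows "q \<noteq> 0 \<Longrightarrow> degree q < n \<Longrightarrow> v \<in> W \<Longrightarrow> v \<noteq> 0 \<Longrightarrow> (\<Sum>k<n. cscale (coeff q k) ((R ^^ k) v)) = 0 \<Longrightarrow>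
    \<exists>x\<in>W. x \<noteq> 0 \<and> (\<exists>c. R x = cscale c x)"
proof (induction n arbitrary: q v)
  case 0
  then show ?case by simp
next
  case (Suc n)
  have Rk: "(R ^^ k) x \<in> W" if "x \<in> W" for k x using that by (induction k) (auto intro: inv)
  show ?case
  proof (cases "degree q = 0")
    case True
    then have "coeff q k = 0" if "k \<noteq> 0" for k using that True coeff_eq_0[of q k] by simp
    then have "(\<Sum>k<Suc n. cscale (coeff q k) ((R ^^ k) v)) = (\<Sum>k<Suc n. if k = 0 then cscale (coeff q 0) v else 0)"
      by (intro sum.cong) auto
    then have "cscale (coeff q 0) v = 0" using Suc.prems by (simp split: if_splits)
    moreover have "coeff q 0 \<noteq> 0" using Suc.prems(1) True by (metis leading_coeff_0_iff)
    ultimately show ?thesis using Suc.prems(4) by (simp add: vec_eq_iff)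
  next
    case False
    then have "\<not> constant (poly q)" by (simp add: constant_degree)
    then obtain l where "poly q l = 0" using fundamental_theorem_of_algebra by blast
    then obtain r where q: "q = [:-l, 1:] * r" by (metis poly_eq_0_iff_dvd dvd_def)
    then have r: "r \<noteq> 0" using Suc.prems(1) by auto
    have "degree q = degree [:-l, 1:] + degree r" unfolding q by (rule degree_mult_eq) (use r in auto)
    then have deg: "degree r < n" using Suc.prems(2) by simp
    define v' where "v' = R v - cscale l v"
    have v'W: "v' \<in> W" unfolding v'_def using W Suc.prems(3) inv by (intro csubspace_diff) (auto simp: csubspace_def)
    show ?thesis
    proof (cases "v' = 0")
      case True
      then have "R v = cscale l v" by (simp add: v'_def)
      then show ?thesis using Suc.prems by blast
    next
      case False
      have diff: "R (x - y) = R x - R y" if "x \<in> W" "y \<in> W" for x y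
      proof -
        have e: "x - y = x + cscale (-1) y" "R x - R y = R x + cscale (-1) (R y)" by (simp_all add: vec_eq_iff)
        have "cscale (-1) y \<in> W" using that W unfolding csubspace_def by blast
        then show ?thesis unfolding e using that R by (simp add: clinear_on_def)
      qed
      have Rv': "(R ^^ k) v' = (R ^^ Suc k) v - cscale l ((R ^^ k) v)" for k
      proof (induction k)
        case (Suc k)
        have "cscale l ((R ^^ k) v) \<in> W" using W Rk Suc.prems \<open>v \<in> W\<close> by (simp add: csubspace_def)
        then show ?case using Suc diff[OF Rk[OF \<open>v \<in> W\<close>, of "Suc k"]] R Rk[OF \<open>v \<in> W\<close>, of k] by (simp add: clinear_on_def)
      qed (simp add: v'_def)
      let ?r = "\<lambda>k. cscale (coeff r k) ((R ^^ Suc k) v)"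
      let ?s = "\<lambda>k. cscale (l * coeff r k) ((R ^^ k) v)"
      have c: "coeff q k = (case k of 0 \<Rightarrow> 0 | Suc j \<Rightarrow> coeff r j) - l * coeff r k" for k
        by (simp add: q coeff_pCons split: nat.split)
      have "0 = (\<Sum>k<Suc n. cscale (coeff q k) ((R ^^ k) v))" using Suc.prems by simp
      also have "\<dots> = (\<Sum>k<Suc n. cscale (case k of 0 \<Rightarrow> 0 | Suc j \<Rightarrow> coeff r j) ((R ^^ k) v)) - (\<Sum>k<Suc n. ?s k)"
        unfolding c by (simp only: sum_subtractf[symmetric]) (intro sum.cong refl, simp add: vec_eq_iff algebra_simps)
      also have "(\<Sum>k<Suc n. cscale (case k of 0 \<Rightarrow> 0 | Suc j \<Rightarrow> coeff r j) ((R ^^ k) v)) = (\<Sum>k<n. ?r k)"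
        by (subst sum.lessThan_Suc_shift) simp
      also have "(\<Sum>k<Suc n. ?s k) = (\<Sum>k<n. ?s k)" using deg by (simp add: coeff_eq_0)
      also have "(\<Sum>k<n. ?r k) - (\<Sum>k<n. ?s k) = (\<Sum>k<n. cscale (coeff r k) ((R ^^ k) v'))"
        unfolding Rv' sum_subtractf[symmetric] by (intro sum.cong refl) (simp add: cscale_add mult.commute)
      finally show ?thesis using Suc.IH[OF r deg v'W False] by simp
    qed
  qed
qed

lemma eigenvector_exists:
  fixes R :: "complex^'a^'b \<Rightarrow> complex^'a^'b"
  assumes W: "csubspace W" and R: "clinear_on W R" and inv: "\<And>x. x \<in> W \<Longrightarrow> R x \<in> W" and v: "v \<in> W" "v \<noteq> 0"
  shows "\<exists>x\<in>W. x \<noteq> 0 \<and> (\<exists>c. R x = cscale c x)"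
proof -
  \<comment> \<open>The real dimension is a sufficient bound: a real linear relation among the
    \<open>N + 1\<close> iterates is in particular a complex one.\<close>
  define N where "N = DIM(complex^'a^'b)"
  have "\<exists>q::complex poly. q \<noteq> 0 \<and> degree q \<le> N \<and> (\<Sum>k\<le>N. cscale (coeff q k) ((R ^^ k) v)) = 0"
  \<comment> \<open>Linear dependence speaks about sets, so coinciding iterates are treated
    separately, by a difference of two monomials.\<close>
  proof (cases "inj_on (\<lambda>k. (R ^^ k) v) {..N}")
    case False
    then obtain i j where ij: "i \<le> N" "j \<le> N" "i \<noteq> j" "(R ^^ i) v = (R ^^ j) v" by (auto simp: inj_on_def)
    let ?q = "monom 1 i - monom 1 j :: complex poly"
    have "coeff ?q i \<noteq> 0" using ij by simp
    then have "?q \<noteq> 0" by (metis coeff_0)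
    moreover have "degree ?q \<le> N" by (rule degree_diff_le) (use ij in \<open>auto intro: order.trans[OF degree_monom_le]\<close>)
    moreover have "(\<Sum>k\<le>N. cscale (coeff ?q k) ((R ^^ k) v)) = (\<Sum>k\<le>N. (if k = i then (R ^^ k) v else 0) - (if k = j then (R ^^ k) v else 0))"
      by (intro sum.cong) (auto simp: vec_eq_iff)
    then have "(\<Sum>k\<le>N. cscale (coeff ?q k) ((R ^^ k) v)) = 0" using ij by (simp add: sum_subtractf)
    ultimately show ?thesis by blast
  next
    case True
    let ?S = "(\<lambda>k. (R ^^ k) v) ` {..N}"
    have "card ?S > N" using True by (simp add: card_image)
    then have "dependent ?S" unfolding N_def by (intro dependent_biggerset) simp
    then obtain u w where u: "w \<in> ?S" "u w \<noteq> 0" "(\<Sum>x\<in>?S. u x *\<^sub>R x) = 0"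
      using dependent_finite[of ?S] by auto
    define q where "q = Poly (map (\<lambda>k. complex_of_real (u ((R ^^ k) v))) [0..<Suc N])"
    have cq: "coeff q k = (if k \<le> N then of_real (u ((R ^^ k) v)) else 0)" for k
      unfolding q_def by (auto simp: coeff_Poly_eq nth_default_def simp del: upt_Suc)
    obtain k where "k \<le> N" "w = (R ^^ k) v" using u(1) by auto
    then have "coeff q k \<noteq> 0" using u(2) by (simp add: cq)
    then have "q \<noteq> 0" by auto
    moreover have "degree q \<le> N" by (rule degree_le) (simp add: cq)
    moreover have "(\<Sum>k\<le>N. cscale (coeff q k) ((R ^^ k) v)) = (\<Sum>x\<in>?S. u x *\<^sub>R x)"
      unfolding sum.reindex[OF True] o_def scaleR_conv_cscale by (rule sum.cong) (simp_all add: cq)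
    ultimately show ?thesis using u(3) by (intro exI[of _ q]) simp
  qed
  then obtain q :: "complex poly" where "q \<noteq> 0" "degree q < Suc N" "(\<Sum>k<Suc N. cscale (coeff q k) ((R ^^ k) v)) = 0"
    by (auto simp: lessThan_Suc_atMost)
  from eigenvector_of_annihilator[OF W R inv this(1,2) v this(3)] show ?thesis by blast
qed

text \<open>In a nonzero invariant subspace of least dimension, an eigenspace of one map is
  invariant under all others by commutativity, hence is everything. The index set of the family may
  be arbitrary.\<close>

lemma common_eigenvector:
  fixes R :: "'s \<Rightarrow> complex^'a^'b \<Rightarrow> complex^'a^'b"
  assumes N: "csubspace N" and ne: "x0 \<in> N" "x0 \<noteq> 0"
    and lin: "\<And>s. clinear_on N (R s)" and inv: "\<And>s x. x \<in> N \<Longrightarrow> R s x \<in> N"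
    and comm: "\<And>s t x. x \<in> N \<Longrightarrow> R s (R t x) = R t (R s x)"
  obtains x c where "x \<in> N" "x \<noteq> 0" "\<And>s. R s x = cscale (c s) x"
proof -
  define Q where "Q W \<longleftrightarrow> csubspace W \<and> W \<subseteq> N \<and> W \<noteq> {0} \<and> (\<forall>s. \<forall>x\<in>W. R s x \<in> W)" for W
  have "Q N" using assms by (auto simp: Q_def)
  then obtain W where W: "Q W" and min: "\<And>W'. Q W' \<Longrightarrow> dim W \<le> dim W'"
    using ex_has_least_nat[of Q N dim] by blast
  have csW: "csubspace W" and WN: "W \<subseteq> N" and Winv: "\<And>s x. x \<in> W \<Longrightarrow> R s x \<in> W" using W by (auto simp: Q_def)
  obtain w where w: "w \<in> W" "w \<noteq> 0" using W by (auto simp: Q_def csubspace_def)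
  have linW: "clinear_on W (R s)" for s using lin[of s] WN unfolding clinear_on_def by blast
  have eig: "\<exists>c. \<forall>x\<in>W. R s x = cscale c x" for s
  proof -
    obtain y c where y: "y \<in> W" "y \<noteq> 0" "R s y = cscale c y"
      using eigenvector_exists[OF csW linW Winv w, of s] by blast
    define W' where "W' = {x \<in> W. R s x = cscale c x}"
    have cs': "csubspace W'"
    proof -
      have "R s 0 = 0" using clinear_on_sum[OF linW csW, of "{}"] by simp
      then show ?thesis
        using csW linW[of s] by (auto simp: W'_def csubspace_def clinear_on_def cscale_add mult.commute)
    qed
    have "Q W'"
      unfolding Q_def
    proof (intro conjI allI ballI)
      show "W' \<noteq> {0}" using y by (auto simp: W'_def)
      show "W' \<subseteq> N" using WN by (auto simp: W'_def)
      fix t x assume x: "x \<in> W'"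
      then have "R s (R t x) = R t (cscale c x)" using comm[of x s t] WN by (auto simp: W'_def)
      also have "\<dots> = cscale c (R t x)" using linW[of t] x by (auto simp: clinear_on_def W'_def)
      finally show "R t x \<in> W'" using x Winv by (auto simp: W'_def)
    qed (rule cs')
    then have "dim W \<le> dim W'" by (rule min)
    then have "W' = W"
      by (intro subspace_dim_equal csubspace_imp_subspace cs' csW) (auto simp: W'_def)
    then show ?thesis by (auto simp: W'_def)
  qed
  then obtain c where "\<And>s x. x \<in> W \<Longrightarrow> R s x = cscale (c s) x" by metis
  then show ?thesis using that[of w c] w WN by blast
qed

section \<open>Blocks of a matrix, product vectors and injective matrices\<close>

definition block :: "'b \<Rightarrow> 'a \<Rightarrow> complex^('a::finite \<times> 'c::finite)^('b::finite \<times> 'd::finite) \<Rightarrow> complex^'c^'d" where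
  "block k i S = (\<chi> b a. S $ (k, b) $ (i, a))"

lemma block_nth [simp]: "block k i S $ b $ a = S $ (k, b) $ (i, a)"
  by (simp add: block_def)

lemma block_mult: "block k i (S ** (mat 1 \<otimes>\<^sub>K x)) = block k i S ** x" "block k i ((mat 1 \<otimes>\<^sub>K y) ** T) = y ** block k i T"
  by (simp_all add: entrywise)

lemma block_linear: "block k i (S + T) = block k i S + block k i T" "block k i (cscale c S) = cscale c (block k i S)"
  by (simp_all add: vec_eq_iff)

definition kron_vec :: "complex^'a \<Rightarrow> complex^'b \<Rightarrow> complex^('a::finite \<times> 'b::finite)" where
  "kron_vec a b = (\<chi> i. a $ fst i * b $ snd i)"

lemma kron_vec_nth [simp]: "kron_vec a b $ (i, j) = a $ i * b $ j"
  by (simp add: kron_vec_def)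

lemma kron_mult_kron_vec: "(P \<otimes>\<^sub>K Q) *v kron_vec a b = kron_vec (P *v a) (Q *v b)"
  by (simp add: vec_eq_iff matrix_vector_mult_def sum_pair sum_product mult_ac)

text \<open>A bijection of the index types makes the matrix square, where a left inverse is also a
  right inverse.\<close>

lemma invertible_if_injective:
  fixes M :: "complex^'a^'b"
  assumes card: "CARD('a) = CARD('b)" and inj: "\<And>x. M *v x = 0 \<Longrightarrow> x = 0"
  shows "invertible M"
proof -
  obtain \<pi> :: "'b \<Rightarrow> 'a" where \<pi>: "bij \<pi>"
    using card finite_same_card_bij[of "UNIV :: 'b set" "UNIV :: 'a set"] by auto
  define P :: "complex^'b^'a" where "P = (\<chi> i j. if i = \<pi> j then 1 else 0)"
  define Pt :: "complex^'a^'b" where "Pt = (\<chi> i j. if \<pi> i = j then 1 else 0)"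
  have PtP: "Pt ** P = mat 1"
    using \<pi> by (auto simp: vec_eq_iff mult_nth P_def Pt_def mat_nth bij_def inj_eq)
  have PPt: "P ** Pt = mat 1"
  proof -
    have "(P ** Pt) $ i $ j = mat 1 $ i $ j" for i j
    proof -
      obtain k where "i = \<pi> k" using \<pi> by (metis bij_pointE)
      then have "P $ i $ l * Pt $ l $ j = (if l = k then if \<pi> k = j then 1 else 0 else 0)" for l
        by (auto simp: P_def Pt_def inj_eq[OF bij_is_inj[OF \<pi>]])
      then show ?thesis using \<open>i = \<pi> k\<close> by (simp add: mult_nth mat_nth)
    qed
    then show ?thesis by (simp add: vec_eq_iff)
  qed
  have "inj ((*v) M)"
  proof (rule injI)
    fix x y assume "M *v x = M *v y"
    then have "M *v (x - y) = 0" by (simp add: matrix_vector_mult_diff_distrib)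
    then show "x = y" using inj by fastforce
  qed
  then obtain N where N: "N ** M = mat 1" using matrix_left_invertible_injective by metis
  have "(Pt ** N) ** (M ** P) = Pt ** (N ** M) ** P" by (simp only: matrix_mul_assoc)
  also have "\<dots> = mat 1" using N PtP by simp
  finally have "(M ** P) ** (Pt ** N) = mat 1" using matrix_left_right_inverse by metis
  then have "M ** (P ** Pt) ** N = mat 1" by (simp only: matrix_mul_assoc)
  then have "M ** N = mat 1" using PPt by simp
  then show ?thesis using N invertible_def by blast
qed

section \<open>Spaces of intertwiners on one, two and three legs\<close>

context torus_equal
begin

definition "pB = (SOME q. \<phi> A.p = outer (fst q) (snd q) \<and> (\<Sum>i\<in>UNIV. snd q $ i * fst q $ i) = 1)"
abbreviation "v1 \<equiv> fst pB"
abbreviation "f1 \<equiv> snd pB"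

lemma v1_f1: "\<phi> A.p = outer v1 f1" "(\<Sum>i\<in>UNIV. f1 $ i * v1 $ i) = 1"
proof -
  obtain v' f' where "\<phi> A.p = outer v' f'" "(\<Sum>i\<in>UNIV. f' $ i * v' $ i) = 1"
    using H.marginal_rank_one[of vA fA] A.p_centralizer A.f_v unfolding A.p_def \<phi>_def by blast
  then have "\<exists>q. \<phi> A.p = outer (fst q) (snd q) \<and> (\<Sum>i\<in>UNIV. snd q $ i * fst q $ i) = 1" by auto
  from someI_ex[OF this] show "\<phi> A.p = outer v1 f1" "(\<Sum>i\<in>UNIV. f1 $ i * v1 $ i) = 1"
    unfolding pB_def by auto
qed

text \<open>\<open>N1\<close> is the space underlying the coalgebra; \<open>N2\<close> and
  \<open>N3\<close> receive its comultiplication and the twice iterated one.\<close>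

definition "N1 = {X. \<forall>x\<in>A1. X ** x = \<phi> x ** X}"
definition "N2 = {S. \<forall>t\<in>A2. S ** t = \<Phi> t ** S}"
definition "N3 = {S. \<forall>t\<in>A3. S ** t = \<Phi>3 t ** S}"

lemma attach_A: 
  assumes "g \<in> carrier G"
  shows "(uA g \<otimes>\<^sub>K P) ** attach vA = attach vA ** P" "detach fA ** (uA g \<otimes>\<^sub>K P) = P ** detach fA"
  by (simp_all add: kron_attach detach_kron A.v_invariant A.f_invariant assms)

text \<open>The group fixes \<open>A.p\<close> and \<open>A.p\<close> has trace 1, so the first
  factor is invisible and \<open>KA\<close> does the separating. This provides the \<open>K\<close>
  for extending from two legs to three.\<close>

lemma separates2: "A.separates (tensor2 uA) (A.p \<otimes>\<^sub>K KA)"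
proof -
  have "uA g ** A.p = A.p" if "g \<in> carrier G" for g
    by (simp add: A.p_def outer_mult_left A.v_invariant that)
  moreover have "trace A.p = 1" using A.f_v by (simp add: A.p_def trace_def mult.commute)
  ultimately show ?thesis using A.sep by (simp add: A.separates_def kron_mult trace_kron)
qed

lemma \<Phi>_attach: "x \<in> A1 \<Longrightarrow> \<Phi> (attach vA ** x ** detach fA) = attach v1 ** \<phi> x ** detach f1"
  using H.iso_kron[OF A.p_centralizer, folded \<phi>_def] v1_f1(1) by (simp add: attach_mult_detach A.p_def)

lemma \<Phi>3_attach: "x \<in> A2 \<Longrightarrow> \<Phi>3 (attach vA ** x ** detach fA) = attach v1 ** \<Phi> x ** detach f1"
proof -
  assume x: "x \<in> A2"
  have p1: "A.p \<otimes>\<^sub>K mat 1 \<in> A2" by (rule kron_one_mem[OF A.p_centralizer])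
  have split: "P \<otimes>\<^sub>K t = leg12 (P \<otimes>\<^sub>K mat 1) ** leg23 t" for P :: "complex^'c::finite^'c" and t
    by (simp add: kron_mult kron_one)
  have "\<Phi>3 (A.p \<otimes>\<^sub>K x) = leg12 (\<Phi> (A.p \<otimes>\<^sub>K mat 1)) ** leg23 (\<Phi> x)"
    unfolding split[of A.p]
    using alg_isoD(5)[OF \<Phi>3_iso leg_centralizer(1)[OF p1 centralizer_one] leg_centralizer(3)[OF x centralizer_one]]
    by (simp add: \<Phi>3_leg12 \<Phi>3_legs p1 x del: leg_kron)
  also have "\<Phi> (A.p \<otimes>\<^sub>K mat 1) = \<phi> A.p \<otimes>\<^sub>K mat 1" using H.bimodule(1)[OF A.p_centralizer] by (simp add: \<phi>_def)
  finally show ?thesis unfolding split[symmetric] by (simp add: attach_mult_detach v1_f1 flip: A.p_def)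
qed

text \<open>Here \<open>V\<close> sits in its tensor square along the invariant vector. On the other
  side \<open>v1\<close> takes the place of \<open>vA\<close>, because \<open>\<phi>\<close> sends
  \<open>A.p\<close> to the projection built from \<open>v1\<close> and \<open>f1\<close>.\<close>

lemma extend1:
  assumes "X \<in> N1" obtains S where "S \<in> N2" "S ** attach vA = attach v1 ** X"
  using A.intertwiner_extension[OF A.rep A.rep2 A.sep attach_A detach_attach[OF A.f_v] \<Phi>_iso \<Phi>_attach detach_attach[OF v1_f1(2)], of X]
    assms unfolding N1_def N2_def by (smt (verit) mem_Collect_eq)

lemma extend2:
  assumes "X \<in> N2" obtains S where "S \<in> N3" "S ** attach vA = attach v1 ** X"
  using A.intertwiner_extension[OF A.rep2 A.rep3 separates2 attach_A detach_attach[OF A.f_v] \<Phi>3_iso \<Phi>3_attach detach_attach[OF v1_f1(2)], of X]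
    assms unfolding N2_def N3_def by (smt (verit) mem_Collect_eq)

lemma unique2: "S \<in> N2 \<Longrightarrow> T \<in> N2 \<Longrightarrow> S ** attach vA = T ** attach vA \<Longrightarrow> S = T"
  using A.intertwiner_unique[OF A.rep A.rep2 A.sep attach_A detach_attach[OF A.f_v], where \<Phi> = \<Phi> and S = S and S' = T]
  unfolding N2_def by simp

lemma csubspace_N: "csubspace N1" "csubspace N2"
  unfolding csubspace_def N1_def N2_def by (auto simp: matrix_add_ldistrib matrix_add_rdistrib)

text \<open>For fixed \<open>j\<close> and \<open>k\<close>, column \<open>k\<close> of the images
  under \<open>\<phi>\<close> of the twirled matrix units \<open>(c, j)\<close>, with
  \<open>c\<close> varying, forms an intertwiner \<open>X\<close>. If all of these vanished,
  injectivity of \<open>\<phi>\<close> would make every twirl vanish, in particular that of the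
  identity.\<close>

lemma N1_nonzero: "\<exists>X\<in>N1. X \<noteq> 0"
proof (rule ccontr)
  assume none: "\<not> (\<exists>X\<in>N1. X \<noteq> 0)"
  let ?tw = "twirl G uA uA"
  have tw: "?tw x \<in> A1" for x by (rule A.twirl_centralizer[OF A.rep])
  have \<phi>l: "\<phi> (x + y) = \<phi> x + \<phi> y" "\<phi> (cscale c x) = cscale c (\<phi> x)" "\<phi> (x ** y) = \<phi> x ** \<phi> y"
    if "x \<in> A1" "y \<in> A1" for x y c using H.marginal_linear[OF that] by (auto simp: \<phi>_def)
  have cl: "clinear_on A1 \<phi>" using \<phi>l centralizer_one by (auto simp: clinear_on_def)
  have csA: "csubspace A1" using subalgebra_centralizer by (auto simp: subalgebra_def)
  have "\<phi> (?tw (outer (axis c 1) (axis j 1))) $ r $ k = 0" for c j r k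
  proof -
    define X :: "complex^'m^'n" where "X = (\<chi> r c. \<phi> (?tw (outer (axis c 1) (axis j 1))) $ r $ k)"
    have Xv: "X *v a = \<phi> (?tw (outer a (axis j 1))) *v axis k 1" for a
    proof -
      have "?tw (outer a (axis j 1)) = (\<Sum>c\<in>UNIV. cscale (a $ c) (?tw (outer (axis c 1) (axis j 1))))"
        by (subst vec_as_sum[of a]) (simp add: outer_linear twirl_linear)
      then have "\<phi> (?tw (outer a (axis j 1))) = (\<Sum>c\<in>UNIV. cscale (a $ c) (\<phi> (?tw (outer (axis c 1) (axis j 1)))))"
        using clinear_on_sum[OF cl csA, of UNIV "\<lambda>c. cscale (a $ c) (?tw (outer (axis c 1) (axis j 1)))"]
        by (simp add: centralizer_cscale tw \<phi>l(2)[OF tw tw])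
      then show ?thesis
        by (simp add: vec_eq_iff X_def matrix_vector_mult_def sum_matrix_nth axis_nth mult.commute)
    qed
    have "X ** x = \<phi> x ** X" if "x \<in> A1" for x
    proof -
      have "X *v (x *v a) = \<phi> x *v (X *v a)" for a
        unfolding Xv outer_mult_left[symmetric] A.mult_twirl[OF that, symmetric] \<phi>l(3)[OF that tw]
        by (simp add: matrix_vector_mul_assoc)
      then show ?thesis by (simp add: matrix_eq matrix_vector_mul_assoc)
    qed
    then have "X = 0" using none by (auto simp: N1_def)
    then have "X $ r $ c = 0" by simp
    then show ?thesis by (simp add: X_def)
  qed
  then have "\<phi> (?tw (outer (axis c 1) (axis j 1))) = 0" for c j by (simp add: vec_eq_iff)
  then have 0: "?tw (outer (axis c 1) (axis j 1)) = 0" for c j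
    using H.marginal_inj[OF tw] by (simp add: \<phi>_def)
  have "?tw (mat 1) = 0"
    by (subst matrix_decompose[symmetric]) (simp add: twirl_linear 0)
  then have "cscale (of_nat (card (carrier G))) (mat 1 :: complex^'m^'m) = 0"
    using A.twirl_of_centralizer[OF A.rep centralizer_one] by simp
  then show False using A.card_carrier_pos by (auto simp: vec_eq_iff mat_nth dest!: spec[of _ undefined])
qed

end

section \<open>The comultiplication and a group-like element\<close>

context torus_equal
begin

lemma N2_block: "S \<in> N2 \<Longrightarrow> block k i S \<in> N1"
  unfolding N1_def N2_def
proof (intro CollectI ballI)
  fix x assume S: "S \<in> {S. \<forall>t\<in>A2. S ** t = \<Phi> t ** S}" and x: "x \<in> A1"
  then have "S ** (mat 1 \<otimes>\<^sub>K x) = (mat 1 \<otimes>\<^sub>K \<phi> x) ** S"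
    using kron_one_mem(2)[OF x] H.iso_kron_one[OF x] by (simp add: \<phi>_def)
  then show "block k i S ** x = \<phi> x ** block k i S" unfolding block_mult[symmetric] by simp
qed

lemma N3_block: "S \<in> N3 \<Longrightarrow> block k i S \<in> N2"
  unfolding N2_def N3_def
proof (intro CollectI ballI)
  fix t assume S: "S \<in> {S. \<forall>t\<in>A3. S ** t = \<Phi>3 t ** S}" and t: "t \<in> A2"
  then have "S ** leg23 t = leg23 (\<Phi> t) ** S"
    using leg_centralizer(3)[OF t centralizer_one] \<Phi>3_legs(1)[OF t] by simp
  then show "block k i S ** t = \<Phi> t ** block k i S" unfolding block_mult[symmetric] by simp
qed

text \<open>Invariance of the swap makes elements of \<open>N3\<close> symmetric in their first two
  legs; this is the source of cocommutativity.\<close>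

lemma N3_exchange:
  assumes "S \<in> N3"
  shows "S $ (k, l, y) $ (i, j, c) = S $ (l, k, y) $ (j, i, c)"
proof -
  have "leg12 swap \<in> A3" by (rule leg_centralizer(1)[OF swap_centralizer centralizer_one])
  then have "S ** leg12 swap = \<Phi>3 (leg12 swap) ** S" using assms unfolding N3_def by blast
  also have "\<Phi>3 (leg12 swap) = leg12 swap" by (simp only: \<Phi>3_leg12[OF swap_centralizer] \<Phi>_swap)
  finally have "S ** leg12 swap = leg12 swap ** S" .
  then have "(S ** leg12 swap) $ (k, l, y) $ (j, i, c) = (leg12 swap ** S) $ (k, l, y) $ (j, i, c)" by simp
  then show ?thesis by (simp add: entrywise)
qed

text \<open>The comultiplication of \<open>N1\<close>; by \<open>unique2\<close> the choice is
  unambiguous.\<close>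

definition "extension X = (SOME S. S \<in> N2 \<and> S ** attach vA = attach v1 ** X)"

lemma extension:
  assumes "X \<in> N1"
  shows "extension X \<in> N2" "extension X ** attach vA = attach v1 ** X"
proof -
  have "\<exists>S. S \<in> N2 \<and> S ** attach vA = attach v1 ** X" using extend1[OF assms] by metis
  from someI_ex[OF this] show "extension X \<in> N2" "extension X ** attach vA = attach v1 ** X"
    unfolding extension_def by auto
qed

lemma extension_unique: "X \<in> N1 \<Longrightarrow> S \<in> N2 \<Longrightarrow> S ** attach vA = attach v1 ** X \<Longrightarrow> extension X = S"
  using extension[of X] unique2[of "extension X" S] by simp

lemma clinear_extension: "clinear_on N1 extension"
  unfolding clinear_on_def
proof (intro conjI ballI allI)
  fix X Y assume X: "X \<in> N1" and Y: "Y \<in> N1"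
  show "extension (X + Y) = extension X + extension Y"
    using csubspace_N X Y extension[OF X] extension[OF Y]
    by (intro extension_unique) (auto simp: csubspace_def matrix_add_ldistrib matrix_add_rdistrib)
next
  fix c X assume X: "X \<in> N1"
  show "extension (cscale c X) = cscale c (extension X)"
    using csubspace_N X extension[OF X]
    by (intro extension_unique) (auto simp: csubspace_def)
qed

text \<open>The comultiplication paired on its first leg with the matrix entry \<open>q\<close>,
  that is, the action of the dual algebra on \<open>N1\<close>.\<close>

definition "contract q X = block (fst q) (snd q) (extension X)"

text \<open>Coassociativity. The vector is attached to the first leg of \<open>S\<close>, which is
  also the leg that \<open>block\<close> removes; the exchange of the first two legs separates the
  two operations.\<close>

lemma extension_twice:
  assumes X: "X \<in> N1" and S: "S \<in> N3" "S ** attach vA = attach v1 ** extension X"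
  shows "block k i S = extension (contract (k, i) X)"
proof (rule extension_unique[symmetric])
  show "block k i S \<in> N2" by (rule N3_block[OF S(1)])
  show "contract (k, i) X \<in> N1" unfolding contract_def by (rule N2_block[OF extension(1)[OF X]])
  have "(block k i S ** attach vA) $ (b1, b2) $ j = (attach v1 ** contract (k, i) X) $ (b1, b2) $ j" for b1 b2 j
  proof -
    have "(block k i S ** attach vA) $ (b1, b2) $ j = (\<Sum>c\<in>UNIV. S $ (k, b1, b2) $ (i, c, j) * vA $ c)"
      by (simp add: mult_nth sum_pair)
    also have "\<dots> = (\<Sum>c\<in>UNIV. S $ (b1, k, b2) $ (c, i, j) * vA $ c)"
      using N3_exchange[OF S(1)] by simp
    also have "\<dots> = (S ** attach vA) $ (b1, k, b2) $ (i, j)" by (simp add: mult_nth sum_pair)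
    also have "\<dots> = (attach v1 ** contract (k, i) X) $ (b1, b2) $ j"
      unfolding S(2) by (simp add: mult_nth contract_def)
    finally show ?thesis .
  qed
  then show "block k i S ** attach vA = attach v1 ** contract (k, i) X" by (simp add: vec_eq_iff)
qed

text \<open>A common eigenvector of the contractions is group-like: its extension to two legs is a product.\<close>

lemma grouplike:
  obtains \<Lambda> :: "complex^'m^'n" where "\<Lambda> \<otimes>\<^sub>K \<Lambda> \<in> N2" "\<Lambda> \<otimes>\<^sub>K \<Lambda> \<otimes>\<^sub>K \<Lambda> \<in> N3" "\<Lambda> *v vA = v1"
proof -
  obtain X0 where X0: "X0 \<in> N1" "X0 \<noteq> 0" using N1_nonzero by blast
  have mem: "contract q X \<in> N1" if "X \<in> N1" for q X
    unfolding contract_def by (rule N2_block[OF extension(1)[OF that]])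
  have lin: "clinear_on N1 (contract q)" for q
    using clinear_extension by (simp add: clinear_on_def contract_def block_linear)
  \<comment> \<open>The entries of one element of \<open>N3\<close> are the double contractions of
    \<open>X\<close>, so its exchange symmetry is the commutativity of the contractions.\<close>
  have three: "\<exists>S\<in>N3. \<forall>k l b i j c. S $ (k, l, b) $ (i, j, c) = contract (l, j) (contract (k, i) X) $ b $ c" if X: "X \<in> N1" for X
  proof -
    obtain S where S: "S \<in> N3" "S ** attach vA = attach v1 ** extension X" using extend2[OF extension(1)[OF X]] .
    have "S $ (k, l, b) $ (i, j, c) = contract (l, j) (contract (k, i) X) $ b $ c" for k l b i j c
      using extension_twice[OF X S, of k i] by (metis block_nth contract_def fst_conv snd_conv)
    then show ?thesis using S(1) by blast
  qed
  have comm: "contract q (contract r X) = contract r (contract q X)" if X: "X \<in> N1" for q r X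
  proof -
    obtain k i l j where qr: "q = (l, j)" "r = (k, i)" by (metis surj_pair)
    obtain S where S: "S \<in> N3" "\<forall>k l b i j c. S $ (k, l, b) $ (i, j, c) = contract (l, j) (contract (k, i) X) $ b $ c"
      using three[OF X] by blast
    have "contract q (contract r X) $ b $ c = contract r (contract q X) $ b $ c" for b c
      using N3_exchange[OF S(1), of k l b i j c] unfolding qr by (simp add: S(2))
    then show ?thesis by (simp add: vec_eq_iff)
  qed
  obtain X c where X: "X \<in> N1" "X \<noteq> 0" and c: "\<And>q. contract q X = cscale (c q) X"
    by (rule common_eigenvector[OF csubspace_N(1) X0, where R = contract], rule lin, erule mem, erule comm, rule that)
  define \<Lambda> where "\<Lambda> = (\<chi> k i. c (k, i))"
  have "extension X $ (k, b) $ (i, a) = (\<Lambda> \<otimes>\<^sub>K X) $ (k, b) $ (i, a)" for k b i a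
    using arg_cong[OF c[of "(k, i)"], of "\<lambda>M. M $ b $ a"] by (simp add: contract_def \<Lambda>_def)
  then have ext: "extension X = \<Lambda> \<otimes>\<^sub>K X" by (simp add: vec_eq_iff)
  obtain b0 a0 where X_ne: "X $ b0 $ a0 \<noteq> 0" using X(2) by (auto simp: vec_eq_iff)
  \<comment> \<open>The condition on the attached vector fixes the scale of \<open>\<Lambda>\<close>
    and shows that it is nonzero.\<close>
  have "attach (\<Lambda> *v vA) ** X = attach v1 ** X" using extension(2)[OF X(1)] by (simp add: ext kron_attach)
  then have "(attach (\<Lambda> *v vA) ** X) $ (k, b0) $ a0 = (attach v1 ** X) $ (k, b0) $ a0" for k by simp
  then have "(\<Lambda> *v vA) $ k = v1 $ k" for k using X_ne by (simp add: mult_nth)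
  then have v: "\<Lambda> *v vA = v1" by (simp add: vec_eq_iff)
  have "v1 \<noteq> 0" using v1_f1(2) by auto
  then have "\<Lambda> \<noteq> 0" using v by auto
  then obtain k0 i0 where L_ne: "\<Lambda> $ k0 $ i0 \<noteq> 0" by (auto simp: vec_eq_iff)
  \<comment> \<open>Commuting with the swap makes the two factors proportional, so \<open>X\<close>
    may be replaced by \<open>\<Lambda>\<close>.\<close>
  have "(\<Lambda> \<otimes>\<^sub>K X) ** swap = swap ** (\<Lambda> \<otimes>\<^sub>K X)"
    using extension(1)[OF X(1)] swap_centralizer \<Phi>_swap unfolding ext N2_def by (metis (mono_tags, lifting) mem_Collect_eq)
  then have "((\<Lambda> \<otimes>\<^sub>K X) ** swap) $ (k, b) $ (a, i) = (swap ** (\<Lambda> \<otimes>\<^sub>K X)) $ (k, b) $ (a, i)" for k b i a by simp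
  then have sym: "\<Lambda> $ k $ i * X $ b $ a = \<Lambda> $ b $ a * X $ k $ i" for k i a b
    by (simp add: mult_nth sum_pair)
  have Xk: "X $ k0 $ i0 \<noteq> 0" using sym[of k0 i0 b0 a0] L_ne X_ne by auto
  define d where "d = \<Lambda> $ k0 $ i0 / X $ k0 $ i0"
  have "\<Lambda> $ b $ a = d * X $ b $ a" for a b
    using sym[of k0 i0 b a] Xk by (simp add: d_def field_simps)
  then have \<Lambda>: "\<Lambda> = cscale d X" by (simp add: vec_eq_iff)
  have 2: "\<Lambda> \<otimes>\<^sub>K \<Lambda> \<in> N2"
    using extension(1)[OF X(1)] csubspace_N(2) by (subst (2) \<Lambda>) (simp add: ext cscale_kron csubspace_def)
  obtain S where S: "S \<in> N3" "\<forall>k l b i j c. S $ (k, l, b) $ (i, j, c) = contract (l, j) (contract (k, i) X) $ b $ c"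
    using three[OF X(1)] by blast
  have "contract q (contract r X) = cscale (c r) (cscale (c q) X)" for q r
    using lin[of q] X(1) unfolding c[of r] clinear_on_def by (simp add: c)
  then have "S = \<Lambda> \<otimes>\<^sub>K \<Lambda> \<otimes>\<^sub>K X"
    using S(2) by (simp add: vec_eq_iff \<Lambda>_def)
  then have "\<Lambda> \<otimes>\<^sub>K \<Lambda> \<otimes>\<^sub>K \<Lambda> = cscale d S" by (subst (3) \<Lambda>) (simp add: cscale_kron)
  then have 3: "\<Lambda> \<otimes>\<^sub>K \<Lambda> \<otimes>\<^sub>K \<Lambda> \<in> N3" using S(1) by (simp add: N3_def)
  show ?thesis using that 2 3 v by blast
qed

text \<open>Let \<open>k\<close> be in the kernel. The group-invariant functional
  \<open>F i j\<close> paired with \<open>vA\<close> on both legs is an element of the commutant,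
  and \<open>\<Lambda>\<close> on both legs sends the product of \<open>vA\<close> with itself to a
  nonzero vector; hence \<open>F i j\<close> vanishes on products of \<open>k\<close> with any
  \<open>k'\<close>. Varying \<open>j\<close> and \<open>k'\<close> gives a linear relation among
  the \<open>uA g\<close> with coefficients \<open>(uA g *v k) $ i\<close>, and pairing it with
  \<open>KA\<close> isolates \<open>k $ i = 0\<close>.\<close>

lemma grouplike_invertible:
  assumes \<Lambda>: "\<Lambda> \<otimes>\<^sub>K \<Lambda> \<in> N2" "\<Lambda> *v vA = v1"
  shows "invertible \<Lambda>"
proof (rule invertible_if_injective[OF card_eq], rule ccontr)
  fix k assume k: "\<Lambda> *v k = 0" "k \<noteq> 0"
  define F where "F i j = (\<Sum>g\<in>carrier G. kron_vec (axis i 1 v* uA g) (axis j 1 v* uA g))" for i j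
  have mem: "outer (kron_vec vA vA) (F i j) \<in> A2" for i j
    unfolding centralizer_def
  proof (intro CollectI ballI)
    fix g assume g: "g \<in> carrier G"
    have kv: "kron_vec a b v* (P \<otimes>\<^sub>K P) = kron_vec (a v* P) (b v* P)" for a b and P :: "complex^'m^'m"
      by (simp add: vec_eq_iff vector_matrix_mult_def sum_pair sum_product mult_ac)
    have "F i j v* (uA g \<otimes>\<^sub>K uA g) = (\<Sum>h\<in>carrier G. kron_vec (axis i 1 v* uA h) (axis j 1 v* uA h) v* (uA g \<otimes>\<^sub>K uA g))"
      unfolding F_def by (simp add: vec_eq_iff vector_matrix_mult_def sum_distrib_left sum_distrib_right sum.swap[of _ "carrier G"])
    also have "\<dots> = (\<Sum>h\<in>carrier G. kron_vec (axis i 1 v* uA (h \<otimes> g)) (axis j 1 v* uA (h \<otimes> g)))"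
      using A.rep g unfolding kv by (intro sum.cong) (auto simp: representation_def vector_matrix_mul_assoc)
    also have "\<dots> = F i j" unfolding F_def by (rule A.sum_group_right[OF g])
    finally show "(uA g \<otimes>\<^sub>K uA g) ** outer (kron_vec vA vA) (F i j) = outer (kron_vec vA vA) (F i j) ** (uA g \<otimes>\<^sub>K uA g)"
      by (simp add: outer_mult_left outer_mult_right kron_mult_kron_vec A.v_invariant g)
  qed
  have "(\<Sum>q\<in>UNIV. F i j $ q * kron_vec k k' $ q) = 0" for i j k'
  proof (rule ccontr)
    assume ne: "(\<Sum>q\<in>UNIV. F i j $ q * kron_vec k k' $ q) \<noteq> 0"
    let ?t = "outer (kron_vec vA vA) (F i j)" and ?s = "\<Sum>q\<in>UNIV. F i j $ q * kron_vec k k' $ q"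
    have t: "?t *v kron_vec k k' = ?s *s kron_vec vA vA"
      by (simp add: vec_eq_iff matrix_vector_mult_def sum_distrib_left sum_distrib_right mult_ac)
    have "(\<Lambda> \<otimes>\<^sub>K \<Lambda>) *v (?t *v kron_vec k k') = \<Phi> ?t *v ((\<Lambda> \<otimes>\<^sub>K \<Lambda>) *v kron_vec k k')"
      using \<Lambda>(1) mem[of i j] by (simp add: N2_def matrix_vector_mul_assoc)
    also have "\<dots> = 0" unfolding kron_mult_kron_vec k(1) by (simp add: kron_vec_def zero_vec_def[symmetric] flip: zero_vec_def)
    finally have "?s *s kron_vec v1 v1 = 0" unfolding t by (simp add: vec.scale kron_mult_kron_vec \<Lambda>(2))
    then have "kron_vec v1 v1 = 0" using ne by simp
    then have "v1 $ a * v1 $ a = 0" for a by (metis kron_vec_nth zero_index)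
    then show False using v1_f1(2) by simp
  qed
  moreover have "(\<Sum>q\<in>UNIV. F i j $ q * kron_vec k k' $ q) = (\<Sum>g\<in>carrier G. (uA g *v k) $ i * (uA g *v k') $ j)" for i j k'
  proof -
    have row: "(axis i 1 v* M) $ c = M $ i $ c" for i c and M :: "complex^'m^'m"
      by (simp add: vector_matrix_mult_def axis_nth)
    have "(\<Sum>q\<in>UNIV. F i j $ q * kron_vec k k' $ q)
      = (\<Sum>g\<in>carrier G. \<Sum>q\<in>UNIV. kron_vec (axis i 1 v* uA g) (axis j 1 v* uA g) $ q * kron_vec k k' $ q)"
      unfolding F_def sum_component sum_distrib_right by (rule sum.swap)
    also have "\<dots> = (\<Sum>g\<in>carrier G. (uA g *v k) $ i * (uA g *v k') $ j)"
      by (simp add: sum_pair row matrix_vector_mult_def sum_product mult_ac) (subst sum.swap, simp add: mult_ac)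
    finally show ?thesis .
  qed
  ultimately have z: "(\<Sum>g\<in>carrier G. (uA g *v k) $ i * (uA g *v k') $ j) = 0" for i j k' by simp
  have "k $ i = 0" for i
  proof -
    define M where "M = (\<Sum>g\<in>carrier G. cscale ((uA g *v k) $ i) (uA g))"
    have "M *v k' = 0" for k'
      using z[of i k'] by (simp add: M_def matrix_vector_mult_sum cscale_mult_vec vec_eq_iff)
    then have "M = 0" by (simp add: matrix_eq)
    then have "0 = trace (M ** KA)" by (simp add: trace_def)
    also have "\<dots> = (\<Sum>g\<in>carrier G. (uA g *v k) $ i * trace (uA g ** KA))"
      by (simp add: M_def sum_mult trace_sum trace_cscale)
    also have "\<dots> = (\<Sum>g\<in>carrier G. if g = \<one> then (uA g *v k) $ i else 0)"
      using A.sep by (intro sum.cong) (auto simp: A.separates_def)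
    also have "\<dots> = k $ i" using A.fin A.rep by (simp add: representation_def)
    finally show ?thesis by simp
  qed
  then show False using k(2) by (simp add: vec_eq_iff)
qed

end

section \<open>The gauge on the vertical legs\<close>

lemma csubspace_cscale: "csubspace E \<Longrightarrow> x \<in> E \<Longrightarrow> cscale c x \<in> E"
  by (simp add: csubspace_def)

definition slice :: "'c \<Rightarrow> 'd \<Rightarrow> complex^('a::finite \<times> 'd::finite)^('b::finite \<times> 'c::finite) \<Rightarrow> complex^'a^'b" where
  "slice l r t = (\<chi> i j. t $ (i, l) $ (j, r))"

lemma slice_nth [simp]: "slice l r t $ i $ j = t $ (i, l) $ (j, r)"
  by (simp add: slice_def)

lemma slice_mult: "slice l r (t ** (y \<otimes>\<^sub>K mat 1)) = slice l r t ** y" "slice l r ((z \<otimes>\<^sub>K mat 1) ** s) = z ** slice l r s"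
  by (simp_all add: entrywise)

lemma slice_eqI: "(\<And>l r. slice l r s = slice l r t) \<Longrightarrow> s = t"
  by (simp add: vec_eq_iff)

lemma slice_lincomb: "slice l r (lincomb a \<phi>) = (\<Sum>s\<in>UNIV. cscale (\<phi> s) (slice l r (a s)))"
  by (simp add: vec_eq_iff lincomb_nth sum_matrix_nth)

lemma ring2_slice: "ring2 s t $ (l1, l2) $ (r1, r2) = trace (slice l1 r1 s ** slice l2 r2 t)"
  unfolding ring2_nth by (subst sum.swap) (simp add: trace_def mult_nth)

lemma ring3_slice: "ring3 s t r $ (l1, l2, l3) $ (r1, r2, r3) = trace (slice l1 r1 s ** slice l2 r2 t ** slice l3 r3 r)"
  unfolding ring3_nth by (subst sum_last_first3) (simp add: trace_def mult_nth sum_distrib_right, subst sum.swap, rule refl)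

lemma subalgebra_UNIV: "subalgebra UNIV"
  by (simp add: subalgebra_def csubspace_def)

text \<open>Matrices \<open>outer x (axis undefined 1)\<close> form a minimal left ideal, a copy of
  the column space. Applying \<open>\<Gamma>\<close> and reading off a column \<open>k\<close> that
  does not always vanish gives the intertwiner \<open>Y\<close>. A nonzero kernel vector could be
  moved to any vector by a matrix, so \<open>Y\<close> would be zero.\<close>

lemma matrix_algebra_iso_inner:
  fixes \<Gamma> :: "complex^'a^'a \<Rightarrow> complex^'b^'b"
  assumes \<Gamma>: "alg_iso UNIV UNIV \<Gamma>" and card: "CARD('a) = CARD('b)"
  obtains Y :: "complex^'a^'b" where "invertible Y" "\<And>M. \<Gamma> M ** Y = Y ** M"
proof -
  let ?E = "\<lambda>c. outer (axis c 1) (axis undefined 1) :: complex^'a^'a"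
  have "\<Gamma> (outer (axis undefined 1) (axis undefined 1)) \<noteq> 0"
  proof
    assume "\<Gamma> (outer (axis undefined 1) (axis undefined 1)) = 0"
    then have "\<Gamma> (outer (axis undefined 1) (axis undefined 1)) = \<Gamma> 0"
      using alg_iso_zero[OF \<Gamma> subalgebra_UNIV] by simp
    then have "outer (axis undefined 1) (axis undefined 1) = (0 :: complex^'a^'a)"
      using alg_isoD(2)[OF \<Gamma>] by (simp add: inj_def)
    moreover have "(outer (axis undefined 1) (axis undefined 1) :: complex^'a^'a) $ undefined $ undefined = 1"
      by (simp add: axis_nth)
    ultimately show False by simp
  qed
  then obtain r k where rk: "\<Gamma> (?E undefined) $ r $ k \<noteq> 0" by (auto simp: vec_eq_iff)
  define Y :: "complex^'a^'b" where "Y = (\<chi> r c. \<Gamma> (?E c) $ r $ k)"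
  have Yv: "Y *v x = \<Gamma> (outer x (axis undefined 1)) *v axis k 1" for x
  proof -
    have "outer x (axis undefined 1) = (\<Sum>c\<in>UNIV. cscale (x $ c) (?E c))"
      by (subst vec_as_sum[of x]) (simp add: outer_linear)
    then have "\<Gamma> (outer x (axis undefined 1)) = (\<Sum>c\<in>UNIV. cscale (x $ c) (\<Gamma> (?E c)))"
      by (simp add: alg_iso_sum[OF \<Gamma> subalgebra_UNIV] alg_isoD(6)[OF \<Gamma>])
    then show ?thesis
      by (simp add: vec_eq_iff Y_def matrix_vector_mult_def sum_matrix_nth axis_nth mult.commute)
  qed
  have Y: "\<Gamma> M ** Y = Y ** M" for M
  proof -
    have "\<Gamma> M *v (Y *v x) = Y *v (M *v x)" for x
      unfolding Yv outer_mult_left[symmetric] by (simp add: alg_isoD(5)[OF \<Gamma>] matrix_vector_mul_assoc)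
    then show ?thesis by (simp add: matrix_eq matrix_vector_mul_assoc)
  qed
  have "x = 0" if x: "Y *v x = 0" for x
  proof (rule ccontr)
    assume "x \<noteq> 0"
    then obtain i where i: "x $ i \<noteq> 0" by (auto simp: vec_eq_iff)
    have "(Y ** outer w (axis i 1)) *v x = 0" for w
      unfolding Y[symmetric] matrix_vector_mul_assoc[symmetric] x by simp
    moreover have "(Y ** outer w (axis i 1)) *v x = x $ i *s (Y *v w)" for w
      by (simp add: outer_mult_left vec_eq_iff matrix_vector_mult_def axis_nth mult.commute[of "x $ i"])
    ultimately have "Y *v w = 0" for w using i by simp
    then have "Y = 0" by (simp add: matrix_eq)
    then have "Y $ r $ undefined = 0" by simp
    then show False using rk by (simp add: Y_def)
  qed
  then have "invertible Y" by (rule invertible_if_injective[OF card])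
  then show ?thesis using Y that by blast
qed

context torus_equal
begin

text \<open>After conjugation by \<open>X\<close> the columns of both families agree as matrices,
  not only in their traces. Every entry of a column is the trace of a product of slices, which is
  the input for an isomorphism of the full matrix algebras on the vertical leg.\<close>

lemma gauge_exists:
  obtains X Y :: "complex^'m^'n" where "invertible X" "invertible Y" "\<And>s. b s ** (Y \<otimes>\<^sub>K X) = (Y \<otimes>\<^sub>K X) ** a s"
proof -
  obtain X :: "complex^'m^'n" where X2: "X \<otimes>\<^sub>K X \<in> N2" and X3: "X \<otimes>\<^sub>K X \<otimes>\<^sub>K X \<in> N3" and "X *v vA = v1"
    by (rule grouplike)
  then have "invertible X" using grouplike_invertible by blast
  then obtain Xi where Xi: "X ** Xi = mat 1" "Xi ** X = mat 1" by (auto simp: invertible_def)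
  define c where "c s = (mat 1 \<otimes>\<^sub>K Xi) ** b s ** (mat 1 \<otimes>\<^sub>K X)" for s
  have aA: "a s \<in> A2" for s using A.range_a lincomb_mem by blast
  have ring2: "ring2 (c s) (c t) = ring2 (a s) (a t)" for s t
  proof -
    have "ring2 (c s) (c t) = (Xi \<otimes>\<^sub>K Xi) ** (\<Phi> (ring2 (a s) (a t)) ** (X \<otimes>\<^sub>K X))"
      by (simp add: c_def ring2_conj[OF matrix_mul_lid] ring_iso(1) aA \<omega>_site matrix_mul_assoc)
    also have "\<Phi> (ring2 (a s) (a t)) ** (X \<otimes>\<^sub>K X) = (X \<otimes>\<^sub>K X) ** ring2 (a s) (a t)"
      using X2 A.ring_centralizer(1)[OF A.rep aA aA aA] by (simp add: N2_def)
    finally show ?thesis by (simp add: matrix_mul_assoc kron_mult Xi kron_one)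
  qed
  have ring3: "ring3 (c s) (c t) (c r) = ring3 (a s) (a t) (a r)" for s t r
  proof -
    have "ring3 (c s) (c t) (c r) = (Xi \<otimes>\<^sub>K Xi \<otimes>\<^sub>K Xi) ** (\<Phi>3 (ring3 (a s) (a t) (a r)) ** (X \<otimes>\<^sub>K X \<otimes>\<^sub>K X))"
      by (simp add: c_def ring3_conj[OF matrix_mul_lid] ring_iso(3) aA \<omega>_site matrix_mul_assoc)
    also have "\<Phi>3 (ring3 (a s) (a t) (a r)) ** (X \<otimes>\<^sub>K X \<otimes>\<^sub>K X) = (X \<otimes>\<^sub>K X \<otimes>\<^sub>K X) ** ring3 (a s) (a t) (a r)"
      using X3 A.ring_centralizer(2)[OF A.rep aA aA aA] by (simp add: N3_def)
    finally show ?thesis by (simp add: matrix_mul_assoc kron_mult Xi kron_one)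
  qed
  define P where "P q = slice (fst (snd q)) (snd (snd q)) (a (fst q))" for q
  define Q where "Q q = slice (fst (snd q)) (snd (snd q)) (c (fst q))" for q
  have tr2: "trace (P q ** P r) = trace (Q q ** Q r)" for q r
    unfolding P_def Q_def ring2_slice[symmetric] ring2 ..
  have tr3: "trace (P q ** P r ** P s) = trace (Q q ** Q r ** Q s)" for q r s
    unfolding P_def Q_def ring3_slice[symmetric] ring3 ..
  have rP: "range (lincomb P) = UNIV"
  proof (intro equalityI subset_UNIV subsetI)
    fix M :: "complex^'m^'m"
    obtain \<sigma> where \<sigma>: "swap = lincomb a \<sigma>" using A2_cases[OF swap_centralizer] by blast
    \<comment> \<open>The slices of the corner are the matrix units, so the slices of the sites span
      all matrices.\<close>
    have "slice l r swap \<in> range (lincomb P)" for l r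
    proof -
      have "slice l r swap = (\<Sum>s\<in>UNIV. cscale (\<sigma> s) (P (s, l, r)))" unfolding \<sigma> slice_lincomb P_def by simp
      then show ?thesis
        by (simp only:) (intro csubspace_sum csubspace_cscale csubspace_lincomb lincomb_mem)
    qed
    then have "(\<Sum>l\<in>UNIV. \<Sum>r\<in>UNIV. cscale (M $ r $ l) (slice l r swap)) \<in> range (lincomb P)"
      by (intro csubspace_sum csubspace_cscale csubspace_lincomb)
    also have "(\<Sum>l\<in>UNIV. \<Sum>r\<in>UNIV. cscale (M $ r $ l) (slice l r swap)) = M"
      by (simp add: vec_eq_iff sum_matrix_nth)
    finally show "M \<in> range (lincomb P)" .
  qed
  have rQ: "range (lincomb Q) = UNIV"
  proof (intro equalityI subset_UNIV subsetI)
    fix M :: "complex^'n^'n"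
    obtain \<sigma> where \<sigma>: "swap = lincomb b \<sigma>" using swap_centralizer[of G uB] unfolding B.range_a[symmetric] by (metis imageE)
    let ?s = "(mat 1 \<otimes>\<^sub>K Xi) ** swap ** (mat 1 \<otimes>\<^sub>K X)"
    have s: "?s = lincomb c \<sigma>" unfolding \<sigma> by (simp add: lincomb_def c_def sum_mult)
    have "slice l r ?s \<in> range (lincomb Q)" for l r
    proof -
      have "slice l r ?s = (\<Sum>s\<in>UNIV. cscale (\<sigma> s) (Q (s, l, r)))" unfolding s slice_lincomb Q_def by simp
      then show ?thesis
        by (simp only:) (intro csubspace_sum csubspace_cscale csubspace_lincomb lincomb_mem)
    qed
    \<comment> \<open>The slices of the conjugated corner are matrix units multiplied by
      \<open>X\<close> and \<open>Xi\<close>; conjugating the coefficients of \<open>M\<close> the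
      other way compensates.\<close>
    then have "(\<Sum>l\<in>UNIV. \<Sum>r\<in>UNIV. cscale ((Xi ** M ** X) $ r $ l) (slice l r ?s)) \<in> range (lincomb Q)"
      by (intro csubspace_sum csubspace_cscale csubspace_lincomb)
    also have "(\<Sum>l\<in>UNIV. \<Sum>r\<in>UNIV. cscale ((Xi ** M ** X) $ r $ l) (slice l r ?s)) = X ** (Xi ** M ** X) ** Xi"
    proof -
      have "slice l r ?s $ i $ j = X $ i $ r * Xi $ l $ j" for l r i j
        by (simp add: mult_nth sum_pair mat_nth)
      then show ?thesis
        by (simp add: vec_eq_iff sum_matrix_nth mult_nth[of "X ** _"] mult_nth[of X] sum_distrib_left sum_distrib_right mult_ac)
    qed
    also have "\<dots> = (X ** Xi) ** M ** (X ** Xi)" by (simp only: matrix_mul_assoc)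
    finally show "M \<in> range (lincomb Q)" by (simp add: Xi)
  qed
  obtain \<Gamma> where \<Gamma>: "alg_iso UNIV UNIV \<Gamma>" "\<And>\<xi>. \<Gamma> (lincomb P \<xi>) = lincomb Q \<xi>"
    by (rule trace_lincomb_iso[OF rP rQ subalgebra_UNIV subalgebra_UNIV trace_nondegenerate_UNIV trace_nondegenerate_UNIV tr2 tr3])
      (blast intro: that)
  obtain Y :: "complex^'m^'n" where Y: "invertible Y" "\<And>M. \<Gamma> M ** Y = Y ** M"
    using matrix_algebra_iso_inner[OF \<Gamma>(1) card_eq] by blast
  have "\<Gamma> (P q) = Q q" for q using \<Gamma>(2) lincomb_single by metis
  then have PQ: "Q q ** Y = Y ** P q" for q using Y(2)[of "P q"] by simp
  have "b s ** (Y \<otimes>\<^sub>K X) = (Y \<otimes>\<^sub>K X) ** a s" for s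
  proof -
    have "c s ** (Y \<otimes>\<^sub>K mat 1) = (Y \<otimes>\<^sub>K mat 1) ** a s"
      by (rule slice_eqI) (use PQ[of "(s, _, _)"] in \<open>simp add: slice_mult P_def Q_def\<close>)
    then have "(mat 1 \<otimes>\<^sub>K X) ** c s ** (Y \<otimes>\<^sub>K mat 1) = (mat 1 \<otimes>\<^sub>K X) ** (Y \<otimes>\<^sub>K mat 1) ** a s"
      by (simp flip: matrix_mul_assoc)
    moreover have "(mat 1 \<otimes>\<^sub>K X) ** c s = b s ** (mat 1 \<otimes>\<^sub>K X)"
      unfolding c_def matrix_mul_assoc kron_mult by (simp add: Xi kron_one)
    ultimately show ?thesis by (simp add: kron_mult flip: matrix_mul_assoc)
  qed
  then show ?thesis using that \<open>invertible X\<close> Y(1) by blast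
qed

end

section \<open>Separating the group elements\<close>

definition fscale :: "complex \<Rightarrow> ('g \<Rightarrow> complex) \<Rightarrow> 'g \<Rightarrow> complex" where
  "fscale r f = (\<lambda>x. r * f x)"

interpretation fs: vector_space "fscale :: complex \<Rightarrow> ('g \<Rightarrow> complex) \<Rightarrow> 'g \<Rightarrow> complex"
  by standard (auto simp: fscale_def algebra_simps)

lemma sum_fun_apply: "(\<Sum>s\<in>S. F s) x = (\<Sum>s\<in>S. F s (x :: 'g) :: complex)"
  by (induction S rule: infinite_finite_induct) auto

lemma smult_zero_vec: "(c :: complex) \<cdot>\<^sub>v 0\<^sub>v k = 0\<^sub>v k"
  by (rule eq_vecI) auto

lemma subspace_module_vecD:
  assumes "VectorSpace.subspace class_ring W (module_vec TYPE(complex) k)"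
  shows "W \<subseteq> carrier_vec k" "0\<^sub>v k \<in> W" "v \<in> W \<Longrightarrow> w \<in> W \<Longrightarrow> v + w \<in> W" "w \<in> W \<Longrightarrow> c \<cdot>\<^sub>v w \<in> W"
proof -
  have sub: "submodule class_ring W (module_vec TYPE(complex) k)" using assms by (simp add: VectorSpace.subspace_def)
  show "W \<subseteq> carrier_vec k" "0\<^sub>v k \<in> W" "v \<in> W \<Longrightarrow> w \<in> W \<Longrightarrow> v + w \<in> W" "w \<in> W \<Longrightarrow> c \<cdot>\<^sub>v w \<in> W"
    using submodule.subset[OF sub] submodule.zero_closed[OF sub] submodule.m_closed[OF sub, of v w]
      submodule.smult_closed[OF sub, of c w]
    by (simp_all add: module_vec_simps class_ring_simps)
qed

lemma mat_eq_if_mult_vec_eq: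
  assumes "P \<in> carrier_mat k k" "Q \<in> carrier_mat k k"
    and "\<And>w. w \<in> carrier_vec k \<Longrightarrow> P *\<^sub>v w = Q *\<^sub>v (w :: complex Matrix.vec)"
  shows "P = Q"
proof (rule eq_matI)
  fix i j assume ij: "i < dim_row Q" "j < dim_col Q"
  have "vec_index (P *\<^sub>v unit_vec k j) i = vec_index (Q *\<^sub>v unit_vec k j) i" using assms(3) by simp
  then show "P $$ (i, j) = Q $$ (i, j)" using ij assms(1,2) by (auto simp: scalar_prod_right_unit)
qed (use assms in auto)

section \<open>The left regular representation\<close>

context group
begin

text \<open>The group algebra is realised as functions vanishing outside the carrier; the value 0
  there keeps translates in this space.\<close>

definition left_translate :: "'a \<Rightarrow> ('a \<Rightarrow> complex) \<Rightarrow> 'a \<Rightarrow> complex" where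
  "left_translate g f = (\<lambda>x. if x \<in> carrier G then f (inv g \<otimes> x) else 0)"

lemma left_translate_linear:
  "left_translate g (f + f') = left_translate g f + left_translate g f'"
  "left_translate g (fscale r f) = fscale r (left_translate g f)"
  by (auto simp: left_translate_def fscale_def)

lemma left_translate_sum: "left_translate g (\<Sum>s\<in>S. F s) = (\<Sum>s\<in>S. left_translate g (F s))"
proof (induction S rule: infinite_finite_induct)
  case (insert x S)
  then show ?case by (simp only: sum.insert[OF insert.hyps] left_translate_linear insert.IH)
qed (auto simp: left_translate_def)

lemma left_translate_mult:
  assumes "g \<in> carrier G" "h \<in> carrier G"
  shows "left_translate (g \<otimes> h) f = left_translate g (left_translate h f)"
  using assms by (auto simp: left_translate_def inv_mult_group m_assoc)

lemma left_translate_one: "(\<And>x. x \<notin> carrier G \<Longrightarrow> f x = 0) \<Longrightarrow> left_translate \<one> f = f"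
  by (auto simp: left_translate_def)

definition translation_invariant :: "('a \<Rightarrow> complex) set \<Rightarrow> bool" where
  "translation_invariant W \<longleftrightarrow> (\<forall>g\<in>carrier G. \<forall>f\<in>W. left_translate g f \<in> W)"

end

section \<open>Irreducible constituents of the regular representation and linear
  independence\<close>

context finite_group
begin

text \<open>The indicator functions of group elements bound all dimensions. Among independent sets
  spanning nonzero invariant subspaces of \<open>I\<close>, one of least cardinality is taken; a
  proper nonzero invariant subspace would have a smaller basis.\<close>

lemma minimal_invariant_subspace:
  assumes I: "fs.subspace I" "translation_invariant I" "\<And>f x. f \<in> I \<Longrightarrow> x \<notin> carrier G \<Longrightarrow> f x = 0"
    and ne: "f0 \<in> I" "f0 \<noteq> 0"
  obtains B where "finite B" "fs.independent B" "B \<noteq> {}" "fs.span B \<subseteq> I" "translation_invariant (fs.span B)"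
    "\<And>W. fs.subspace W \<Longrightarrow> W \<subseteq> fs.span B \<Longrightarrow> translation_invariant W \<Longrightarrow> W = {0} \<or> W = fs.span B"
proof -
  define D where "D = (\<lambda>g x. if x = g then 1 else 0 :: complex) ` carrier G"
  have D: "finite D" using fin by (simp add: D_def)
  have "f \<in> fs.span D" if "f \<in> I" for f
  proof -
    have "f = (\<Sum>g\<in>carrier G. fscale (f g) (\<lambda>x. if x = g then 1 else 0))"
      using I(3)[OF that] fin by (auto simp: fun_eq_iff sum_fun_apply fscale_def)
    also have "\<dots> \<in> fs.span D" by (intro fs.span_sum fs.span_scale fs.span_base) (auto simp: D_def)
    finally show ?thesis .
  qed
  then have ID: "I \<subseteq> fs.span D" by blast
  define Q where "Q B \<longleftrightarrow> finite B \<and> fs.independent B \<and> B \<noteq> {} \<and> fs.span B \<subseteq> I \<and> translation_invariant (fs.span B)" for B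
  have Q_basis: "\<exists>B. Q B \<and> fs.span B = W" if W: "fs.subspace W" "W \<subseteq> I" "translation_invariant W" "W \<noteq> {0}" for W
  proof -
    obtain B where B: "B \<subseteq> W" "fs.independent B" "W \<subseteq> fs.span B" using fs.maximal_independent_subset .
    have span: "fs.span B = W" using B W(1) fs.span_minimal by blast
    have "finite B" using fs.independent_span_bound[OF D B(2)] B(1) W(2) ID by blast
    moreover have "B \<noteq> {}" using span W(4) by auto
    ultimately show ?thesis using B span W by (auto simp: Q_def)
  qed
  have "\<exists>B. Q B" using Q_basis[of I] I ne by blast
  then obtain B where B: "Q B" and min: "\<And>B'. Q B' \<Longrightarrow> card B \<le> card B'"
    using ex_has_least_nat[of Q _ card] by blast
  have "W = {0} \<or> W = fs.span B" if W: "fs.subspace W" "W \<subseteq> fs.span B" "translation_invariant W" for W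
  proof (rule disjCI)
    assume "W \<noteq> fs.span B"
    show "W = {0}"
    proof (rule ccontr)
      assume "W \<noteq> {0}"
      then obtain B' where B': "Q B'" "fs.span B' = W" using Q_basis[of W] W B by (auto simp: Q_def)
      obtain x where x: "x \<in> fs.span B" "x \<notin> fs.span B'" using W B' \<open>W \<noteq> fs.span B\<close> by blast
      have ind: "fs.independent (insert x B')" using x B' by (intro fs.independent_insertI) (auto simp: Q_def)
      have "insert x B' \<subseteq> fs.span B" using x B' W fs.span_superset by blast
      then have "card (insert x B') \<le> card B"
        using fs.independent_span_bound[OF _ ind, of B] B by (auto simp: Q_def)
      moreover have "x \<notin> B'" using x fs.span_superset by blast
      ultimately have "card B' < card B" using B' by (simp add: Q_def)
      then show False using min[OF B'(1)] by simp
    qed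
  qed
  then show ?thesis using that[of B] B by (auto simp: Q_def)
qed

text \<open>Coordinates in the basis \<open>B\<close> turn translations into matrices, the form over
  which irreducible representations are quantified. \<open>F\<close> identifies invariant subspaces
  on both sides, so minimality becomes irreducibility. The last conclusion keeps the linearity of
  \<open>F\<close> available to the caller.\<close>

lemma irreducible_from_invariant_subspace:
  assumes B: "finite B" "fs.independent B" "B \<noteq> {}" "translation_invariant (fs.span B)"
    and supp: "\<And>f x. f \<in> fs.span B \<Longrightarrow> x \<notin> carrier G \<Longrightarrow> f x = 0"
    and min: "\<And>W. fs.subspace W \<Longrightarrow> W \<subseteq> fs.span B \<Longrightarrow> translation_invariant W \<Longrightarrow> W = {0} \<or> W = fs.span B"
  obtains k \<rho> F where "irreducible_representation G k \<rho>" "F ` carrier_vec k = fs.span B" "F (0\<^sub>v k) = 0"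
    "\<And>g w. g \<in> carrier G \<Longrightarrow> w \<in> carrier_vec k \<Longrightarrow> F (\<rho> g *\<^sub>v w) = left_translate g (F w)"
    "\<And>w. F w = (\<Sum>i<k. fscale (vec_index w i) (F (unit_vec k i)))"
proof -
  define k where "k = card B"
  have k: "k > 0" using B by (simp add: k_def card_gt_0_iff)
  obtain e where e: "bij_betw e {..<k} B" using ex_bij_betw_nat_finite[OF B(1)] by (auto simp: k_def lessThan_atLeast0)
  then have eB: "i < k \<Longrightarrow> e i \<in> B" for i by (auto simp: bij_betw_def)
  define F :: "complex Matrix.vec \<Rightarrow> 'a \<Rightarrow> complex" where "F w = (\<Sum>i<k. fscale (vec_index w i) (e i))" for w
  define coord where "coord f = Matrix.vec k (\<lambda>i. fs.representation B f (e i))" for f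
  have F_span: "F w \<in> fs.span B" for w
    unfolding F_def by (intro fs.span_sum fs.span_scale fs.span_base eB) simp
  have coord: "coord f \<in> carrier_vec k" for f by (simp add: coord_def)
  have F_coord: "F (coord f) = f" if "f \<in> fs.span B" for f
  proof -
    have "F (coord f) = (\<Sum>i<k. fscale (fs.representation B f (e i)) (e i))" by (simp add: F_def coord_def)
    also have "\<dots> = (\<Sum>b\<in>B. fscale (fs.representation B f b) b)" by (rule sum.reindex_bij_betw[OF e])
    also have "\<dots> = f" by (rule fs.sum_representation_eq[OF B(2) that B(1) order.refl])
    finally show ?thesis .
  qed
  have F_add: "F (v + w) = F v + F w" if "v \<in> carrier_vec k" "w \<in> carrier_vec k" for v w
    using that unfolding F_def sum.distrib[symmetric] by (intro sum.cong refl) (auto simp: fs.scale_left_distrib)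
  have F_smult: "F (c \<cdot>\<^sub>v w) = fscale c (F w)" if "w \<in> carrier_vec k" for c w
    using that by (simp add: F_def fs.scale_sum_right)
  have F_inj: "v = w" if vw: "v \<in> carrier_vec k" "w \<in> carrier_vec k" "F v = F w" for v w
  proof (rule eq_vecI)
    fix i assume "i < dim_vec w"
    then have i: "i < k" using vw by simp
    define d where "d b = vec_index v (inv_into {..<k} e b) - vec_index w (inv_into {..<k} e b)" for b
    have "(\<Sum>b\<in>B. fscale (d b) b) = (\<Sum>i<k. fscale (d (e i)) (e i))"
      by (rule sum.reindex_bij_betw[OF e, symmetric])
    also have "\<dots> = (\<Sum>i<k. fscale (vec_index v i - vec_index w i) (e i))"
      using e by (intro sum.cong) (auto simp: d_def bij_betw_def)
    also have "\<dots> = F v - F w" by (simp add: F_def fs.scale_left_diff_distrib sum_subtractf)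
    finally have "(\<Sum>b\<in>B. fscale (d b) b) = 0" using vw by simp
    then have "d (e i) = 0" using fs.independentD[OF B(2,1) order.refl] eB[OF i] by blast
    then show "vec_index v i = vec_index w i" using e i by (simp add: d_def bij_betw_def)
  qed (use vw in auto)
  define \<rho> where "\<rho> g = Matrix.mat k k (\<lambda>(i, j). vec_index (coord (left_translate g (e j))) i)" for g
  have \<rho>: "\<rho> g \<in> carrier_mat k k" for g by (simp add: \<rho>_def)
  have F\<rho>: "F (\<rho> g *\<^sub>v w) = left_translate g (F w)" if "g \<in> carrier G" "w \<in> carrier_vec k" for g w
  proof -
    have "F (\<rho> g *\<^sub>v w) = (\<Sum>i<k. fscale (\<Sum>j<k. vec_index (coord (left_translate g (e j))) i * vec_index w j) (e i))"
      using that unfolding F_def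
      by (intro sum.cong refl arg_cong2[where f = fscale]) (simp add: \<rho>_def scalar_prod_def lessThan_atLeast0)
    also have "\<dots> = (\<Sum>j<k. fscale (vec_index w j) (F (coord (left_translate g (e j)))))"
      unfolding F_def fs.scale_sum_left fs.scale_sum_right by (subst sum.swap) (simp add: mult.commute)
    also have "\<dots> = (\<Sum>j<k. fscale (vec_index w j) (left_translate g (e j)))"
    proof (intro sum.cong refl arg_cong2[where f = fscale] F_coord)
      fix j assume "j \<in> {..<k}"
      then have "e j \<in> fs.span B" by (intro fs.span_base eB) simp
      then show "left_translate g (e j) \<in> fs.span B" using B(4) that(1) unfolding translation_invariant_def by blast
    qed
    also have "\<dots> = left_translate g (F w)"
      by (simp add: F_def left_translate_sum left_translate_linear)
    finally show ?thesis .
  qed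
  have F_image: "F ` carrier_vec k = fs.span B"
  proof
    show "fs.span B \<subseteq> F ` carrier_vec k" using F_coord coord by (metis image_eqI subsetI)
  qed (use F_span in auto)
  have F_zero: "F (0\<^sub>v k) = 0" by (simp add: F_def)
  have irr: "irreducible_representation G k \<rho>"
    unfolding irreducible_representation_def
  proof (intro conjI ballI allI impI)
    show "\<rho> \<one> = 1\<^sub>m k"
    proof (rule mat_eq_if_mult_vec_eq[OF \<rho>])
      fix w :: "complex Matrix.vec" assume w: "w \<in> carrier_vec k"
      have "F (\<rho> \<one> *\<^sub>v w) = F w" using F\<rho>[OF one_closed w] supp[OF F_span] by (simp add: left_translate_one)
      then show "\<rho> \<one> *\<^sub>v w = 1\<^sub>m k *\<^sub>v w" using F_inj w mult_mat_vec_carrier[OF \<rho>] by simp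
    qed simp
    fix g h assume gh: "g \<in> carrier G" "h \<in> carrier G"
    show "\<rho> (g \<otimes> h) = \<rho> g * \<rho> h"
    proof (rule mat_eq_if_mult_vec_eq[OF \<rho> mult_carrier_mat[OF \<rho> \<rho>]])
      fix w :: "complex Matrix.vec" assume w: "w \<in> carrier_vec k"
      note hw = mult_mat_vec_carrier[OF \<rho> w, of h]
      have "F (\<rho> (g \<otimes> h) *\<^sub>v w) = F (\<rho> g *\<^sub>v (\<rho> h *\<^sub>v w))"
        using gh w hw by (simp add: F\<rho> left_translate_mult)
      then have "\<rho> (g \<otimes> h) *\<^sub>v w = \<rho> g *\<^sub>v (\<rho> h *\<^sub>v w)"
        using F_inj w hw mult_mat_vec_carrier[OF \<rho>] by blast
      then show "\<rho> (g \<otimes> h) *\<^sub>v w = (\<rho> g * \<rho> h) *\<^sub>v w"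
        using assoc_mult_mat_vec[OF \<rho> \<rho> w] by simp
    qed
  next
    fix W assume W: "VectorSpace.subspace class_ring W (module_vec TYPE(complex) k)"
      and inv: "\<forall>g\<in>carrier G. \<forall>w\<in>W. \<rho> g *\<^sub>v w \<in> W"
    note Wk = subspace_module_vecD(1)[OF W] and W0 = subspace_module_vecD(2)[OF W]
      and Wadd = subspace_module_vecD(3)[OF W] and Wsm = subspace_module_vecD(4)[OF W]
    have "fs.subspace (F ` W)"
    proof (rule fs.subspaceI)
      show "0 \<in> F ` W" using W0 F_zero by (metis image_eqI)
      show "x + y \<in> F ` W" if "x \<in> F ` W" "y \<in> F ` W" for x y
        using that F_add Wadd Wk by (smt (verit) image_iff subsetD)
      show "fscale c x \<in> F ` W" if "x \<in> F ` W" for c x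
        using that F_smult Wsm Wk by (smt (verit) image_iff subsetD)
    qed
    moreover have "F ` W \<subseteq> fs.span B" using F_span by blast
    moreover have "translation_invariant (F ` W)"
      unfolding translation_invariant_def
    proof (intro ballI)
      fix g f assume g: "g \<in> carrier G" and "f \<in> F ` W"
      then obtain w where w: "w \<in> W" "f = F w" by blast
      then have "left_translate g f = F (\<rho> g *\<^sub>v w)" using F\<rho>[OF g, of w] Wk by auto
      then show "left_translate g f \<in> F ` W" using inv g w by blast
    qed
    ultimately consider "F ` W = {0}" | "F ` W = fs.span B" using min by blast
    then show "W = {0\<^sub>v k} \<or> W = carrier_vec k"
    proof cases
      case 1
      have "w = 0\<^sub>v k" if "w \<in> W" for w
      proof (rule F_inj)
        show "F w = F (0\<^sub>v k)" using 1 that F_zero by auto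
      qed (use that Wk in auto)
      then show ?thesis using W0 by blast
    next
      case 2
      have "w \<in> W" if w: "w \<in> carrier_vec k" for w
      proof -
        have "F w \<in> F ` W" using 2 F_span by blast
        then obtain w' where "w' \<in> W" "F w = F w'" by blast
        then show ?thesis using F_inj[OF w, of w'] Wk by auto
      qed
      then show ?thesis using Wk by blast
    qed
  qed (use k \<rho> in auto)
  have "F (unit_vec k i) = e i" if "i < k" for i
  proof -
    have "F (unit_vec k i) = (\<Sum>j<k. if j = i then e i else 0)"
      unfolding F_def using that by (intro sum.cong) auto
    then show ?thesis using that by simp
  qed
  then have "F w = (\<Sum>i<k. fscale (vec_index w i) (F (unit_vec k i)))" for w
    by (subst F_def) (intro sum.cong refl, simp)
  then show ?thesis using that[OF irr F_image F_zero F\<rho>] by blast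
qed

text \<open>A linear relation among the \<open>u g\<close> would, for a minimal left ideal inside the adjoint of the annihilator
  of \<open>u\<close>, give an irreducible representation that is contained in \<open>u\<close> and hence annihilated; but \<open>y\<^sup>* y\<close>
  does not vanish for \<open>y \<noteq> 0\<close>.\<close>

lemma rep_independent:
  fixes u :: "'a \<Rightarrow> complex^'n^'n"
  assumes rep: "representation G u"
    and contains: "\<And>k \<rho>. irreducible_representation G k \<rho> \<Longrightarrow> contains_representation G u k \<rho>"
    and c: "(\<Sum>g\<in>carrier G. cscale (c g) (u g)) = 0" and h: "h \<in> carrier G"
  shows "c h = 0"
proof (rule ccontr)
  assume "c h \<noteq> 0"
  \<comment> \<open>Conjugation and inversion form the adjoint: for \<open>y\<close> in
    \<open>I\<close> the adjoint of \<open>y\<close> annihilates \<open>u\<close>, hence also each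
    representation contained in \<open>u\<close>, including the one generated by \<open>y\<close>
    itself.\<close>
  define I where "I = {y. (\<forall>x. x \<notin> carrier G \<longrightarrow> y x = 0) \<and> (\<Sum>g\<in>carrier G. cscale (cnj (y (inv g))) (u g)) = 0}"
  have I_sub: "fs.subspace I"
  proof (rule fs.subspaceI)
    show "x + y \<in> I" if "x \<in> I" "y \<in> I" for x y
      using that by (auto simp: I_def cscale_add sum.distrib)
    show "fscale r x \<in> I" if "x \<in> I" for r x
    proof -
      have "(\<Sum>g\<in>carrier G. cscale (cnj (r * x (inv g))) (u g)) = cscale (cnj r) (\<Sum>g\<in>carrier G. cscale (cnj (x (inv g))) (u g))"
        by (simp add: cscale_sum)
      then show ?thesis using that by (simp add: I_def fscale_def)
    qed
  qed (simp add: I_def)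
  have I_inv: "translation_invariant I"
    unfolding translation_invariant_def
  proof (intro ballI)
    fix g y assume g: "g \<in> carrier G" and y: "y \<in> I"
    have "(\<Sum>k\<in>carrier G. cscale (cnj (left_translate g y (inv k))) (u k))
      = (\<Sum>k\<in>carrier G. cscale (cnj (y (inv (k \<otimes> g)))) (u (k \<otimes> g) ** u (inv g)))"
    proof (rule sum.cong)
      fix k assume k: "k \<in> carrier G"
      have "u (k \<otimes> g) ** u (inv g) = u (k \<otimes> g \<otimes> inv g)" using rep g k by (simp add: representation_def)
      then show "cscale (cnj (left_translate g y (inv k))) (u k) = cscale (cnj (y (inv (k \<otimes> g)))) (u (k \<otimes> g) ** u (inv g))"
        using g k by (simp add: left_translate_def inv_mult_group m_assoc)
    qed simp
    also have "\<dots> = (\<Sum>k\<in>carrier G. cscale (cnj (y (inv k))) (u k ** u (inv g)))"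
      by (rule sum_group_right[OF g])
    also have "\<dots> = (\<Sum>k\<in>carrier G. cscale (cnj (y (inv k))) (u k)) ** u (inv g)"
      by (simp add: sum_mult)
    also have "\<dots> = 0" using y by (simp add: I_def)
    finally show "left_translate g y \<in> I" by (simp add: I_def left_translate_def)
  qed
  define f0 where "f0 x = (if x \<in> carrier G then cnj (c (inv x)) else 0)" for x
  have "(\<Sum>g\<in>carrier G. cscale (cnj (f0 (inv g))) (u g)) = (\<Sum>g\<in>carrier G. cscale (c g) (u g))"
    by (intro sum.cong) (auto simp: f0_def)
  then have f0: "f0 \<in> I" using c by (simp add: I_def f0_def)
  have "f0 (inv h) \<noteq> 0" using h \<open>c h \<noteq> 0\<close> by (simp add: f0_def)
  then have "f0 \<noteq> 0" by auto
  then obtain B where B: "finite B" "fs.independent B" "B \<noteq> {}" "fs.span B \<subseteq> I" "translation_invariant (fs.span B)"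
    "\<And>W. fs.subspace W \<Longrightarrow> W \<subseteq> fs.span B \<Longrightarrow> translation_invariant W \<Longrightarrow> W = {0} \<or> W = fs.span B"
    using minimal_invariant_subspace[OF I_sub I_inv _ f0] by (auto simp: I_def)
  have supp: "f x = 0" if "f \<in> fs.span B" "x \<notin> carrier G" for f x using that B(4) by (auto simp: I_def)
  obtain k \<rho> F where irr: "irreducible_representation G k \<rho>" and F: "F ` carrier_vec k = fs.span B" "F (0\<^sub>v k) = 0"
    and F\<rho>: "\<And>g w. g \<in> carrier G \<Longrightarrow> w \<in> carrier_vec k \<Longrightarrow> F (\<rho> g *\<^sub>v w) = left_translate g (F w)"
    and F_sum: "\<And>w. F w = (\<Sum>i<k. fscale (vec_index w i) (F (unit_vec k i)))"
    by (rule irreducible_from_invariant_subspace[OF B(1,2,3,5)], erule (1) supp, erule (2) B(6), blast intro: that)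
  have \<rho>: "\<rho> g \<in> carrier_mat k k" if "g \<in> carrier G" for g using irr that by (simp add: irreducible_representation_def)
  obtain E where E_add: "\<And>v w. v \<in> carrier_vec k \<Longrightarrow> w \<in> carrier_vec k \<Longrightarrow> E (v + w) = E v + E w"
    and E_smult: "\<And>c v. v \<in> carrier_vec k \<Longrightarrow> E (c \<cdot>\<^sub>v v) = c *s E v" and E_inj: "inj_on E (carrier_vec k)"
    and E\<rho>: "\<And>g v. g \<in> carrier G \<Longrightarrow> v \<in> carrier_vec k \<Longrightarrow> E (\<rho> g *\<^sub>v v) = u g *v (E v :: complex^'n)"
    using contains[OF irr] unfolding contains_representation_def by blast
  have E0: "E (0\<^sub>v k) = 0" using E_smult[of "0\<^sub>v k" 0] by (simp add: smult_zero_vec)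
  obtain y where y: "y \<in> B" using B(3) by blast
  then have y_span: "y \<in> fs.span B" by (rule fs.span_base)
  then obtain w where w: "w \<in> carrier_vec k" "y = F w" using F(1) by blast
  define x where "x g = cnj (y (inv g))" for g
  have x: "(\<Sum>g\<in>carrier G. cscale (x g) (u g)) = 0" using y_span B(4) by (auto simp: I_def x_def)
  define z where "z S = Matrix.vec k (\<lambda>i. \<Sum>g\<in>S. x g * vec_index (\<rho> g *\<^sub>v w) i)" for S
  have \<rho>w: "\<rho> g *\<^sub>v w \<in> carrier_vec k" if "g \<in> carrier G" for g using mult_mat_vec_carrier[OF \<rho>[OF that] w(1)] .
  have Ez: "E (z S) = (\<Sum>g\<in>S. x g *s E (\<rho> g *\<^sub>v w))" if "finite S" "S \<subseteq> carrier G" for S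
    using that
  proof (induction S rule: finite_induct)
    case empty
    have "z {} = 0\<^sub>v k" by (auto simp: z_def)
    then show ?case using E0 by simp
  next
    case (insert g S)
    then have g: "g \<in> carrier G" by simp
    have dims: "dim_vec (\<rho> g *\<^sub>v w) = k" using \<rho>w[OF g] by (rule carrier_vecD)
    have "z (insert g S) = x g \<cdot>\<^sub>v (\<rho> g *\<^sub>v w) + z S"
      by (rule eq_vecI) (use insert(1,2) dims in \<open>simp_all add: z_def del: index_mult_mat_vec dim_mult_mat_vec\<close>)
    moreover have "z S \<in> carrier_vec k" by (simp add: z_def)
    ultimately have "E (z (insert g S)) = x g *s E (\<rho> g *\<^sub>v w) + E (z S)"
      using \<rho>w[OF g] by (simp add: E_add E_smult)
    then show ?case using insert by simp
  qed
  have "E (z (carrier G)) = (\<Sum>g\<in>carrier G. cscale (x g) (u g)) *v E w"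
    using Ez[OF fin order.refl] E\<rho>[OF _ w(1)] by (simp add: matrix_vector_mult_sum cscale_mult_vec)
  then have "E (z (carrier G)) = E (0\<^sub>v k)" using x E0 by simp
  then have z0: "z (carrier G) = 0\<^sub>v k" using inj_onD[OF E_inj] by (simp add: z_def)
  have "F (z (carrier G)) = (\<Sum>g\<in>carrier G. fscale (x g) (F (\<rho> g *\<^sub>v w)))"
  proof -
    have "F (z (carrier G)) = (\<Sum>i<k. fscale (\<Sum>g\<in>carrier G. x g * vec_index (\<rho> g *\<^sub>v w) i) (F (unit_vec k i)))"
      by (subst F_sum) (intro sum.cong refl, simp add: z_def)
    also have "\<dots> = (\<Sum>g\<in>carrier G. fscale (x g) (\<Sum>i<k. fscale (vec_index (\<rho> g *\<^sub>v w) i) (F (unit_vec k i))))"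
      unfolding fs.scale_sum_left fs.scale_sum_right fs.scale_scale by (rule sum.swap)
    finally show ?thesis by (simp only: F_sum[symmetric])
  qed
  \<comment> \<open>At the identity the convolution of \<open>x\<close> with \<open>y\<close> is a
    sum of squared moduli.\<close>
  then have "0 = (\<Sum>g\<in>carrier G. fscale (x g) (left_translate g y)) \<one>"
    using z0 F(2) F\<rho>[OF _ w(1)] w(2) by simp
  also have "\<dots> = (\<Sum>g\<in>carrier G. of_real ((cmod (y (inv g)))\<^sup>2))"
    by (simp add: sum_fun_apply fscale_def x_def left_translate_def complex_norm_square mult.commute del: of_real_power)
  also have "\<dots> = of_real (\<Sum>g\<in>carrier G. (cmod (y (inv g)))\<^sup>2)" by simp
  finally have "(\<Sum>g\<in>carrier G. (cmod (y (inv g)))\<^sup>2) = 0" by (metis of_real_eq_0_iff)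
  then have "\<forall>g\<in>carrier G. y (inv g) = 0" using fin by (simp add: sum_nonneg_eq_0_iff)
  then have "y g = 0" if "g \<in> carrier G" for g using that by (metis inv_closed inv_inv)
  then have "y g = 0" for g using supp[OF y_span] by blast
  then have "y = 0" by (simp add: fun_eq_iff)
  then show False using B(2) y fs.dependent_zero by blast
qed

text \<open>\<open>K\<close> represents, through the trace pairing, the coordinate functional of
  \<open>u \<one>\<close> in the independent family of the \<open>u g\<close>; the pairing
  transposes the indices. Injectivity of \<open>q\<close> comes first, since independence of its
  image as a set would not notice repetitions.\<close>

lemma separating_matrix:
  fixes u :: "'a \<Rightarrow> complex^'n^'n"
  assumes rep: "representation G u"
    and contains: "\<And>k \<rho>. irreducible_representation G k \<rho> \<Longrightarrow> contains_representation G u k \<rho>"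
  obtains K where "separates u K"
proof -
  define q :: "'a \<Rightarrow> complex^('n \<times> 'n)" where "q g = (\<chi> i. u g $ fst i $ snd i)" for g
  have u_q: "u g $ i $ j = q g $ (i, j)" for g i j by (simp add: q_def)
  have inj: "inj_on q (carrier G)"
  proof (rule inj_onI, rule ccontr)
    fix g h assume gh: "g \<in> carrier G" "h \<in> carrier G" "q g = q h" "g \<noteq> h"
    have "u g = u h" using gh(3) by (simp add: vec_eq_iff u_q)
    define c where "c k = (if k = g then 1 else 0) - (if k = h then 1 else (0::complex))" for k
    have "(\<Sum>k\<in>carrier G. cscale (c k) (u k)) = (\<Sum>k\<in>carrier G. (if k = g then u g else 0) - (if k = h then u h else 0))"
      by (intro sum.cong) (auto simp: c_def vec_eq_iff)
    then have "(\<Sum>k\<in>carrier G. cscale (c k) (u k)) = 0" using gh fin \<open>u g = u h\<close> by (simp add: sum_subtractf)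
    then have "c g = 0" using rep_independent[OF rep contains] gh(1) by blast
    then show False using gh(4) by (simp add: c_def)
  qed
  have "vec.independent (q ` carrier G)"
  proof
    assume "vec.dependent (q ` carrier G)"
    then obtain r where r: "\<exists>v\<in>q ` carrier G. r v \<noteq> 0" "(\<Sum>v\<in>q ` carrier G. r v *s v) = 0"
      using vec.dependent_finite[of "q ` carrier G"] fin by auto
    have "(\<Sum>g\<in>carrier G. r (q g) *s q g) = 0" using r(2) by (simp add: sum.reindex[OF inj])
    then have "(\<Sum>g\<in>carrier G. r (q g) * q g $ (i, j)) = 0" for i j by (simp add: vec_eq_iff)
    then have "(\<Sum>g\<in>carrier G. cscale (r (q g)) (u g)) = 0" by (simp add: vec_eq_iff sum_matrix_nth u_q)
    then have "r (q g) = 0" if "g \<in> carrier G" for g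
      using rep_independent[OF rep contains, where c = "\<lambda>g. r (q g)"] that by blast
    then show False using r(1) by auto
  qed
  then obtain l :: "complex^('n \<times> 'n) \<Rightarrow> complex^1" where l: "Vector_Spaces.linear (*s) (*s) l"
    "\<forall>x\<in>q ` carrier G. l x = (if x = q \<one> then 1 else 0)"
    using vec.linear_independent_extend[of "q ` carrier G" "\<lambda>x. if x = q \<one> then 1 else 0"] by blast
  define K :: "complex^'n^'n" where "K = (\<chi> j i. l (axis (i, j) 1) $ 1)"
  have lK: "l (q g) $ 1 = trace (u g ** K)" for g
  proof -
    have "l (q g) = l (\<Sum>i\<in>UNIV. (q g $ i) *s axis i 1)" by (simp flip: vec_as_sum)
    also have "\<dots> = (\<Sum>i\<in>UNIV. (q g $ i) *s l (axis i 1))"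
      by (simp add: vec.linear_sum[OF l(1)] vec.linear_scale[OF l(1)])
    finally show ?thesis by (simp add: sum_pair trace_def mult_nth K_def u_q)
  qed
  have "separates u K"
    unfolding separates_def
  proof
    fix g assume g: "g \<in> carrier G"
    have "trace (u g ** K) = (if q g = q \<one> then 1 else 0)" using l(2) g by (simp flip: lK)
    also have "q g = q \<one> \<longleftrightarrow> g = \<one>" using inj g by (auto simp: inj_on_def)
    finally show "trace (u g ** K) = (if g = \<one> then 1 else 0)" .
  qed
  then show ?thesis using that by blast
qed

text \<open>The trivial representation is irreducible and thus supplies \<open>v\<close>. The
  functional is a row of the group average at an index where \<open>v\<close> is nonzero, scaled to
  pair with \<open>v\<close> to 1.\<close>

lemma invariant_vector:
  fixes u :: "'a \<Rightarrow> complex^'n^'n"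
  assumes rep: "representation G u"
    and contains: "\<And>k \<rho>. irreducible_representation G k \<rho> \<Longrightarrow> contains_representation G u k \<rho>"
  obtains v f where "\<And>g. g \<in> carrier G \<Longrightarrow> u g *v v = v" "\<And>g. g \<in> carrier G \<Longrightarrow> f v* u g = f"
    "(\<Sum>i\<in>UNIV. f $ i * v $ i) = 1"
proof -
  have irr: "irreducible_representation G 1 (\<lambda>_. 1\<^sub>m 1)"
    unfolding irreducible_representation_def
  proof (intro conjI ballI allI impI)
    fix W assume W: "VectorSpace.subspace class_ring W (module_vec TYPE(complex) 1)"
    note Wk = subspace_module_vecD(1)[OF W] and W0 = subspace_module_vecD(2)[OF W] and Wsm = subspace_module_vecD(4)[OF W]
    show "W = {0\<^sub>v 1} \<or> W = carrier_vec 1"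
    proof (rule disjCI)
      assume "W \<noteq> carrier_vec 1"
      have "w = 0\<^sub>v 1" if w: "w \<in> W" for w
      proof (rule ccontr)
        assume "w \<noteq> 0\<^sub>v 1"
        have ne: "vec_index w 0 \<noteq> 0"
        proof
          assume "vec_index w 0 = 0"
          moreover have "dim_vec w = 1" using w Wk by auto
          ultimately have "w = 0\<^sub>v 1" by (intro eq_vecI) auto
          with \<open>w \<noteq> 0\<^sub>v 1\<close> show False ..
        qed
        have "x \<in> W" if x: "x \<in> carrier_vec 1" for x
        proof -
          have "x = (vec_index x 0 / vec_index w 0) \<cdot>\<^sub>v w" using x w Wk ne by (intro eq_vecI) auto
          then show ?thesis using Wsm[OF w] by metis
        qed
        then show False using \<open>W \<noteq> carrier_vec 1\<close> Wk by blast
      qed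
      then show "W = {0\<^sub>v 1}" using W0 by blast
    qed
  qed auto
  obtain E where E_smult: "\<And>c v. v \<in> carrier_vec 1 \<Longrightarrow> E (c \<cdot>\<^sub>v v) = c *s E v" and E_inj: "inj_on E (carrier_vec 1)"
    and E\<rho>: "\<And>g v. g \<in> carrier G \<Longrightarrow> v \<in> carrier_vec 1 \<Longrightarrow> E (1\<^sub>m 1 *\<^sub>v v) = u g *v (E v :: complex^'n)"
    using contains[OF irr] unfolding contains_representation_def by blast
  define v where "v = E (unit_vec 1 0)"
  have v: "u g *v v = v" if "g \<in> carrier G" for g using E\<rho>[OF that, of "unit_vec 1 0"] by (simp add: v_def)
  have "E (0\<^sub>v 1) = 0" using E_smult[of "0\<^sub>v 1" 0] by (simp add: smult_zero_vec)
  then have "v \<noteq> 0" using inj_onD[OF E_inj, of "unit_vec 1 0" "0\<^sub>v 1"] by (auto simp: v_def)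
  then obtain i where i: "v $ i \<noteq> 0" by (auto simp: vec_eq_iff)
  let ?n = "of_nat (card (carrier G)) :: complex"
  define f :: "complex^'n" where "f = (\<chi> j. (\<Sum>g\<in>carrier G. u g $ i $ j) / (?n * v $ i))"
  have "f v* u h = f" if h: "h \<in> carrier G" for h
  proof -
    have "(\<Sum>g\<in>carrier G. u g) ** u h = (\<Sum>g\<in>carrier G. u (g \<otimes> h))"
      using rep h by (simp add: sum_mult representation_def)
    also have "\<dots> = (\<Sum>g\<in>carrier G. u g)" by (rule sum_group_right[OF h])
    finally have "((\<Sum>g\<in>carrier G. u g) ** u h) $ i $ j = (\<Sum>g\<in>carrier G. u g) $ i $ j" for j by simp
    then have "(\<Sum>k\<in>UNIV. (\<Sum>g\<in>carrier G. u g $ i $ k) * u h $ k $ j) = (\<Sum>g\<in>carrier G. u g $ i $ j)" for j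
      by (simp add: mult_nth)
    then show ?thesis
      by (simp add: f_def vec_eq_iff vector_matrix_mult_def mult.commute[of "u h $ _ $ _"] flip: sum_divide_distrib)
  qed
  moreover have "(\<Sum>j\<in>UNIV. f $ j * v $ j) = 1"
  proof -
    have "(\<Sum>j\<in>UNIV. (\<Sum>g\<in>carrier G. u g $ i $ j) * v $ j) = (\<Sum>g\<in>carrier G. (u g *v v) $ i)"
      by (simp add: matrix_vector_mult_def sum_distrib_right) (rule sum.swap)
    also have "\<dots> = ?n * v $ i" using v by simp
    finally show ?thesis using i card_carrier_pos by (simp add: f_def sum_divide_distrib[symmetric])
  qed
  ultimately show ?thesis using that v by blast
qed

end

section \<open>The PEPS state as a torus contraction\<close>

definition site :: "complex^('a \<times> 'a \<times> 'a \<times> 'a)^'p \<Rightarrow> 'p \<Rightarrow> complex^('a::finite \<times> 'a)^('a \<times> 'a)" where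
  "site A p = (\<chi> i j. A $ p $ (fst j, snd j, fst i, snd i))"

lemma site_nth [simp]: "site A p $ (d, l) $ (u, r) = A $ p $ (u, r, d, l)"
  by (simp add: site_def)

lemma site_eq_iff: "A = B \<longleftrightarrow> (\<forall>p. site A p = site B p)"
  by (auto simp: vec_eq_iff)

text \<open>The dual legs are the row indices, so the transposed inverses become left multiplication
  by the inverses and a change of gauge is a conjugation of site matrices.\<close>

lemma site_leg_map:
  "site (B ** leg_map Y X) p = (matrix_inv Y \<otimes>\<^sub>K matrix_inv X) ** site B p ** (Y \<otimes>\<^sub>K X)"
  by (simp add: entrywise leg_map_def transpose_def sum_distrib_left sum_distrib_right mult_ac)

text \<open>A matrix \<open>M\<close> in the commutant is read as a tensor \<open>m\<close> with
  one-dimensional physical space. Invariance means that \<open>m\<close> absorbs the group average,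
  which factors as \<open>L ** A\<close>; the row \<open>m ** L\<close> therefore holds the
  coefficients of \<open>M\<close> in the sites.\<close>

lemma range_site:
  fixes G :: "('g, 'z) monoid_scheme" and u :: "'g \<Rightarrow> complex^'a^'a" and A :: "complex^('a \<times> 'a \<times> 'a \<times> 'a)^'p"
  assumes "group G" "finite (carrier G)" and A: "G_injective G u A"
  shows "range (lincomb (site A)) = centralizer G (tensor2 u)"
proof -
  interpret finite_group G using assms by (simp add: finite_group_def finite_group_axioms_def)
  have rep: "representation G u" using A by (simp add: G_injective_def)
  have key: "(matrix_inv (u g) \<otimes>\<^sub>K matrix_inv (u g)) ** M ** (u g \<otimes>\<^sub>K u g) = M \<longleftrightarrow> (u g \<otimes>\<^sub>K u g) ** M = M ** (u g \<otimes>\<^sub>K u g)"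
    if g: "g \<in> carrier G" for g M
    using rep_conj_iff[OF rep_kron[OF rep rep] g] rep_inv(3)[OF rep g] by simp
  show ?thesis
  proof
    have "site A p \<in> centralizer G (tensor2 u)" for p
    proof -
      have "site A p = (matrix_inv (u g) \<otimes>\<^sub>K matrix_inv (u g)) ** site A p ** (u g \<otimes>\<^sub>K u g)" if "g \<in> carrier G" for g
      proof -
        have "A = A ** leg_map (u g) (u g)" using A that unfolding G_injective_def by blast
        then have "site A p = site (A ** leg_map (u g) (u g)) p" by simp
        then show ?thesis unfolding site_leg_map .
      qed
      then show ?thesis unfolding centralizer_def using key[THEN iffD1, OF _ sym] by blast
    qed
    then show "range (lincomb (site A)) \<subseteq> centralizer G (tensor2 u)"
      unfolding lincomb_def by (auto intro!: centralizer_sum centralizer_cscale)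
    show "centralizer G (tensor2 u) \<subseteq> range (lincomb (site A))"
    proof
      fix M assume M: "M \<in> centralizer G (tensor2 u)"
      define m :: "complex^('a \<times> 'a \<times> 'a \<times> 'a)^1" where "m = (\<chi> _ i. M $ (fst (snd (snd i)), snd (snd (snd i))) $ (fst i, fst (snd i)))"
      have m: "site m p = M" for p by (simp add: vec_eq_iff m_def)
      have m_leg: "m ** leg_map (u g) (u g) = m" if "g \<in> carrier G" for g
        unfolding site_eq_iff site_leg_map m using key[OF that] M that by (simp add: centralizer_def)
      obtain L where L: "L ** A = (1 / real (card (carrier G))) *\<^sub>R (\<Sum>g\<in>carrier G. leg_map (u g) (u g))"
        using A unfolding G_injective_def by blast
      have "m ** L ** A = m ** (L ** A)" by (simp only: matrix_mul_assoc)
      also have "\<dots> = cscale (of_real (1 / real (card (carrier G)))) (\<Sum>g\<in>carrier G. m ** leg_map (u g) (u g))"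
        unfolding L scaleR_conv_cscale by (simp add: sum_mult)
      also have "(\<Sum>g\<in>carrier G. m ** leg_map (u g) (u g)) = (\<Sum>g\<in>carrier G. m)" using m_leg by simp
      also have "cscale (of_real (1 / real (card (carrier G)))) (\<Sum>g\<in>carrier G. m) = m"
        using card_carrier_pos by (simp add: vec_eq_iff sum_matrix_nth del: sum_constant) simp
      finally have mLA: "m ** L ** A = m" .
      have "M = lincomb (site A) (\<lambda>p. (m ** L) $ 1 $ p)"
      proof -
        have "M $ (d, l) $ (v, r) = (\<Sum>p\<in>UNIV. (m ** L) $ 1 $ p * A $ p $ (v, r, d, l))" for d l v r
        proof -
          have "M $ (d, l) $ (v, r) = (m ** L ** A) $ 1 $ (v, r, d, l)" unfolding mLA by (simp add: m_def)
          then show ?thesis by (simp only: mult_nth[of "m ** L"])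
        qed
        then show ?thesis by (simp add: vec_eq_iff lincomb_nth)
      qed
      then show "M \<in> range (lincomb (site A))" by blast
    qed
  qed
qed

lemma G_injective_site_family:
  assumes "group G" "finite (carrier G)" and A: "G_injective G u A"
  obtains K v f where "site_family G u K v f (site A)"
proof -
  interpret finite_group G using assms by (simp add: finite_group_def finite_group_axioms_def)
  have rep: "representation G u" and contains: "\<And>k \<rho>. irreducible_representation G k \<rho> \<Longrightarrow> contains_representation G u k \<rho>"
    using A by (auto simp: G_injective_def)
  obtain K where K: "separates u K" using separating_matrix[OF rep contains] by blast
  obtain v f where vf: "\<And>g. g \<in> carrier G \<Longrightarrow> u g *v v = v" "\<And>g. g \<in> carrier G \<Longrightarrow> f v* u g = f"
    "(\<Sum>i\<in>UNIV. f $ i * v $ i) = 1"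
    using invariant_vector[OF rep contains] by blast
  have "site_family G u K v f (site A)"
    by standard (use rep K vf range_site[OF assms] in auto)
  then show ?thesis using that by blast
qed

section \<open>Coefficients of the state, sorted by columns and by rows\<close>

lemma sum_curry:
  fixes F :: "(nat \<times> nat \<Rightarrow> 'a::finite) \<Rightarrow> complex"
  shows "(\<Sum>h\<in>torus n m \<rightarrow>\<^sub>E UNIV. F h) = (\<Sum>k\<in>{..<n} \<rightarrow>\<^sub>E ({..<m} \<rightarrow>\<^sub>E UNIV). F (\<lambda>q\<in>torus n m. k (fst q) (snd q)))"
    and "(\<Sum>h\<in>torus n m \<rightarrow>\<^sub>E UNIV. F h) = (\<Sum>k\<in>{..<m} \<rightarrow>\<^sub>E ({..<n} \<rightarrow>\<^sub>E UNIV). F (\<lambda>q\<in>torus n m. k (snd q) (fst q)))"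
proof -
  show "(\<Sum>h\<in>torus n m \<rightarrow>\<^sub>E UNIV. F h) = (\<Sum>k\<in>{..<n} \<rightarrow>\<^sub>E ({..<m} \<rightarrow>\<^sub>E UNIV). F (\<lambda>q\<in>torus n m. k (fst q) (snd q)))"
    by (rule sum.reindex_bij_witness[where i = "\<lambda>k. \<lambda>q\<in>torus n m. k (fst q) (snd q)"
          and j = "\<lambda>h. \<lambda>x\<in>{..<n}. \<lambda>y\<in>{..<m}. h (x, y)"])
       (auto simp: torus_def fun_eq_iff PiE_iff extensional_def restrict_def intro!: arg_cong[where f = F])
  show "(\<Sum>h\<in>torus n m \<rightarrow>\<^sub>E UNIV. F h) = (\<Sum>k\<in>{..<m} \<rightarrow>\<^sub>E ({..<n} \<rightarrow>\<^sub>E UNIV). F (\<lambda>q\<in>torus n m. k (snd q) (fst q)))"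
    by (rule sum.reindex_bij_witness[where i = "\<lambda>k. \<lambda>q\<in>torus n m. k (snd q) (fst q)"
          and j = "\<lambda>h. \<lambda>y\<in>{..<m}. \<lambda>x\<in>{..<n}. h (x, y)"])
       (auto simp: torus_def fun_eq_iff PiE_iff extensional_def restrict_def intro!: arg_cong[where f = F])
qed

text \<open>For fixed horizontal indices different columns share no summation index, so the sum over
  the vertical indices distributes over the product of columns.\<close>

lemma peps_state_columns:
  assumes "n \<ge> 1" "m \<ge> 1"
  shows "peps_state A n m (\<lambda>q\<in>torus n m. f (fst q) (snd q)) = torus_contraction n m (\<lambda>x y. site A (f x y))"
proof -
  let ?T = "\<lambda>(k :: nat \<Rightarrow> nat \<Rightarrow> 'a) w x y. site A (f x y) $ (w x ((y + m - 1) mod m), k ((x + n - 1) mod n) y) $ (w x y, k x y)"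
  have "peps_state A n m (\<lambda>q\<in>torus n m. f (fst q) (snd q)) =
    (\<Sum>k\<in>{..<n} \<rightarrow>\<^sub>E ({..<m} \<rightarrow>\<^sub>E UNIV). \<Sum>w\<in>{..<n} \<rightarrow>\<^sub>E ({..<m} \<rightarrow>\<^sub>E UNIV). \<Prod>x<n. \<Prod>y<m. ?T k w x y)"
    using assms unfolding peps_state_def sum_curry(1) prod.cartesian_product
    by (simp add: torus_def[symmetric] PiE_iff) (auto intro!: sum.cong prod.cong simp: torus_def)
  also have "\<dots> = torus_contraction n m (\<lambda>x y. site A (f x y))"
    unfolding torus_contraction_def
    by (rule sum.cong[OF refl], subst prod_sum_PiE) (auto intro!: finite_PiE)
  finally show ?thesis .
qed

text \<open>The same with the directions exchanged: rows become the closed lines, and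
  \<open>flip\<close> lets the left and right legs take the place of the down and up legs.\<close>

lemma peps_state_rows:
  assumes "n \<ge> 1" "m \<ge> 1"
  shows "peps_state A n m (\<lambda>q\<in>torus n m. f (fst q) (snd q)) = torus_contraction m n (\<lambda>y x. flip (site A (f x y)))"
proof -
  let ?T = "\<lambda>(k :: nat \<Rightarrow> nat \<Rightarrow> 'a) w y x. flip (site A (f x y)) $ (w y ((x + n - 1) mod n), k ((y + m - 1) mod m) x) $ (w y x, k y x)"
  have "peps_state A n m (\<lambda>q\<in>torus n m. f (fst q) (snd q)) =
    (\<Sum>w\<in>{..<m} \<rightarrow>\<^sub>E ({..<n} \<rightarrow>\<^sub>E UNIV). \<Sum>k\<in>{..<m} \<rightarrow>\<^sub>E ({..<n} \<rightarrow>\<^sub>E UNIV). \<Prod>x<n. \<Prod>y<m. ?T k w y x)"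
    using assms unfolding peps_state_def sum_curry(2) prod.cartesian_product
    by (simp add: torus_def[symmetric] PiE_iff) (auto intro!: sum.cong prod.cong simp: torus_def)
  also have "\<dots> = (\<Sum>k\<in>{..<m} \<rightarrow>\<^sub>E ({..<n} \<rightarrow>\<^sub>E UNIV). \<Sum>w\<in>{..<m} \<rightarrow>\<^sub>E ({..<n} \<rightarrow>\<^sub>E UNIV). \<Prod>y<m. \<Prod>x<n. ?T k w y x)"
    by (subst sum.swap) (simp only: prod.swap[of _ "{..<m}"])
  also have "\<dots> = torus_contraction m n (\<lambda>y x. flip (site A (f x y)))"
    unfolding torus_contraction_def
    by (rule sum.cong[OF refl], subst prod_sum_PiE) (auto intro!: finite_PiE)
  finally show ?thesis .
qed

theorem theorem2p1:
  fixes G :: "('g, 'z) monoid_scheme"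
    and u\<^sub>A :: "'g \<Rightarrow> complex^'a^'a"
    and u\<^sub>B :: "'g \<Rightarrow> complex^'b^'b"
    and A :: "complex^('a \<times> 'a \<times> 'a \<times> 'a)^'p"
    and B :: "complex^('b \<times> 'b \<times> 'b \<times> 'b)^'p"
  assumes "group G" and "finite (carrier G)"
    and "G_injective G u\<^sub>A A" and "G_injective G u\<^sub>B B"
    and "\<And>n m. n \<ge> 1 \<Longrightarrow> m \<ge> 1 \<Longrightarrow> peps_state A n m = peps_state B n m"
  shows "\<exists>X Y :: complex^'a^'b. invertible X \<and> invertible Y \<and> A = B ** leg_map Y X"
proof -
  obtain K\<^sub>A v\<^sub>A f\<^sub>A where A: "site_family G u\<^sub>A K\<^sub>A v\<^sub>A f\<^sub>A (site A)"
    using G_injective_site_family[OF assms(1-3)] .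
  obtain K\<^sub>B v\<^sub>B f\<^sub>B where B: "site_family G u\<^sub>B K\<^sub>B v\<^sub>B f\<^sub>B (site B)"
    using G_injective_site_family[OF assms(1,2,4)] .
  interpret torus_equal G u\<^sub>A K\<^sub>A v\<^sub>A f\<^sub>A "site A" u\<^sub>B K\<^sub>B v\<^sub>B f\<^sub>B "site B"
  proof (intro torus_equal.intro torus_equal_axioms.intro A B)
    fix n m :: nat and q :: "nat \<Rightarrow> nat \<Rightarrow> 'p"
    assume nm: "n \<ge> 1" "m \<ge> 1"
    show "torus_contraction n m (\<lambda>x y. site A (q x y)) = torus_contraction n m (\<lambda>x y. site B (q x y))"
      using assms(5)[OF nm] peps_state_columns[OF nm, of A q] peps_state_columns[OF nm, of B q] by simp
    \<comment> \<open>Transposing \<open>q\<close> and exchanging the side lengths reads the state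
      on the transposed torus row by row.\<close>
    show "torus_contraction n m (\<lambda>x y. flip (site A (q x y))) = torus_contraction n m (\<lambda>x y. flip (site B (q x y)))"
      using assms(5)[OF nm(2,1)] peps_state_rows[OF nm(2,1), of A "\<lambda>x y. q y x"] peps_state_rows[OF nm(2,1), of B "\<lambda>x y. q y x"]
      by simp
  qed
  obtain X Y :: "complex^'a^'b" where XY: "invertible X" "invertible Y"
    and gauge: "\<And>s. site B s ** (Y \<otimes>\<^sub>K X) = (Y \<otimes>\<^sub>K X) ** site A s"
    by (rule gauge_exists) (blast intro: that)
  have inv: "matrix_inv M ** M = mat 1" if "invertible M" for M :: "complex^'a^'b"
    using that matrix_inv_eqI unfolding invertible_def by metis
  have "site A s = site (B ** leg_map Y X) s" for s
    unfolding site_leg_map matrix_mul_assoc[symmetric] gauge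
    by (simp add: matrix_mul_assoc kron_mult inv XY kron_one)
  then have "A = B ** leg_map Y X" by (simp add: site_eq_iff)
  then show ?thesis using XY by blast
qed

end
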